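(* Let $m\ge 3$ and let $h:\mathrm{PConf}_n(\mathbb{CP}^1)\to\mathrm{PConf}_m(\mathbb{CP}^1)$ be a holomorphic map. Then up to a permutation of the coordinates on the domain and twisting by a holomorphic map $A:\mathrm{PConf}_n(\mathbb{CP}^1)\to\mathrm{PSL}(2,\mathbb{C})$, $h$ is either a constant map or a forgetful map.
   Context: $\mathrm{PConf}_n(\mathbb{CP}^1)$ is the complex manifold of ordered $n$-tuples of distinct points of $\mathbb{CP}^1$. $\mathrm{PSL}(2,\mathbb{C})=\mathrm{Aut}(\mathbb{CP}^1)$ acts diagonally on $\mathrm{PConf}_m(\mathbb{CP}^1)$ by Möbius transformations. The twist of $h$ by a holomorphic map $A:\mathrm{PConf}_n(\mathbb{CP}^1)\to\mathrm{PSL}(2,\mathbb{C})$ is $h^A(x)=A(x)(h(x))$. A forgetful map is $(x_1,\dots,x_n)\mapsto(x_1,\dots,x_m)$ for $m\le n$ (including the identity when $m=n$). *)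

theory Defs
  imports "HOL-Analysis.Analysis"
begin

section \<open>Complex manifolds given by explicit atlases\<close>

text \<open>A map between open subsets of complex coordinate spaces is holomorphic if it has a
  complex-linear Frechet derivative everywhere.\<close>

definition holomorphic_vec_on ::
  "(complex^'a::finite \<Rightarrow> complex^'b::finite) \<Rightarrow> (complex^'a) set \<Rightarrow> bool" where
  "holomorphic_vec_on f S \<longleftrightarrow>
     (\<forall>z\<in>S. \<exists>f'. (f has_derivative f') (at z within S) \<and> (\<forall>c v. f' (c *s v) = c *s f' v))"

type_synonym ('p, 'a) chart = "'p set \<times> ('p \<Rightarrow> complex^'a)"

text \<open>The manifold carried by an atlas is the union of the chart domains; its topology is the one
  making every chart a homeomorphism onto an open set.\<close>

definition atlas_carrier :: "('p, 'a::finite) chart set \<Rightarrow> 'p set" where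
  "atlas_carrier \<A> = (\<Union>(U, \<phi>)\<in>\<A>. U)"

text \<open>The openness clause says that \<open>f\<close> is continuous for the topologies determined by the
  atlases. Values of \<open>f\<close> outside the carrier are irrelevant.\<close>

definition holomorphic_map ::
  "('p, 'a::finite) chart set \<Rightarrow> ('q, 'b::finite) chart set \<Rightarrow> ('p \<Rightarrow> 'q) \<Rightarrow> bool" where
  "holomorphic_map \<A> \<B> f \<longleftrightarrow>
     f ` atlas_carrier \<A> \<subseteq> atlas_carrier \<B> \<and>
     (\<forall>(U, \<phi>)\<in>\<A>. \<forall>(V, \<psi>)\<in>\<B>.
        open (\<phi> ` (U \<inter> f -` V)) \<and>
        holomorphic_vec_on (\<psi> \<circ> f \<circ> inv_into U \<phi>) (\<phi> ` (U \<inter> f -` V)))"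


section \<open>The complex projective line\<close>

definition proportional :: "complex^2 \<Rightarrow> complex^2 \<Rightarrow> bool" where
  "proportional v w \<longleftrightarrow> v \<noteq> 0 \<and> w \<noteq> 0 \<and> (\<exists>c. c \<noteq> 0 \<and> w = c *s v)"

lemma proportional_part_equivp: "part_equivp proportional"
proof (rule part_equivpI)
  show "\<exists>x. proportional x x"
    by (rule exI[of _ "axis 1 1"])
       (auto simp: proportional_def axis_eq_0_iff intro!: exI[of _ 1])
  show "symp proportional"
  proof (rule sympI)
    fix v w assume "proportional v w"
    then obtain c where "v \<noteq> 0" "w \<noteq> 0" "c \<noteq> 0" "w = c *s v"
      by (auto simp: proportional_def)
    then show "proportional w v"
      unfolding proportional_def by (intro conjI exI[of _ "inverse c"]) auto
  qed
  show "transp proportional"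
  proof (rule transpI)
    fix u v w assume "proportional u v" "proportional v w"
    then obtain c d where "u \<noteq> 0" "w \<noteq> 0" "c \<noteq> 0" "v = c *s u" "d \<noteq> 0" "w = d *s v"
      by (auto simp: proportional_def)
    then show "proportional u w"
      unfolding proportional_def by (intro conjI exI[of _ "d * c"]) auto
  qed
qed

quotient_type cp1 = "complex^2" / partial: proportional
  by (rule proportional_part_equivp)

text \<open>Affine charts of the projective line. In the index type \<open>2\<close> one has \<open>2 = 0\<close>, so \<open>j + 1\<close> is
  the index other than \<open>j\<close>.\<close>

lift_definition cp1_nonzero :: "2 \<Rightarrow> cp1 \<Rightarrow> bool" is "\<lambda>j v. v $ j \<noteq> 0"
  by (auto simp: proportional_def)

lift_definition cp1_affine :: "2 \<Rightarrow> cp1 \<Rightarrow> complex" is "\<lambda>j v. v $ (j + 1) / v $ j"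
  by (auto simp: proportional_def)


section \<open>Configuration spaces\<close>

definition PConf :: "(cp1^'n::finite) set" where
  "PConf = {x. inj (($) x)}"

text \<open>The product atlas of the affine charts, restricted to \<open>PConf\<close>: \<open>s i\<close> selects the affine
  chart used for the \<open>i\<close>-th point.\<close>

definition PConf_atlas :: "(cp1^'n, 'n::finite) chart set" where
  "PConf_atlas =
     (\<Union>s. {({x \<in> PConf. \<forall>i. cp1_nonzero (s i) (x $ i)}, \<lambda>x. \<chi> i. cp1_affine (s i) (x $ i))})"


section \<open>The group PSL(2,C)\<close>

definition sl2_equiv :: "complex^2^2 \<Rightarrow> complex^2^2 \<Rightarrow> bool" where
  "sl2_equiv A B \<longleftrightarrow> det A = 1 \<and> det B = 1 \<and> (B = A \<or> B = - A)"

lemma sl2_equiv_part_equivp: "part_equivp sl2_equiv"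
proof (rule part_equivpI)
  show "\<exists>x. sl2_equiv x x"
    by (rule exI[of _ "mat 1"]) (auto simp: sl2_equiv_def)
  show "symp sl2_equiv"
    by (rule sympI) (auto simp: sl2_equiv_def)
  show "transp sl2_equiv"
    by (rule transpI) (auto simp: sl2_equiv_def)
qed

quotient_type psl2 = "complex^2^2" / partial: sl2_equiv
  by (rule sl2_equiv_part_equivp)

text \<open>PSL(2,C) is identified with the open subset of the projective space of 2-by-2 matrices
  where the determinant does not vanish, and inherits its four affine charts: on the set where the
  \<open>(i,j)\<close> entry is nonzero, the coordinates are the other three entries divided by it.\<close>

lift_definition psl2_nonzero :: "2 \<Rightarrow> 2 \<Rightarrow> psl2 \<Rightarrow> bool" is "\<lambda>i j A. A $ i $ j \<noteq> 0"
  by (auto simp: sl2_equiv_def)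

lift_definition psl2_affine :: "2 \<Rightarrow> 2 \<Rightarrow> psl2 \<Rightarrow> complex^3" is
  "\<lambda>i j A. vector [A $ i $ (j + 1) / A $ i $ j,
                   A $ (i + 1) $ j / A $ i $ j,
                   A $ (i + 1) $ (j + 1) / A $ i $ j]"
  by (auto simp: sl2_equiv_def)

definition psl2_atlas :: "(psl2, 3) chart set" where
  "psl2_atlas = (\<Union>i j. {({g. psl2_nonzero i j g}, psl2_affine i j)})"

lemma sl2_mult_eq_0_iff:
  fixes A :: "complex^2^2"
  assumes "det A = 1"
  shows "A *v v = 0 \<longleftrightarrow> v = 0"
  using assms by (metis invertible_det_nz invertible_def matrix_vector_mul_assoc
      matrix_vector_mul_lid matrix_vector_mult_0_right zero_neq_one)

lift_definition moebius :: "psl2 \<Rightarrow> cp1 \<Rightarrow> cp1" is "\<lambda>A v. A *v v"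
proof -
  fix A B :: "complex^2^2" and v w :: "complex^2"
  assume "sl2_equiv A B" and "proportional v w"
  then have det: "det A = 1" "det B = 1" and AB: "B = A \<or> B = - A"
    and "v \<noteq> 0" "w \<noteq> 0" by (auto simp: sl2_equiv_def proportional_def)
  obtain c where c: "c \<noteq> 0" "w = c *s v"
    using \<open>proportional v w\<close> by (auto simp: proportional_def)
  have "(- A) *v u = - (A *v u)" for u
    by (metis matrix_vector_mult_diff_rdistrib diff_0 matrix_vector_mult_0)
  then have "B *v w = c *s (A *v v) \<or> B *v w = (- c) *s (A *v v)"
    using AB c by (auto simp: vector_scalar_commute)
  then show "proportional (A *v v) (B *v w)"
    unfolding proportional_def using c det \<open>v \<noteq> 0\<close> \<open>w \<noteq> 0\<close>
    by (metis sl2_mult_eq_0_iff neg_equal_0_iff_equal)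
qed

definition moebius_diag :: "psl2 \<Rightarrow> cp1^'m::finite \<Rightarrow> cp1^'m" where
  "moebius_diag g y = (\<chi> i. moebius g (y $ i))"

definition twist :: "('p \<Rightarrow> psl2) \<Rightarrow> ('p \<Rightarrow> cp1^'m::finite) \<Rightarrow> 'p \<Rightarrow> cp1^'m" where
  "twist A h x = moebius_diag (A x) (h x)"


section \<open>Permutations of coordinates and forgetful maps\<close>

definition permute_coords :: "('n \<Rightarrow> 'n) \<Rightarrow> cp1^'n::finite \<Rightarrow> cp1^'n" where
  "permute_coords \<sigma> x = (\<chi> i. x $ \<sigma> i)"

text \<open>The points of a configuration are listed in the order of the index type. The map
  \<open>(x\<^sub>1, \<dots>, x\<^sub>n) \<mapsto> (x\<^sub>1, \<dots>, x\<^sub>m)\<close> is then restriction along the order isomorphism \<open>\<iota>\<close> of the index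
  type \<open>'m\<close> onto an initial segment of \<open>'n\<close>; such an \<open>\<iota>\<close> exists iff \<open>m \<le> n\<close>, and is unique.\<close>

definition initial_embedding :: "('m::linorder \<Rightarrow> 'n::linorder) \<Rightarrow> bool" where
  "initial_embedding \<iota> \<longleftrightarrow> strict_mono \<iota> \<and> (\<forall>i. \<forall>k\<le>\<iota> i. k \<in> range \<iota>)"

definition forgetful_on_PConf ::
  "(cp1^'n::{finite,linorder} \<Rightarrow> cp1^'m::{finite,linorder}) \<Rightarrow> bool" where
  "forgetful_on_PConf f \<longleftrightarrow>
     (\<exists>\<iota>::'m \<Rightarrow> 'n. initial_embedding \<iota> \<and> (\<forall>x\<in>PConf. f x = (\<chi> i. x $ \<iota> i)))"

end

theory Submission
  imports Defs "HOL-Complex_Analysis.Complex_Analysis"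
begin

text \<open>
  The cross-ratio of \<open>h\<^sub>p, h\<^sub>q, h\<^sub>r, h\<^sub>j\<close> is, for fixed \<open>p, q, r\<close>, a holomorphic function on the
  configuration space that omits \<open>0\<close>, \<open>1\<close> and \<open>\<infinity>\<close>, and it does not change when \<open>h\<close> is twisted. So
  everything rests on knowing such functions: each is constant or the cross-ratio of four of the
  points (\<open>omits_01_classification\<close>).

  For this, fix all points but \<open>z\<^sub>i\<close>. The function \<open>f\<close> is then holomorphic on the complement of the
  finitely many points \<open>z\<^sub>j\<close>, also at \<open>\<infinity>\<close>, and omits two values. The great Picard theorem removes
  essential singularities, and Liouville's theorem gives \<open>f = c \<Prod>\<^sub>j (z\<^sub>i - z\<^sub>j)\<^bsup>a i j\<^esup>\<close>. The exponents are
  integers, and by analytic continuation they cannot change when the other points move; the same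
  holds for \<open>1 - f\<close>, with exponents \<open>b i j\<close>. Now let \<open>z\<^sub>i\<close> tend to \<open>z\<^sub>j\<close> where \<open>a i j > 0\<close>. Then \<open>f\<close>
  tends to \<open>0\<close>, so \<open>1 - f\<close> tends to \<open>1\<close> whatever the remaining points are, and the product for
  \<open>1 - f\<close> must become trivial on the diagonal \<open>z\<^sub>i = z\<^sub>j\<close>. This is \<open>zero_edge\<close>; with its analogues
  for \<open>1 - f\<close> and \<open>1 / f\<close> it is a condition on a graph whose edges are marked as zeros, ones or poles
  of \<open>f\<close>. The only solutions are the empty graph and the complete graph on four vertices whose
  three perfect matchings are the zeros, the ones and the poles, all with one multiplicity \<open>w\<close>.
  Finally \<open>w = 1\<close>, because three powers of distinct linear forms with exponent at least two satisfy
  no relation with nonzero coefficients. That is a cross-ratio.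

  If all these cross-ratios are constant, the twist that moves \<open>h\<^sub>p, h\<^sub>q, h\<^sub>r\<close> to three fixed points
  makes \<open>h\<close> constant. Otherwise all of them are cross-ratios of four points, since the cross-ratio of
  \<open>h\<^sub>p, h\<^sub>q, h\<^sub>r, h\<^sub>j\<close> never equals the one for another index \<open>k\<close> and a cross-ratio of four points
  attains every value except \<open>0, 1, \<infinity>\<close>. The quotient of two of them omits \<open>0\<close>, \<open>1\<close>, \<open>\<infinity>\<close> once
  more, so it is classified too, and comparing exponents shows that the two quadruples have three
  entries in common in the same positions, up to the Klein four-group that fixes cross-ratios. Hence
  one triple serves all \<open>j\<close> (\<open>cratio_family_common_triple\<close>), and the twist that moves
  \<open>h\<^sub>p, h\<^sub>q, h\<^sub>r\<close> to these three points of the configuration makes \<open>h\<close> a projection to coordinates. Each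
  of the two twists is given by a matrix that is polynomial in homogeneous coordinates of the points
  involved, and is therefore holomorphic (\<open>ex_holomorphic_moebius_transport\<close>).
\<close>

text \<open>The symbol \<open>$\<close> is to mean vector components only, not coefficients of power series.\<close>

unbundle no Formal_Power_Series.fps_syntax

section \<open>Functions of one variable omitting two values\<close>

text \<open>Orders of vanishing are read off from limits: this is how two expressions with different exponents
  are told apart throughout.\<close>

lemma powi_diff_tendsto_nonzero_imp_exponent_0:
  fixes a :: complex
  assumes lim: "((\<lambda>t. (t - a) powi d) \<longlongrightarrow> L) (at a)" and "L \<noteq> 0"
  shows "d = 0"
proof (rule ccontr)
  assume "d \<noteq> 0"
  have pos: False if "((\<lambda>t. (t - a) powi d) \<longlongrightarrow> L) (at a)" "d > 0" "L \<noteq> 0" for d L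
  proof -
    have "((\<lambda>t. (t - a) powi d) \<longlongrightarrow> 0 powi d) (at a)"
      using that by (intro tendsto_power_int' tendsto_eq_intros) auto
    then have "L = 0" using that tendsto_unique[OF _ that(1)] by fastforce
    then show False using that by simp
  qed
  show False
  proof (cases "d > 0")
    case True then show False using pos assms by blast
  next
    case False
    have "((\<lambda>t. inverse ((t - a) powi d)) \<longlongrightarrow> inverse L) (at a)"
      using assms by (intro tendsto_intros)
    then have "((\<lambda>t. (t - a) powi (-d)) \<longlongrightarrow> inverse L) (at a)"
      by (simp add: power_int_minus)
    then show False using pos[of "-d" "inverse L"] False \<open>d \<noteq> 0\<close> \<open>L \<noteq> 0\<close> by auto
  qed
qed

lemma prod_powi_nonzero:
  assumes "finite J" "t \<notin> p ` J"
  shows "(\<Prod>j\<in>J. (t - p j :: complex) powi e j) \<noteq> 0"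
  using assms by auto

lemma tendsto_prod_powi:
  assumes "a \<notin> p ` J"
  shows "((\<lambda>t. \<Prod>j\<in>J. (t - p j :: complex) powi e j) \<longlongrightarrow> (\<Prod>j\<in>J. (a - p j) powi e j)) (at a)"
  using assms by (intro tendsto_intros) auto

text \<open>The exponent at a point is the order of the function there. The finite set \<open>K\<close> allows the identity to be
  known only away from some further points.\<close>

lemma prod_powi_exponents_unique:
  fixes p :: "'i \<Rightarrow> complex"
  assumes J: "finite J" "inj_on p J" and c: "c \<noteq> 0" "c' \<noteq> 0" and K: "finite K"
    and eq: "\<And>t. t \<notin> p ` J \<Longrightarrow> t \<notin> K \<Longrightarrow>
      c * (\<Prod>j\<in>J. (t - p j) powi e j) = c' * (\<Prod>j\<in>J. (t - p j) powi e' j)"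
    and "i \<in> J"
  shows "e i = e' i"
proof -
  define I where "I = J - {i}"
  have I: "finite I" "i \<notin> I" "J = insert i I" "p i \<notin> p ` I"
    using J \<open>i \<in> J\<close> by (auto simp: I_def inj_on_def)
  define G where "G = (\<lambda>e t. \<Prod>j\<in>I. (t - p j) powi e j)"
  have nz: "G e (p i) \<noteq> 0" for e unfolding G_def using I by (intro prod_powi_nonzero) auto
  have "eventually (\<lambda>t. t \<in> - (p ` J \<union> K - {p i}) - {p i}) (at (p i))"
    using J K by (intro eventually_at_in_open open_Compl finite_imp_closed) auto
  then have ev: "eventually (\<lambda>t. (t - p i) powi (e i - e' i) = c' * G e' t / (c * G e t)) (at (p i))"
  proof (rule eventually_mono)
    fix t assume t: "t \<in> - (p ` J \<union> K - {p i}) - {p i}"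
    then have t': "t \<notin> p ` J" "t \<notin> K" "t \<noteq> p i" by auto
    then have "G e t \<noteq> 0" unfolding G_def using I by (intro prod_powi_nonzero) auto
    moreover have "c * ((t - p i) powi e i * G e t) = c' * ((t - p i) powi e' i * G e' t)"
      using eq[OF t'(1,2)] I by (simp add: G_def)
    ultimately show "(t - p i) powi (e i - e' i) = c' * G e' t / (c * G e t)"
      using c t' by (simp add: power_int_diff field_simps)
  qed
  have "((\<lambda>t. c' * G e' t / (c * G e t)) \<longlongrightarrow> c' * G e' (p i) / (c * G e (p i))) (at (p i))"
    using nz c I unfolding G_def by (intro tendsto_intros tendsto_prod_powi) auto
  then have "((\<lambda>t. (t - p i) powi (e i - e' i)) \<longlongrightarrow> c' * G e' (p i) / (c * G e (p i))) (at (p i))"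
    using ev by (simp add: tendsto_cong)
  from powi_diff_tendsto_nonzero_imp_exponent_0[OF this] show ?thesis using nz c by auto
qed

text \<open>Divide out the zero or pole at each puncture in turn; what remains extends over all punctures.\<close>

lemma entire_nonvanishing_factor:
  fixes p :: "'i \<Rightarrow> complex"
  assumes "finite J" "inj_on p J" "f holomorphic_on - p ` J"
    and "\<And>t. t \<notin> p ` J \<Longrightarrow> f t \<noteq> 0"
    and "\<And>j. j \<in> J \<Longrightarrow> not_essential f (p j)"
  shows "\<exists>e g. g holomorphic_on UNIV \<and> (\<forall>t. g t \<noteq> 0) \<and>
    (\<forall>t. t \<notin> p ` J \<longrightarrow> f t = g t * (\<Prod>j\<in>J. (t - p j) powi e j))"
  using assms
proof (induction J arbitrary: f rule: finite_induct)
  case empty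
  then show ?case by (intro exI[of _ f] exI) auto
next
  case (insert i J)
  have op: "open (- p ` J)" "open (- p ` insert i J)"
    using insert by (auto intro!: finite_imp_closed simp: open_Compl simp del: image_insert)
  have pi: "p i \<notin> p ` J" using insert by (auto simp: inj_on_def)
  have iso: "isolated_singularity_at f (p i)"
    by (rule isolated_singularity_at_holomorphic[of _ "- p ` J"])
      (use insert.prems op pi in \<open>auto intro: holomorphic_on_subset\<close>)
  have "\<forall>\<^sub>F w in at (p i). f w \<noteq> 0"
    using eventually_at_in_open[OF op(1), of "p i"] pi
    by (auto elim!: eventually_mono intro!: insert.prems)
  then have fr: "\<exists>\<^sub>F w in at (p i). f w \<noteq> 0"
    by (simp add: eventually_frequently)
  obtain h n r where h: "h (p i) \<noteq> 0" "r > 0" "h holomorphic_on cball (p i) r"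
    and fh: "\<And>w. w \<in> cball (p i) r - {p i} \<Longrightarrow> f w = h w * (w - p i) powi n"
    using zorder_exist[OF iso insert.prems(4) fr] by blast
  define f2 where "f2 = (\<lambda>t. if t = p i then h (p i) else f t * (t - p i) powi (- n))"
  have f2h: "f2 w = h w" if "w \<in> cball (p i) r" for w
    using fh[of w] that by (auto simp: f2_def power_int_minus)
  have "f2 holomorphic_on ball (p i) r"
    by (rule holomorphic_transform[OF holomorphic_on_subset[OF h(3)]]) (auto simp: f2h)
  moreover have "f2 holomorphic_on (- p ` insert i J)"
  proof (rule holomorphic_transform)
    show "(\<lambda>t. f t * (t - p i) powi (- n)) holomorphic_on (- p ` insert i J)"
      by (intro holomorphic_intros insert.prems) auto
  qed (auto simp: f2_def)
  ultimately have "f2 holomorphic_on (ball (p i) r \<union> - p ` insert i J)"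
    using op by (intro holomorphic_on_Un) auto
  then have hol2: "f2 holomorphic_on (- p ` J)"
    by (rule holomorphic_on_subset) (use h in auto)
  have ne2: "f2 t \<noteq> 0" if "t \<notin> p ` J" for t
    using that h insert.prems(3)[of t] by (auto simp: f2_def)
  have ness: "not_essential f2 (p j)" if "j \<in> J" for j
  proof -
    have ne: "p j \<noteq> p i" using pi that by (metis imageI)
    have 1: "not_essential (\<lambda>t. f t * (t - p i) powi (- n)) (p j)"
    proof (rule not_essential_times)
      show "not_essential f (p j)" using insert.prems that by auto
      have an: "(\<lambda>t. (t - p i) powi (- n)) analytic_on {p j}"
        using ne by (intro analytic_intros) auto
      show "not_essential (\<lambda>t. (t - p i) powi (- n)) (p j)"
        by (rule not_essential_analytic[OF an])
      show "isolated_singularity_at (\<lambda>t. (t - p i) powi (- n)) (p j)"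
        by (rule isolated_singularity_at_analytic[OF an])
      have oj: "open (- p ` (insert i J - {j}))"
        using insert by (auto intro!: finite_imp_closed simp: open_Compl)
      show "isolated_singularity_at f (p j)"
      proof (rule isolated_singularity_at_holomorphic[OF _ oj])
        show "p j \<in> - p ` (insert i J - {j})"
          using insert.prems(1) that by (auto simp: inj_on_def)
      next
        show "f holomorphic_on - p ` (insert i J - {j}) - {p j}"
          by (rule holomorphic_on_subset[OF insert.prems(2)]) auto
      qed
    qed
    have "\<forall>\<^sub>F t in at (p j). f2 t = f t * (t - p i) powi (- n)"
      using eventually_neq_at_within[of "p i" "p j" UNIV]
      by (rule eventually_mono) (simp add: f2_def)
    from 1 not_essential_cong[OF this refl] show ?thesis by simp
  qed
  obtain e g where eg: "g holomorphic_on UNIV" "\<forall>t. g t \<noteq> 0"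
    "\<forall>t. t \<notin> p ` J \<longrightarrow> f2 t = g t * (\<Prod>j\<in>J. (t - p j) powi e j)"
    using insert.IH[OF _ hol2 ne2 ness] insert.prems(1) by auto
  have "f t = g t * (\<Prod>j\<in>insert i J. (t - p j) powi (e(i := n)) j)" if t: "t \<notin> p ` insert i J" for t
  proof -
    have "f t = f2 t * (t - p i) powi n"
      using t by (auto simp: f2_def power_int_minus)
    moreover have "(\<Prod>j\<in>J. (t - p j) powi (e(i := n)) j) = (\<Prod>j\<in>J. (t - p j) powi e j)"
      using insert.hyps by (intro prod.cong) auto
    ultimately show ?thesis using t eg(3) insert.hyps by simp
  qed
  then show ?case using eg by blast
qed

lemma tendsto_prod_powi_at_infinity:
  fixes p :: "'i \<Rightarrow> complex"
  assumes "finite J"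
  shows "((\<lambda>t. (\<Prod>j\<in>J. (t - p j) powi e j) / t powi (sum e J)) \<longlongrightarrow> 1) at_infinity"
proof -
  have "((\<lambda>t. \<Prod>j\<in>J. ((t - p j) / t) powi e j) \<longlongrightarrow> (\<Prod>j\<in>J. 1 powi e j)) at_infinity"
  proof (intro tendsto_prod tendsto_power_int)
    fix j
    have "((\<lambda>t. 1 - p j * inverse t) \<longlongrightarrow> 1 - p j * 0) at_infinity"
      by (intro tendsto_intros tendsto_inverse_0)
    then show "((\<lambda>t. (t - p j) / t) \<longlongrightarrow> 1) at_infinity"
    proof (rule Lim_transform_eventually[where f = "\<lambda>t. 1 - p j * inverse t", THEN tendsto_eq_rhs])
      show "\<forall>\<^sub>F x in at_infinity. 1 - p j * inverse x = (x - p j) / x"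
        using eventually_not_equal_at_infinity[of 0]
        by eventually_elim (auto simp: field_simps)
    qed simp
  qed auto
  then have *: "((\<lambda>t. \<Prod>j\<in>J. ((t - p j) / t) powi e j) \<longlongrightarrow> 1) at_infinity" by simp
  show ?thesis
  proof (rule Lim_transform_eventually[OF *])
    show "\<forall>\<^sub>F t in at_infinity. (\<Prod>j\<in>J. ((t - p j) / t) powi e j) =
        (\<Prod>j\<in>J. (t - p j) powi e j) / t powi (sum e J)"
      using eventually_not_equal_at_infinity[of 0]
    proof eventually_elim
      case (elim t)
      have "t powi (sum e J) = (\<Prod>j\<in>J. t powi e j)"
        using \<open>finite J\<close> elim by (induction J rule: finite_induct) (auto simp: power_int_add)
      then show ?case by (simp add: power_int_divide_distrib prod_dividef)
    qed
  qed
qed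

text \<open>Liouville's theorem, applied to \<open>g\<close> or to \<open>1 / g\<close> according to the sign of \<open>N\<close>: one of the two has a finite
  limit at infinity.\<close>

lemma entire_limit_powi_imp_constant:
  assumes g: "g holomorphic_on UNIV" "\<And>t. g t \<noteq> 0"
    and lim: "((\<lambda>t. g t * t powi N) \<longlongrightarrow> l) at_infinity" and "l \<noteq> 0"
  shows "N = 0 \<and> g constant_on UNIV"
proof -
  have pos: "N = 0 \<and> g constant_on UNIV"
    if g: "g holomorphic_on UNIV" "\<And>t. g t \<noteq> 0"
    and lim: "((\<lambda>t. g t * t powi N) \<longlongrightarrow> l) at_infinity" "l \<noteq> 0" and N: "N \<ge> 0" for g l N
  proof -
    have inv: "((\<lambda>t::complex. inverse t) \<longlongrightarrow> 0) at_infinity" by (rule tendsto_inverse_0)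
    have "((\<lambda>t. (g t * t powi N) * inverse t ^ nat N) \<longlongrightarrow> l * 0 ^ nat N) at_infinity"
      by (intro tendsto_intros lim inv)
    then have "(g \<longlongrightarrow> l * 0 ^ nat N) at_infinity"
    proof (rule Lim_transform_eventually)
      show "\<forall>\<^sub>F t in at_infinity. (g t * t powi N) * inverse t ^ nat N = g t"
        using eventually_not_equal_at_infinity[of 0]
        by eventually_elim (use N in \<open>auto simp: power_int_nonneg_exp field_simps\<close>)
    qed
    then have gc: "g t = l * 0 ^ nat N" for t using Liouville_weak[OF g(1)] by blast
    then have "N = 0" using g(2)[of 0] N by (cases "nat N = 0") auto
    then show ?thesis using gc by (auto simp: constant_on_def)
  qed
  show ?thesis
  proof (cases "N \<ge> 0")
    case True then show ?thesis using pos g lim \<open>l \<noteq> 0\<close> by blast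
  next
    case False
    have "((\<lambda>t. inverse (g t * t powi N)) \<longlongrightarrow> inverse l) at_infinity"
      using lim \<open>l \<noteq> 0\<close> by (intro tendsto_intros)
    then have "((\<lambda>t. inverse (g t) * t powi (- N)) \<longlongrightarrow> inverse l) at_infinity"
      by (simp add: power_int_minus)
    moreover have "(\<lambda>t. inverse (g t)) holomorphic_on UNIV"
      using g by (intro holomorphic_intros) auto
    ultimately have "- N = 0 \<and> (\<lambda>t. inverse (g t)) constant_on UNIV"
      by (intro pos[of _ _ "inverse l"]) (use g False \<open>l \<noteq> 0\<close> in auto)
    then show ?thesis using False by simp
  qed
qed

text \<open>The great Picard theorem excludes essential singularities at the punctures, so dividing by suitable
  powers leaves an entire function without zeros. Its growth at infinity is that of a power, so it is
  constant; and since \<open>f\<close> itself has a finite nonzero limit there, the exponents add up to \<open>0\<close>.\<close>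

theorem omitting_two_values_imp_rational:
  fixes p :: "'i \<Rightarrow> complex"
  assumes J: "finite J" "inj_on p J" and hol: "f holomorphic_on - p ` J"
    and om: "\<And>t. t \<notin> p ` J \<Longrightarrow> f t \<noteq> 0 \<and> f t \<noteq> 1"
    and lim: "(f \<longlongrightarrow> l) at_infinity" and "l \<noteq> 0"
  shows "\<exists>e c. c \<noteq> 0 \<and> sum e J = 0 \<and> (\<forall>t. t \<notin> p ` J \<longrightarrow> f t = c * (\<Prod>j\<in>J. (t - p j) powi e j))"
proof -
  have ness: "not_essential f (p j)" if "j \<in> J" for j
  proof -
    define M where "M = - p ` (J - {j})"
    have M: "open M" "p j \<in> M" "M - {p j} = - p ` J"
      using J that by (auto simp: M_def inj_on_def open_Compl finite_imp_closed)
    obtain x where x: "(f \<longlongrightarrow> x) (at (p j)) \<or> ((inverse \<circ> f) \<longlongrightarrow> x) (at (p j))"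
      using great_Picard[OF M(1,2), of 0 1 f] hol om M(3) by auto
    show ?thesis
    proof (cases "(f \<longlongrightarrow> x) (at (p j))")
      case True then show ?thesis by (auto simp: not_essential_def)
    next
      case False
      then have inv: "((\<lambda>t. inverse (f t)) \<longlongrightarrow> x) (at (p j))" using x by (simp add: o_def)
      have "not_essential (\<lambda>t. inverse (f t)) (p j)"
        using inv by (auto simp: not_essential_def)
      moreover have "isolated_singularity_at (\<lambda>t. inverse (f t)) (p j)"
        using M hol om
        by (intro isolated_singularity_at_holomorphic[of _ M] holomorphic_intros) auto
      ultimately have "not_essential (\<lambda>t. inverse (inverse (f t))) (p j)"
        by (rule not_essential_inverse)
      then show ?thesis by simp
    qed
  qed
  obtain e g where g: "g holomorphic_on UNIV" "\<And>t. g t \<noteq> 0"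
    and fg: "\<And>t. t \<notin> p ` J \<Longrightarrow> f t = g t * (\<Prod>j\<in>J. (t - p j) powi e j)"
    using entire_nonvanishing_factor[OF J hol _ ness] om by blast
  let ?P = "\<lambda>t. (\<Prod>j\<in>J. (t - p j) powi e j)"
  have "((\<lambda>t. f t / (?P t / t powi (sum e J))) \<longlongrightarrow> l / 1) at_infinity"
    by (intro tendsto_intros lim tendsto_prod_powi_at_infinity J) auto
  then have "((\<lambda>t. g t * t powi (sum e J)) \<longlongrightarrow> l / 1) at_infinity"
  proof (rule Lim_transform_eventually)
    have "\<forall>\<^sub>F t in at_infinity. t \<notin> p ` J"
      using J eventually_ball_finite[of "p ` J" "\<lambda>t y. t \<noteq> y" at_infinity]
      by (force elim: eventually_mono intro: eventually_not_equal_at_infinity)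
    then show "\<forall>\<^sub>F t in at_infinity. f t / (?P t / t powi (sum e J)) = g t * t powi (sum e J)"
      by eventually_elim (use prod_powi_nonzero[OF J(1)] fg in auto)
  qed
  then have "sum e J = 0 \<and> g constant_on UNIV"
    using entire_limit_powi_imp_constant[OF g] \<open>l \<noteq> 0\<close> by simp
  then show ?thesis using fg g(2) unfolding constant_on_def by (metis UNIV_I)
qed

section \<open>Exponents along the diagonals\<close>

text \<open>Here \<open>z\<close> stands for the points with index other than \<open>i\<close>, and \<open>t\<close> runs over the positions that they
  leave to the point with index \<open>i\<close>.\<close>

definition has_exponents_at ::
  "(('n::finite \<Rightarrow> complex) \<Rightarrow> complex) \<Rightarrow> 'n \<Rightarrow> ('n \<Rightarrow> complex) \<Rightarrow> ('n \<Rightarrow> int) \<Rightarrow> bool" where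
  "has_exponents_at f i z e \<longleftrightarrow>
     (\<exists>c. c \<noteq> 0 \<and> (\<forall>t. t \<notin> z ` (- {i}) \<longrightarrow> f (z(i := t)) = c * (\<Prod>j\<in>- {i}. (t - z j) powi e j)))"

text \<open>The content of this definition is that \<open>a\<close> is the same for all \<open>z\<close>.\<close>

definition has_exponents ::
  "(('n::finite \<Rightarrow> complex) \<Rightarrow> complex) \<Rightarrow> ('n \<Rightarrow> 'n \<Rightarrow> int) \<Rightarrow> bool" where
  "has_exponents f a \<longleftrightarrow> (\<forall>i z. inj_on z (- {i}) \<longrightarrow> has_exponents_at f i z (a i))"

text \<open>The restriction to finite points of a holomorphic function on the configuration space of the
  projective line with values outside \<open>0, 1, \<infinity>\<close>. The condition on the limit is what remains of the
  configurations that contain the point \<open>\<infinity>\<close>.\<close>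

definition omits_01 :: "(('n::finite \<Rightarrow> complex) \<Rightarrow> complex) \<Rightarrow> bool" where
  "omits_01 f \<longleftrightarrow> (\<forall>i z. inj_on z (- {i}) \<longrightarrow>
     (\<lambda>t. f (z(i := t))) holomorphic_on - z ` (- {i}) \<and>
     (\<forall>t. t \<notin> z ` (- {i}) \<longrightarrow> f (z(i := t)) \<noteq> 0 \<and> f (z(i := t)) \<noteq> 1) \<and>
     (\<exists>l. l \<noteq> 0 \<and> l \<noteq> 1 \<and> ((\<lambda>t. f (z(i := t))) \<longlongrightarrow> l) at_infinity))"

text \<open>Move the points one at a time to a configuration disjoint from both given ones, and from there to the
  target: disjointness guarantees that no two points collide on the way.\<close>

lemma configurations_connected_by_single_moves:
  fixes z z' :: "'n \<Rightarrow> complex"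
  assumes "finite I" "inj_on z I" "inj_on z' I" "P z"
    and step: "\<And>z k u. inj_on z I \<Longrightarrow> k \<in> I \<Longrightarrow> inj_on (z(k := u)) I \<Longrightarrow> P z \<Longrightarrow> P (z(k := u))"
    and ext: "\<And>z z'. (\<And>j. j \<in> I \<Longrightarrow> z j = z' j) \<Longrightarrow> P z \<Longrightarrow> P z'"
  shows "P z'"
proof -
  have move: "P w" if z: "inj_on z I" "P z" and w: "inj_on w I" "w ` I \<inter> z ` I = {}" for z w
  proof -
    have inj: "inj_on (\<lambda>j. if j \<in> B then w j else z j) I" for B
    proof (rule inj_onI)
      fix x y assume xy: "x \<in> I" "y \<in> I"
        and eq: "(if x \<in> B then w x else z x) = (if y \<in> B then w y else z y)"
      have "w x \<noteq> z y" "w y \<noteq> z x" using w(2) xy by blast+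
      then show "x = y" using eq xy z(1) w(1) by (auto split: if_splits dest: inj_onD)
    qed
    have "finite B \<Longrightarrow> B \<subseteq> I \<Longrightarrow> P (\<lambda>j. if j \<in> B then w j else z j)" for B
    proof (induction B rule: finite_induct)
      case empty then show ?case using z by simp
    next
      case (insert k B)
      have eq: "(\<lambda>j. if j \<in> B then w j else z j)(k := w k) = (\<lambda>j. if j \<in> insert k B then w j else z j)"
        by auto
      show ?case using step[OF inj, of k B "w k"] inj[of "insert k B"] insert unfolding eq by simp
    qed
    from this[of I] have "P (\<lambda>j. if j \<in> I then w j else z j)" using \<open>finite I\<close> by simp
    then show ?thesis by (rule ext[rotated]) auto
  qed
  have "infinite (- (z ` I \<union> z' ` I))"
    using \<open>finite I\<close> by (intro Diff_infinite_finite[of _ UNIV, folded Compl_eq_Diff_UNIV] infinite_UNIV_char_0) auto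
  then obtain W where W: "W \<subseteq> - (z ` I \<union> z' ` I)" "finite W" "card W = card I"
    using infinite_arbitrarily_large by metis
  then obtain w where w: "bij_betw w I W" using \<open>finite I\<close> finite_same_card_bij by metis
  then have wi: "inj_on w I" "w ` I = W" by (auto simp: bij_betw_def)
  have "P w" by (rule move[OF assms(2,4) wi(1)]) (use wi W in auto)
  then show ?thesis by (rule move[OF wi(1) _ assms(3)]) (use wi W in auto)
qed

lemma open_imp_fsigma:
  fixes S :: "'a::euclidean_space set"
  assumes "open S"
  shows "fsigma S"
proof -
  obtain C :: "nat \<Rightarrow> 'a set" where "\<And>n. compact (C n)" "\<Union> (range C) = S"
    using open_Union_compact_subsets[OF assms] by metis
  then show ?thesis using fsigma.intros[of C] by (auto simp: compact_imp_closed)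
qed

lemma inj_on_coordinate_update:
  assumes "inj_on z (- {i, k})" "u \<notin> z ` (- {i, k})"
  shows "inj_on (z(k := u)) (- {i})"
proof (rule inj_onI)
  fix x y assume xy: "x \<in> - {i}" "y \<in> - {i}" and eq: "(z(k := u)) x = (z(k := u)) y"
  have "z x \<noteq> u" if "x \<noteq> i" "x \<noteq> k" for x using assms(2) that by blast
  then show "x = y" using xy eq assms(1) by (auto split: if_splits dest: inj_onD)
qed

lemma image_coordinate_update:
  assumes "k \<noteq> i"
  shows "(z(k := u)) ` (- {i}) = insert u (z ` (- {i, k}))"
proof -
  have "- {i} = insert k (- {i, k})" using assms by auto
  then have "(z(k := u)) ` (- {i}) = insert ((z(k := u)) k) ((z(k := u)) ` (- {i, k}))"
    by (metis image_insert)
  also have "(z(k := u)) ` (- {i, k}) = z ` (- {i, k})" by (rule image_cong) auto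
  finally show ?thesis by simp
qed

lemma omits_01_imp_has_exponents_at:
  assumes "omits_01 f" "inj_on z (- {i})"
  shows "\<exists>e. has_exponents_at f i z e \<and> sum e (- {i}) = 0"
proof -
  have hol: "(\<lambda>t. f (z(i := t))) holomorphic_on - z ` (- {i})"
    and om: "\<And>t. t \<notin> z ` (- {i}) \<Longrightarrow> f (z(i := t)) \<noteq> 0 \<and> f (z(i := t)) \<noteq> 1"
    and lim: "\<exists>l. l \<noteq> 0 \<and> l \<noteq> 1 \<and> ((\<lambda>t. f (z(i := t))) \<longlongrightarrow> l) at_infinity"
    using assms unfolding omits_01_def by blast+
  obtain l where "l \<noteq> 0" "((\<lambda>t. f (z(i := t))) \<longlongrightarrow> l) at_infinity" using lim by blast
  from omitting_two_values_imp_rational[OF finite assms(2) hol om this(2,1)]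
  show ?thesis unfolding has_exponents_at_def by blast
qed

lemma has_exponents_at_unique:
  assumes "has_exponents_at f i z e" "has_exponents_at f i z e'" "inj_on z (- {i})" "j \<noteq> i"
  shows "e j = e' j"
proof -
  obtain c c' where "c \<noteq> 0" "c' \<noteq> 0"
    "\<And>t. t \<notin> z ` (- {i}) \<Longrightarrow> f (z(i := t)) = c * (\<Prod>j\<in>- {i}. (t - z j) powi e j)"
    "\<And>t. t \<notin> z ` (- {i}) \<Longrightarrow> f (z(i := t)) = c' * (\<Prod>j\<in>- {i}. (t - z j) powi e' j)"
    using assms(1,2) unfolding has_exponents_at_def by blast
  then show ?thesis
    using assms(3,4) prod_powi_exponents_unique[of "- {i}" z c c' "{}" e e' j] by auto
qed

lemma has_exponents_at_cong:
  assumes "has_exponents_at f i z e" and "\<And>j. j \<noteq> i \<Longrightarrow> z j = z' j" and "\<And>j. j \<noteq> i \<Longrightarrow> e j = e' j"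
  shows "has_exponents_at f i z' e'"
proof -
  have "z' ` (- {i}) = z ` (- {i})" using assms(2) by (auto intro!: image_cong)
  moreover have "z'(i := t) = z(i := t)" for t using assms(2) by auto
  moreover have "(\<Prod>j\<in>- {i}. (t - z' j) powi e' j) = (\<Prod>j\<in>- {i}. (t - z j) powi e j)" for t
    using assms(2,3) by (intro prod.cong) auto
  ultimately show ?thesis using assms(1) unfolding has_exponents_at_def by simp
qed

text \<open>There are only countably many exponent vectors, but uncountably many positions \<open>u\<close> of the \<open>k\<close>-th point, so
  one vector \<open>e\<close> occurs uncountably often. The statement that the exponents are \<open>e\<close> is an analytic identity
  in \<open>u\<close>, and an analytic identity that holds uncountably often holds always.\<close>

lemma exponents_constant_in_coordinate:
  fixes f :: "('n::finite \<Rightarrow> complex) \<Rightarrow> complex"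
  assumes f: "omits_01 f" and z: "inj_on z (- {i})" and "k \<noteq> i"
  shows "\<exists>e. \<forall>u. u \<notin> z ` (- {i, k}) \<longrightarrow> has_exponents_at f i (z(k := u)) e"
proof -
  define Y where "Y = - z ` (- {i, k})"
  have zik: "inj_on z (- {i, k})" using z by (rule inj_on_subset) auto
  have inj_u: "inj_on (z(k := u)) (- {i})" if "u \<in> Y" for u
    using that zik by (intro inj_on_coordinate_update) (auto simp: Y_def)
  have "\<forall>u\<in>Y. \<exists>e. has_exponents_at f i (z(k := u)) e"
    using omits_01_imp_has_exponents_at[OF f inj_u] by blast
  then obtain E where E: "\<And>u. u \<in> Y \<Longrightarrow> has_exponents_at f i (z(k := u)) (E u)" by metis
  have finY: "finite (- Y)" by (auto simp: Y_def)
  \<comment> \<open>Otherwise the uncountable set of positions would be a countable union of countable sets.\<close>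
  have "\<exists>e. uncountable {u \<in> Y. E u = e}"
  proof (rule ccontr)
    assume "\<nexists>e. uncountable {u \<in> Y. E u = e}"
    then have "countable (\<Union>e. {u \<in> Y. E u = e})" by (intro countable_UN) auto
    then have "countable Y" by (rule countable_subset[rotated]) auto
    then have "countable (Y \<union> - Y)" using countable_finite[OF finY] by (rule countable_Un)
    then show False using uncountable_UNIV_complex by simp
  qed
  then obtain e where e: "uncountable {u \<in> Y. E u = e}" by blast
  define R where "R = (\<lambda>u v. (v - u) powi e k * (\<Prod>j\<in>- {i, k}. (v - z j) powi e j))"
  have R: "(\<Prod>j\<in>- {i}. (v - (z(k := u)) j) powi e j) = R u v" for u v
  proof -
    have "- {i} = insert k (- {i, k})" using \<open>k \<noteq> i\<close> by auto
    then have "(\<Prod>j\<in>- {i}. (v - (z(k := u)) j) powi e j) =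
        (v - u) powi e k * (\<Prod>j\<in>- {i, k}. (v - (z(k := u)) j) powi e j)" by simp
    also have "(\<Prod>j\<in>- {i, k}. (v - (z(k := u)) j) powi e j) = (\<Prod>j\<in>- {i, k}. (v - z j) powi e j)"
      by (intro prod.cong) auto
    finally show ?thesis by (simp add: R_def)
  qed
  have R_nz: "R u v \<noteq> 0" if "v \<in> Y" "u \<noteq> v" for u v
    using that prod_powi_nonzero[of "- {i, k}" v z e] by (auto simp: R_def Y_def)
  \<comment> \<open>The quotient of the function by the product for the exponents is the same at any two positions of the point with index i: an identity in u that holds on an uncountable set.\<close>
  have cross: "f (z(k := u, i := v)) * R u v0 = f (z(k := u, i := v0)) * R u v"
    if v: "v \<in> Y" "v0 \<in> Y" and u: "u \<in> Y" "u \<noteq> v" "u \<noteq> v0" for u v v0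
  proof -
    define Y' where "Y' = Y - {v, v0}"
    have hol: "(\<lambda>u. f (z(k := u, i := v))) holomorphic_on Y'" if "v \<in> Y" "v \<notin> Y'" for v
    proof -
      have "inj_on (z(i := v)) (- {k})"
        using that zik \<open>k \<noteq> i\<close> by (intro inj_on_coordinate_update) (auto simp: Y_def insert_commute)
      then have "(\<lambda>u. f (z(i := v, k := u))) holomorphic_on - (z(i := v)) ` (- {k})"
        using f unfolding omits_01_def by blast
      moreover have "(z(i := v, k := u)) = (z(k := u, i := v))" for u
        using \<open>k \<noteq> i\<close> by (rule fun_upd_twist[symmetric])
      ultimately have "(\<lambda>u. f (z(k := u, i := v))) holomorphic_on - (z(i := v)) ` (- {k})" by simp
      moreover have "Y' \<subseteq> - (z(i := v)) ` (- {k})" using that by (auto simp: Y'_def Y_def)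
      ultimately show ?thesis by (rule holomorphic_on_subset)
    qed
    have holR: "(\<lambda>u. R u v) holomorphic_on Y'" if "v \<notin> Y'" for v
      unfolding R_def by (intro holomorphic_intros) (use that in auto)
    have Y': "open Y'" "connected Y'"
    proof -
      have eq: "Y' = UNIV - (z ` (- {i, k}) \<union> {v, v0})" by (auto simp: Y'_def Y_def)
      show "open Y'" unfolding eq by (intro open_Diff finite_imp_closed) auto
      show "connected Y'" unfolding eq by (intro connected_open_delete_finite) auto
    qed
    have "uncountable ({u \<in> Y. E u = e} - {v, v0})"
      using e by (metis countable_finite finite.emptyI finite_insert uncountable_minus_countable)
    moreover have "{u \<in> Y. E u = e} - {v, v0} \<subseteq>
        {u \<in> Y'. f (z(k := u, i := v)) * R u v0 = f (z(k := u, i := v0)) * R u v}"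
    proof
      fix u assume u: "u \<in> {u \<in> Y. E u = e} - {v, v0}"
      then obtain c where c: "\<And>t. t \<notin> (z(k := u)) ` (- {i}) \<Longrightarrow> f (z(k := u, i := t)) = c * R u t"
        using E[of u] u unfolding has_exponents_at_def R[symmetric] by blast
      have "v \<notin> (z(k := u)) ` (- {i})" "v0 \<notin> (z(k := u)) ` (- {i})"
        using u v unfolding image_coordinate_update[OF \<open>k \<noteq> i\<close>] by (auto simp: Y_def)
      then have "f (z(k := u, i := v)) = c * R u v" "f (z(k := u, i := v0)) = c * R u v0"
        using c by blast+
      moreover have "u \<in> Y'" using u by (auto simp: Y'_def)
      ultimately show "u \<in> {u \<in> Y'. f (z(k := u, i := v)) * R u v0 = f (z(k := u, i := v0)) * R u v}"
        by simp
    qed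
    ultimately have unc: "uncountable {u \<in> Y'. f (z(k := u, i := v)) * R u v0 = f (z(k := u, i := v0)) * R u v}"
      using countable_subset by blast
    have vv: "v \<notin> Y'" "v0 \<notin> Y'" by (auto simp: Y'_def)
    have "Y' \<subseteq> {u \<in> Y'. f (z(k := u, i := v)) * R u v0 = f (z(k := u, i := v0)) * R u v}"
    proof (rule holomorphic_countable_equal[where S = Y', OF _ _ Y' _ unc])
      show "(\<lambda>u. f (z(k := u, i := v)) * R u v0) holomorphic_on Y'"
        "(\<lambda>u. f (z(k := u, i := v0)) * R u v) holomorphic_on Y'"
        by (intro holomorphic_on_mult hol holR v vv)+
    qed (rule open_imp_fsigma[OF Y'(1)])
    then show ?thesis using u by (auto simp: Y'_def)
  qed
  have "has_exponents_at f i (z(k := u)) e" if "u \<in> Y" for u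
  proof -
    have "infinite (UNIV - (- Y \<union> {u}))"
      using finY by (intro Diff_infinite_finite infinite_UNIV_char_0) auto
    then have "UNIV - (- Y \<union> {u}) \<noteq> {}" by (metis finite.emptyI)
    then obtain v0 where v0: "v0 \<in> Y" "v0 \<noteq> u" by blast
    have "v0 \<notin> (z(k := u)) ` (- {i})"
      using v0 unfolding image_coordinate_update[OF \<open>k \<noteq> i\<close>] by (auto simp: Y_def)
    then have f0: "f (z(k := u, i := v0)) \<noteq> 0"
      using f inj_u[OF that] unfolding omits_01_def by blast
    show ?thesis unfolding has_exponents_at_def R
    proof (intro exI[of _ "f (z(k := u, i := v0)) / R u v0"] conjI allI impI)
      show "f (z(k := u, i := v0)) / R u v0 \<noteq> 0" using f0 R_nz v0 by auto
    next
      fix t assume t: "t \<notin> (z(k := u)) ` (- {i})"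
      then have "t \<in> Y" "t \<noteq> u"
        unfolding image_coordinate_update[OF \<open>k \<noteq> i\<close>] by (auto simp: Y_def)
      then show "f (z(k := u, i := t)) = f (z(k := u, i := v0)) / R u v0 * R u t"
        using cross[of t v0 u] v0 that R_nz[of v0 u] by (simp add: field_simps)
    qed
  qed
  then show ?thesis by (auto simp: Y_def)
qed

text \<open>The exponents do not change when one point moves, and single moves connect all configurations.\<close>

theorem omits_01_imp_has_exponents:
  fixes f :: "('n::finite \<Rightarrow> complex) \<Rightarrow> complex"
  assumes f: "omits_01 f"
  shows "\<exists>a. has_exponents f a \<and> (\<forall>i. sum (a i) (- {i}) = 0)"
proof -
  have "\<exists>e. sum e (- {i}) = 0 \<and> (\<forall>z. inj_on z (- {i}) \<longrightarrow> has_exponents_at f i z e)" for i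
  proof -
    obtain z0 :: "'n \<Rightarrow> complex" where "inj z0"
      using finite_imp_inj_to_nat_seg[of "UNIV :: 'n set"] inj_compose[of "of_nat :: nat \<Rightarrow> complex"]
      by (metis finite_class.finite_UNIV inj_of_nat)
    then have z0: "inj_on z0 (- {i})" by (rule inj_on_subset) auto
    obtain e where e: "has_exponents_at f i z0 e" "sum e (- {i}) = 0"
      using omits_01_imp_has_exponents_at[OF f z0] by blast
    have "has_exponents_at f i z e" if "inj_on z (- {i})" for z
    proof (rule configurations_connected_by_single_moves[of "- {i}" z0 z "\<lambda>z. has_exponents_at f i z e", OF _ z0 that e(1)])
      fix z k u assume z: "inj_on z (- {i})" "k \<in> - {i}" "inj_on (z(k := u)) (- {i})" "has_exponents_at f i z e"
      obtain e' where e': "\<And>u. u \<notin> z ` (- {i, k}) \<Longrightarrow> has_exponents_at f i (z(k := u)) e'"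
        using exponents_constant_in_coordinate[OF f z(1), of k] z(2) by auto
      have "has_exponents_at f i (z(k := z k)) e'" 
        using z(1,2) by (intro e') (auto simp: inj_on_def)
      then have "\<And>j. j \<noteq> i \<Longrightarrow> e' j = e j" using has_exponents_at_unique z(1,4) by simp
      moreover have "has_exponents_at f i (z(k := u)) e'"
        using z(2,3) by (intro e') (auto simp: inj_on_def)
      ultimately show "has_exponents_at f i (z(k := u)) e" by (blast intro: has_exponents_at_cong)
    qed (auto intro: has_exponents_at_cong)
    then show ?thesis using e(2) by blast
  qed
  then show ?thesis unfolding has_exponents_def by metis
qed

text \<open>One factor carries the zero or pole at \<open>z j\<close>; the others are continuous and nonzero there.\<close>

lemma has_exponents_at_local_form:
  assumes "has_exponents_at f i z e" "inj_on z (- {i})" "j \<noteq> i"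
  shows "\<exists>G L. L \<noteq> 0 \<and> (G \<longlongrightarrow> L) (at (z j)) \<and>
    (\<forall>\<^sub>F t in at (z j). f (z(i := t)) = (t - z j) powi e j * G t)"
proof -
  obtain c where c: "c \<noteq> 0"
    "\<And>t. t \<notin> z ` (- {i}) \<Longrightarrow> f (z(i := t)) = c * (\<Prod>j\<in>- {i}. (t - z j) powi e j)"
    using assms(1) unfolding has_exponents_at_def by blast
  define G where "G = (\<lambda>t. c * (\<Prod>k\<in>- {i, j}. (t - z k) powi e k))"
  have eq: "- {i} = insert j (- {i, j})" using assms(3) by auto
  have nin: "z j \<notin> z ` (- {i, j})" using assms(2,3) by (auto simp: inj_on_def)
  have "(G \<longlongrightarrow> G (z j)) (at (z j))"
    unfolding G_def using nin by (intro tendsto_intros tendsto_prod_powi)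
  moreover have "G (z j) \<noteq> 0" using c(1) nin prod_powi_nonzero[of "- {i, j}" "z j" z e] by (simp add: G_def)
  moreover have "\<forall>\<^sub>F t in at (z j). f (z(i := t)) = (t - z j) powi e j * G t"
  proof -
    have "\<forall>\<^sub>F t in at (z j). t \<in> - z ` (- {i, j}) - {z j}"
      using nin by (intro eventually_at_in_open open_Compl finite_imp_closed) auto
    then show ?thesis
    proof eventually_elim
      case (elim t)
      then have "t \<notin> z ` (- {i})" unfolding eq by auto
      from c(2)[OF this] show ?case unfolding eq G_def by simp
    qed
  qed
  ultimately show ?thesis by blast
qed

lemma order_at_point_unique:
  fixes G H :: "complex \<Rightarrow> complex"
  assumes "\<forall>\<^sub>F t in at a. (t - a) powi m * G t = (t - a) powi n * H t"
    and "(G \<longlongrightarrow> L) (at a)" "L \<noteq> 0" "(H \<longlongrightarrow> M) (at a)" "M \<noteq> 0"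
  shows "m = n"
proof -
  have "((\<lambda>t. H t / G t) \<longlongrightarrow> M / L) (at a)" using assms by (intro tendsto_intros)
  moreover have "\<forall>\<^sub>F t in at a. H t / G t = (t - a) powi (m - n)"
    using assms(1) tendsto_imp_eventually_ne[OF assms(2,3)] eventually_neq_at_within[of a]
    by eventually_elim (auto simp: power_int_diff field_simps)
  ultimately have "((\<lambda>t. (t - a) powi (m - n)) \<longlongrightarrow> M / L) (at a)"
    by (rule Lim_transform_eventually)
  from powi_diff_tendsto_nonzero_imp_exponent_0[OF this] show ?thesis using assms by simp
qed

lemma exponent_0_if_nonzero_limit:
  assumes "has_exponents_at f i z e" "inj_on z (- {i})" "j \<noteq> i"
    and "((\<lambda>t. f (z(i := t))) \<longlongrightarrow> M) (at (z j))" "M \<noteq> 0"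
  shows "e j = 0"
proof -
  obtain G L where G: "L \<noteq> 0" "(G \<longlongrightarrow> L) (at (z j))"
    "\<forall>\<^sub>F t in at (z j). f (z(i := t)) = (t - z j) powi e j * G t"
    using has_exponents_at_local_form[OF assms(1-3)] by blast
  from G(3) have "\<forall>\<^sub>F t in at (z j). (t - z j) powi e j * G t = (t - z j) powi 0 * f (z(i := t))"
    by eventually_elim simp
  from order_at_point_unique[OF this G(2,1) assms(4,5)] show ?thesis .
qed

lemma exponent_pos_imp_tendsto_0:
  assumes "has_exponents_at f i z e" "inj_on z (- {i})" "j \<noteq> i" "e j > 0"
  shows "((\<lambda>t. f (z(i := t))) \<longlongrightarrow> 0) (at (z j))"
proof -
  obtain G L where G: "(G \<longlongrightarrow> L) (at (z j))"
    "\<forall>\<^sub>F t in at (z j). f (z(i := t)) = (t - z j) powi e j * G t"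
    using has_exponents_at_local_form[OF assms(1-3)] by blast
  have "((\<lambda>t. (t - z j) powi e j * G t) \<longlongrightarrow> (z j - z j) powi e j * L) (at (z j))"
    using assms(4) by (intro tendsto_intros G tendsto_power_int') auto
  then have "((\<lambda>t. (t - z j) powi e j * G t) \<longlongrightarrow> 0) (at (z j))" using assms(4) by simp
  then show ?thesis
    by (rule Lim_transform_eventually) (use G(2) in \<open>simp add: eq_commute\<close>)
qed

lemma ex_inj_complex: "\<exists>z :: 'n::finite \<Rightarrow> complex. inj z"
  using finite_imp_inj_to_nat_seg[of "UNIV :: 'n set"] inj_compose[of "of_nat :: nat \<Rightarrow> complex"]
  by (metis finite_class.finite_UNIV inj_of_nat)

lemma inj_fun_upd_iff:
  "inj (z(i := t)) \<longleftrightarrow> inj_on z (- {i}) \<and> t \<notin> z ` (- {i})" (is "?l \<longleftrightarrow> ?r")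
proof
  assume l: ?l
  have "z j \<noteq> t" if "j \<noteq> i" for j
    using injD[OF l, of i j] that by auto
  moreover have "inj_on z (- {i})"
  proof (rule inj_onI)
    fix x y assume "x \<in> - {i}" "y \<in> - {i}" "z x = z y"
    then show "x = y" using injD[OF l, of x y] by auto
  qed
  ultimately show ?r by blast
next
  assume r: ?r
  show ?l
  proof (rule injI)
    fix x y assume eq: "(z(i := t)) x = (z(i := t)) y"
    have "z j \<noteq> t" if "j \<noteq> i" for j using r that by blast
    then show "x = y" using eq r by (auto split: if_splits dest: inj_onD)
  qed
qed

lemma has_exponents_atD: "has_exponents f a \<Longrightarrow> inj_on z (- {i}) \<Longrightarrow> has_exponents_at f i z (a i)"
  unfolding has_exponents_def by blast

lemma has_exponents_unique:
  fixes f :: "('n::finite \<Rightarrow> complex) \<Rightarrow> complex"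
  assumes "has_exponents f a" "has_exponents f b" "i \<noteq> j"
  shows "a i j = b i j"
proof -
  obtain z :: "'n \<Rightarrow> complex" where "inj z" using ex_inj_complex by blast
  then have z: "inj_on z (- {i})" by (rule inj_on_subset) auto
  show ?thesis using has_exponents_at_unique[OF assms(1,2)[THEN has_exponents_atD, OF z] z] assms(3) by auto
qed

lemma has_exponents_cong:
  fixes f :: "('n::finite \<Rightarrow> complex) \<Rightarrow> complex"
  assumes "has_exponents f a" "\<And>z. inj z \<Longrightarrow> f z = g z" "\<And>i j. i \<noteq> j \<Longrightarrow> a i j = b i j"
  shows "has_exponents g b"
  unfolding has_exponents_def
proof (intro allI impI)
  fix i and z :: "'n \<Rightarrow> complex" assume z: "inj_on z (- {i})"
  obtain c where c: "c \<noteq> 0" "\<And>t. t \<notin> z ` (- {i}) \<Longrightarrow> f (z(i := t)) = c * (\<Prod>j\<in>- {i}. (t - z j) powi a i j)"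
    using has_exponents_atD[OF assms(1) z] unfolding has_exponents_at_def by blast
  have "(\<Prod>j\<in>- {i}. (t - z j) powi a i j) = (\<Prod>j\<in>- {i}. (t - z j) powi b i j)" for t
    using assms(3) by (intro prod.cong) auto
  moreover have "g (z(i := t)) = f (z(i := t))" if "t \<notin> z ` (- {i})" for t
    using assms(2)[of "z(i := t)"] z that by (simp add: inj_fun_upd_iff)
  ultimately show "has_exponents_at g i z (b i)"
    using c unfolding has_exponents_at_def by metis
qed

lemma has_exponents_mult:
  fixes f g :: "('n::finite \<Rightarrow> complex) \<Rightarrow> complex"
  assumes "has_exponents f a" "has_exponents g b"
  shows "has_exponents (\<lambda>z. f z * g z) (\<lambda>i j. a i j + b i j)"
  unfolding has_exponents_def
proof (intro allI impI)
  fix i and z :: "'n \<Rightarrow> complex" assume z: "inj_on z (- {i})"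
  obtain c where c: "c \<noteq> 0" "\<And>t. t \<notin> z ` (- {i}) \<Longrightarrow> f (z(i := t)) = c * (\<Prod>j\<in>- {i}. (t - z j) powi a i j)"
    using has_exponents_atD[OF assms(1) z] unfolding has_exponents_at_def by blast
  obtain d where d: "d \<noteq> 0" "\<And>t. t \<notin> z ` (- {i}) \<Longrightarrow> g (z(i := t)) = d * (\<Prod>j\<in>- {i}. (t - z j) powi b i j)"
    using has_exponents_atD[OF assms(2) z] unfolding has_exponents_at_def by blast
  have "f (z(i := t)) * g (z(i := t)) = c * d * (\<Prod>j\<in>- {i}. (t - z j) powi (a i j + b i j))"
    if t: "t \<notin> z ` (- {i})" for t
  proof -
    have "(\<Prod>j\<in>- {i}. (t - z j) powi (a i j + b i j)) =
        (\<Prod>j\<in>- {i}. (t - z j) powi a i j * (t - z j) powi b i j)"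
      using t by (intro prod.cong power_int_add) auto
    then show ?thesis using c(2)[OF t] d(2)[OF t] by (simp add: prod.distrib)
  qed
  then show "has_exponents_at (\<lambda>z. f z * g z) i z (\<lambda>j. a i j + b i j)"
    using c(1) d(1) unfolding has_exponents_at_def by (intro exI[of _ "c * d"]) auto
qed

lemma has_exponents_inverse:
  fixes f :: "('n::finite \<Rightarrow> complex) \<Rightarrow> complex"
  assumes "has_exponents f a"
  shows "has_exponents (\<lambda>z. inverse (f z)) (\<lambda>i j. - a i j)"
  unfolding has_exponents_def
proof (intro allI impI)
  fix i and z :: "'n \<Rightarrow> complex" assume z: "inj_on z (- {i})"
  obtain c where c: "c \<noteq> 0" "\<And>t. t \<notin> z ` (- {i}) \<Longrightarrow> f (z(i := t)) = c * (\<Prod>j\<in>- {i}. (t - z j) powi a i j)"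
    using has_exponents_atD[OF assms(1) z] unfolding has_exponents_at_def by blast
  show "has_exponents_at (\<lambda>z. inverse (f z)) i z (\<lambda>j. - a i j)"
    unfolding has_exponents_at_def
  proof (intro exI[of _ "inverse c"] conjI allI impI)
    fix t assume "t \<notin> z ` (- {i})"
    from c(2)[OF this] show "inverse (f (z(i := t))) = inverse c * (\<Prod>j\<in>- {i}. (t - z j) powi - a i j)"
      by (simp add: power_int_minus prod_inversef[unfolded o_def])
  qed (use c in auto)
qed

lemma has_exponents_const:
  assumes "c \<noteq> 0"
  shows "has_exponents (\<lambda>z. c) (\<lambda>i j. 0)"
  using assms unfolding has_exponents_def has_exponents_at_def by auto

lemma omits_01_nonzero:
  assumes "omits_01 f" "inj z"
  shows "f z \<noteq> 0" "f z \<noteq> 1"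
proof -
  fix i
  have z: "inj_on z (- {i})" "z i \<notin> z ` (- {i})" using assms(2) inj_fun_upd_iff[of z i "z i"] by auto
  have "f (z(i := z i)) \<noteq> 0 \<and> f (z(i := z i)) \<noteq> 1"
    using assms(1) z unfolding omits_01_def by blast
  then show "f z \<noteq> 0" "f z \<noteq> 1" by auto
qed

lemma omits_01_one_minus:
  fixes f :: "('n::finite \<Rightarrow> complex) \<Rightarrow> complex"
  assumes "omits_01 f"
  shows "omits_01 (\<lambda>z. 1 - f z)"
  unfolding omits_01_def
proof (intro allI impI conjI)
  fix i and z :: "'n \<Rightarrow> complex" assume z: "inj_on z (- {i})"
  have 1: "(\<lambda>t. f (z(i := t))) holomorphic_on - z ` (- {i})"
    "\<And>t. t \<notin> z ` (- {i}) \<Longrightarrow> f (z(i := t)) \<noteq> 0 \<and> f (z(i := t)) \<noteq> 1"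
    "\<exists>l. l \<noteq> 0 \<and> l \<noteq> 1 \<and> ((\<lambda>t. f (z(i := t))) \<longlongrightarrow> l) at_infinity"
    using assms z unfolding omits_01_def by blast+
  show "(\<lambda>t. 1 - f (z(i := t))) holomorphic_on - z ` (- {i})"
    using 1(1) by (intro holomorphic_intros)
  show "1 - f (z(i := t)) \<noteq> 0" "1 - f (z(i := t)) \<noteq> 1" if "t \<notin> z ` (- {i})" for t
    using 1(2)[OF that] by auto
  obtain l where "l \<noteq> 0" "l \<noteq> 1" "((\<lambda>t. f (z(i := t))) \<longlongrightarrow> l) at_infinity" using 1(3) by blast
  then show "\<exists>l. l \<noteq> 0 \<and> l \<noteq> 1 \<and> ((\<lambda>t. 1 - f (z(i := t))) \<longlongrightarrow> l) at_infinity"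
    by (intro exI[of _ "1 - l"]) (auto intro!: tendsto_intros)
qed

lemma omits_01_cong:
  fixes f g :: "('n::finite \<Rightarrow> complex) \<Rightarrow> complex"
  assumes f: "omits_01 f" and eq: "\<And>z. inj z \<Longrightarrow> f z = g z"
  shows "omits_01 g"
  unfolding omits_01_def
proof (intro allI impI)
  fix i and z :: "'n \<Rightarrow> complex" assume z: "inj_on z (- {i})"
  have eq': "f (z(i := t)) = g (z(i := t))" if "t \<notin> z ` (- {i})" for t
    using z that by (intro eq) (simp add: inj_fun_upd_iff)
  have 1: "(\<lambda>t. f (z(i := t))) holomorphic_on - z ` (- {i})"
    "\<And>t. t \<notin> z ` (- {i}) \<Longrightarrow> f (z(i := t)) \<noteq> 0 \<and> f (z(i := t)) \<noteq> 1"
    "\<exists>l. l \<noteq> 0 \<and> l \<noteq> 1 \<and> ((\<lambda>t. f (z(i := t))) \<longlongrightarrow> l) at_infinity"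
    using f z unfolding omits_01_def by blast+
  have "(\<lambda>t. g (z(i := t))) holomorphic_on - z ` (- {i})"
    by (rule holomorphic_transform[OF 1(1)]) (use eq' in auto)
  moreover have "\<forall>\<^sub>F t in at_infinity. t \<notin> z ` (- {i})"
    using eventually_ball_finite[of "z ` (- {i})" "\<lambda>t y. t \<noteq> y" at_infinity]
    by (force elim: eventually_mono intro: eventually_not_equal_at_infinity)
  then have ev: "\<forall>\<^sub>F t in at_infinity. f (z(i := t)) = g (z(i := t))"
    by eventually_elim (rule eq')
  obtain l where l: "l \<noteq> 0" "l \<noteq> 1" "((\<lambda>t. f (z(i := t))) \<longlongrightarrow> l) at_infinity"
    using 1(3) by blast
  have "\<exists>l. l \<noteq> 0 \<and> l \<noteq> 1 \<and> ((\<lambda>t. g (z(i := t))) \<longlongrightarrow> l) at_infinity"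
    using l(1,2) Lim_transform_eventually[OF l(3) ev] by blast
  moreover have "\<forall>t. t \<notin> z ` (- {i}) \<longrightarrow> g (z(i := t)) \<noteq> 0 \<and> g (z(i := t)) \<noteq> 1"
    using 1(2) eq' by metis
  ultimately show "(\<lambda>t. g (z(i := t))) holomorphic_on - z ` (- {i}) \<and>
     (\<forall>t. t \<notin> z ` (- {i}) \<longrightarrow> g (z(i := t)) \<noteq> 0 \<and> g (z(i := t)) \<noteq> 1) \<and>
     (\<exists>l. l \<noteq> 0 \<and> l \<noteq> 1 \<and> ((\<lambda>t. g (z(i := t))) \<longlongrightarrow> l) at_infinity)" by blast
qed

text \<open>Both exponents are the order of \<open>f\<close> along the diagonal \<open>z\<^sub>i = z\<^sub>j\<close>. To compare them, write \<open>f\<close> near a point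
  of the diagonal as a product in the variable \<open>z\<^sub>i\<close> and as one in the variable \<open>z\<^sub>j\<close>; the constant of the
  latter, which depends on \<open>z\<^sub>i\<close>, is found by moving \<open>z\<^sub>j\<close> to a distant position \<open>t0\<close>, and is therefore
  continuous and nonzero at the diagonal.\<close>

lemma exponents_symmetric:
  fixes f :: "('n::finite \<Rightarrow> complex) \<Rightarrow> complex"
  assumes f: "has_exponents f a"
  shows "a i j = a j i"
proof (cases "i = j")
  case False
  obtain z :: "'n \<Rightarrow> complex" where z: "inj z" using ex_inj_complex by blast
  have zi: "inj_on z (- {i})" and zj: "inj_on z (- {j})" and zij: "inj_on z (- {i, j})"
    by (rule inj_on_subset[OF z]; simp)+
  obtain G L where G: "L \<noteq> 0" "(G \<longlongrightarrow> L) (at (z j))"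
    "\<forall>\<^sub>F s in at (z j). f (z(i := s)) = (s - z j) powi a i j * G s"
    using has_exponents_at_local_form[OF has_exponents_atD[OF f zi] zi, of j] False by auto
  have "infinite (UNIV - range z)" by (intro Diff_infinite_finite infinite_UNIV_char_0) auto
  then have "UNIV - range z \<noteq> {}" by (metis finite.emptyI)
  then obtain t0 where t0: "t0 \<notin> range z" by blast
  have w: "inj_on (z(j := t0)) (- {i})"
    using zij t0 by (intro inj_on_coordinate_update) auto
  obtain c where c: "c \<noteq> 0" "\<And>s. s \<notin> (z(j := t0)) ` (- {i}) \<Longrightarrow>
      f (z(j := t0, i := s)) = c * (\<Prod>k\<in>- {i}. (s - (z(j := t0)) k) powi a i k)"
    using has_exponents_atD[OF f w] unfolding has_exponents_at_def by blast
  define F where "F = (\<lambda>s. c * (\<Prod>k\<in>- {i}. (s - (z(j := t0)) k) powi a i k))"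
  have nin: "z j \<notin> (z(j := t0)) ` (- {i})"
    unfolding image_coordinate_update[OF False[symmetric]] using t0 z by (auto simp: inj_on_def)
  define P where "P = (\<lambda>t. \<Prod>k\<in>- {i, j}. (t - z k) powi a j k)"
  have P: "P t0 \<noteq> 0" "P (z j) \<noteq> 0"
    unfolding P_def by (rule prod_powi_nonzero; use t0 z in \<open>auto simp: inj_on_def\<close>)+
  define H where "H = (\<lambda>s. (- 1) powi a j i * F s * P (z j) / ((t0 - s) powi a j i * P t0))"
  have "(F \<longlongrightarrow> F (z j)) (at (z j))"
    unfolding F_def using nin by (intro tendsto_intros tendsto_prod_powi)
  moreover have ne: "t0 - z j \<noteq> 0" using t0 by auto
  ultimately have H: "(H \<longlongrightarrow> H (z j)) (at (z j))"
    unfolding H_def using P by (intro tendsto_intros) auto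
  have "F (z j) \<noteq> 0" using c(1) nin prod_powi_nonzero[of "- {i}" "z j" "z(j := t0)"] by (simp add: F_def)
  then have H0: "H (z j) \<noteq> 0" using P ne by (simp add: H_def)
  have "\<forall>\<^sub>F s in at (z j). s \<in> - (z(j := t0)) ` (- {i}) - {z j}"
    using nin by (intro eventually_at_in_open open_Compl finite_imp_closed) auto
  then have "\<forall>\<^sub>F s in at (z j). f (z(i := s)) = (s - z j) powi a j i * H s"
  proof eventually_elim
    case (elim s)
    then have s: "s \<notin> (z(j := t0)) ` (- {i})" "s \<noteq> z j" by auto
    then have s': "s \<noteq> t0" "s \<notin> z ` (- {i, j})"
      unfolding image_coordinate_update[OF False[symmetric]] by auto
    have ws: "inj_on (z(i := s)) (- {j})"
      using zij s' by (intro inj_on_coordinate_update) (auto simp: insert_commute)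
    obtain d where d: "d \<noteq> 0" "\<And>t. t \<notin> (z(i := s)) ` (- {j}) \<Longrightarrow>
        f (z(i := s, j := t)) = d * (\<Prod>k\<in>- {j}. (t - (z(i := s)) k) powi a j k)"
      using has_exponents_atD[OF f ws] unfolding has_exponents_at_def by blast
    have eq: "(\<Prod>k\<in>- {j}. (t - (z(i := s)) k) powi a j k) = (t - s) powi a j i * P t" for t
    proof -
      have "- {j} = insert i (- {i, j})" using False by auto
      then have "(\<Prod>k\<in>- {j}. (t - (z(i := s)) k) powi a j k) =
        (t - s) powi a j i * (\<Prod>k\<in>- {i, j}. (t - (z(i := s)) k) powi a j k)" by simp
      also have "(\<Prod>k\<in>- {i, j}. (t - (z(i := s)) k) powi a j k) = P t"
        unfolding P_def by (intro prod.cong) auto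
      finally show ?thesis .
    qed
    have img: "(z(i := s)) ` (- {j}) = insert s (z ` (- {i, j}))"
      using image_coordinate_update[OF False] by (simp add: insert_commute)
    have t0n: "t0 \<notin> (z(i := s)) ` (- {j})" unfolding img using t0 s' by auto
    have zjn: "z j \<notin> (z(i := s)) ` (- {j})" unfolding img using s(2) z by (auto simp: inj_on_def)
    have "z(i := s) = z(i := s, j := z j)" using False by auto
    then have 1: "f (z(i := s)) = d * ((z j - s) powi a j i * P (z j))"
      using d(2)[OF zjn] unfolding eq by simp
    have "F s = d * ((t0 - s) powi a j i * P t0)"
      using d(2)[OF t0n] c(2)[OF s(1)] unfolding eq F_def
      by (metis fun_upd_twist False)
    then have "d = F s / ((t0 - s) powi a j i * P t0)" using s' P by (simp add: field_simps)
    moreover have "(z j - s) powi a j i = (- 1) powi a j i * (s - z j) powi a j i"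
      by (simp flip: power_int_mult_distrib)
    ultimately show ?case using 1 unfolding H_def by simp
  qed
  with G(3) have "\<forall>\<^sub>F s in at (z j). (s - z j) powi a i j * G s = (s - z j) powi a j i * H s"
    by eventually_elim simp
  then show ?thesis using order_at_point_unique G(1,2) H H0 by blast
qed auto

text \<open>As \<open>z\<^sub>i\<close> tends to \<open>z\<^sub>j\<close>, \<open>f\<close> tends to \<open>0\<close> and \<open>1 - f\<close> to \<open>1\<close>, for all positions of the other points. So on
  the diagonal \<open>z\<^sub>i = z\<^sub>j\<close> the product for \<open>1 - f\<close> is identically \<open>1\<close>. On this diagonal the exponents at \<open>i\<close>
  and \<open>j\<close> are added, and all resulting exponents vanish.\<close>

lemma zero_edge:
  fixes f :: "('n::finite \<Rightarrow> complex) \<Rightarrow> complex"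
  assumes f: "has_exponents f a" and g: "has_exponents (\<lambda>z. 1 - f z) b"
    and ij: "i \<noteq> j" "a i j > 0"
  shows "b i j = 0"
    and "\<And>k. k \<noteq> i \<Longrightarrow> k \<noteq> j \<Longrightarrow> b k i + b k j = 0"
    and "\<And>k l. k \<noteq> i \<Longrightarrow> k \<noteq> j \<Longrightarrow> l \<noteq> i \<Longrightarrow> l \<noteq> j \<Longrightarrow> l \<noteq> k \<Longrightarrow> b k l = 0"
proof -
  have lim: "((\<lambda>t. 1 - f (z(i := t))) \<longlongrightarrow> 1) (at (z j))" if z: "inj_on z (- {i})" for z
  proof -
    have "((\<lambda>t. f (z(i := t))) \<longlongrightarrow> 0) (at (z j))"
      using exponent_pos_imp_tendsto_0[OF has_exponents_atD[OF f z] z] ij by auto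
    then have "((\<lambda>t. 1 - f (z(i := t))) \<longlongrightarrow> 1 - 0) (at (z j))" by (intro tendsto_intros)
    then show ?thesis by simp
  qed
  obtain z :: "'n \<Rightarrow> complex" where z: "inj z" using ex_inj_complex by blast
  have zi: "inj_on z (- {i})" by (rule inj_on_subset[OF z]) auto
  show "b i j = 0"
    using exponent_0_if_nonzero_limit[OF has_exponents_atD[OF g zi] zi _ lim[OF zi]] ij by auto
  have main: "(if l = j then b k j + b k i else b k l) = 0"
    if k: "k \<noteq> i" "k \<noteq> j" and l: "l \<noteq> i" "l \<noteq> k" for k l
  proof -
    \<comment> \<open>The exponents of the restriction to the diagonal, on which the factors for i and j coincide.\<close>
    define e where "e = (\<lambda>l. if l = j then b k j + b k i else b k l)"
    define Q where "Q = (\<lambda>s u. (u - s) powi b k i * (\<Prod>m\<in>- {i, k}. (u - z m) powi b k m))"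
    have Qlim: "((\<lambda>s. Q s u) \<longlongrightarrow> (\<Prod>m\<in>- {i, k}. (u - z m) powi e m)) (at (z j))"
      "(\<Prod>m\<in>- {i, k}. (u - z m) powi e m) \<noteq> 0" if u: "u \<notin> z ` (- {i, k})" for u
    proof -
      have uj: "u \<noteq> z j" using u ij k by auto
      have "((\<lambda>s. Q s u) \<longlongrightarrow> Q (z j) u) (at (z j))"
        unfolding Q_def using uj by (intro tendsto_intros) auto
      moreover have "Q (z j) u = (\<Prod>m\<in>- {i, k}. (u - z m) powi e m)"
      proof -
        have eq: "- {i, k} = insert j (- {i, k, j})" using ij k by auto
        have "(\<Prod>m\<in>- {i, k, j}. (u - z m) powi e m) = (\<Prod>m\<in>- {i, k, j}. (u - z m) powi b k m)"
          by (intro prod.cong) (auto simp: e_def)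
        then show ?thesis unfolding Q_def eq using uj by (simp add: e_def power_int_add)
      qed
      ultimately show "((\<lambda>s. Q s u) \<longlongrightarrow> (\<Prod>m\<in>- {i, k}. (u - z m) powi e m)) (at (z j))" by simp
      show "(\<Prod>m\<in>- {i, k}. (u - z m) powi e m) \<noteq> 0" using u by (intro prod_powi_nonzero) auto
    qed
    have zki: "inj_on z (- {k, i})" by (rule inj_on_subset[OF z]) auto
    have "infinite (UNIV - z ` (- {i, k}))" by (intro Diff_infinite_finite infinite_UNIV_char_0) auto
    then have "UNIV - z ` (- {i, k}) \<noteq> {}" by (metis finite.emptyI)
    then obtain u0 where u0: "u0 \<notin> z ` (- {i, k})" by blast
    \<comment> \<open>Compare the function at two positions u and u0 of the point with index k; both values tend to 1.\<close>
    have const: "(\<Prod>m\<in>- {i, k}. (u - z m) powi e m) = (\<Prod>m\<in>- {i, k}. (u0 - z m) powi e m)"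
      if u: "u \<notin> z ` (- {i, k})" for u
    proof -
      have inj_u: "inj_on (z(k := u)) (- {i})" if "u \<notin> z ` (- {i, k})" for u
        using that zki by (intro inj_on_coordinate_update) (auto simp: insert_commute)
      have lim_u: "((\<lambda>s. 1 - f (z(k := u, i := s))) \<longlongrightarrow> 1) (at (z j))"
        if "u \<notin> z ` (- {i, k})" for u
        using lim[OF inj_u[OF that]] k by auto
      have "((\<lambda>s. (1 - f (z(k := u, i := s))) * Q s u0 - (1 - f (z(k := u0, i := s))) * Q s u) \<longlongrightarrow>
          1 * (\<Prod>m\<in>- {i, k}. (u0 - z m) powi e m) - 1 * (\<Prod>m\<in>- {i, k}. (u - z m) powi e m)) (at (z j))"
        by (intro tendsto_intros lim_u Qlim u u0)
      moreover have "\<forall>\<^sub>F s in at (z j).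
          (1 - f (z(k := u, i := s))) * Q s u0 - (1 - f (z(k := u0, i := s))) * Q s u = 0"
      proof -
        have "z j \<notin> insert u (insert u0 (z ` (- {i, k, j})))"
          using u u0 ij k z by (auto simp: inj_on_def)
        then have "\<forall>\<^sub>F s in at (z j). s \<in> - insert u (insert u0 (z ` (- {i, k, j}))) - {z j}"
          by (intro eventually_at_in_open open_Compl finite_imp_closed) auto
        then show ?thesis
        proof eventually_elim
          case (elim s)
          have "- {i, k} = insert j (- {i, k, j})" using ij k by auto
          then have s: "s \<notin> z ` (- {i, k})" "s \<noteq> u" "s \<noteq> u0" using elim by auto
          have "inj_on (z(i := s)) (- {k})"
            using s zki by (intro inj_on_coordinate_update) (auto simp: insert_commute)
          then obtain c where c: "\<And>u. u \<notin> (z(i := s)) ` (- {k}) \<Longrightarrow>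
              1 - f (z(i := s, k := u)) = c * (\<Prod>m\<in>- {k}. (u - (z(i := s)) m) powi b k m)"
            using has_exponents_atD[OF g] unfolding has_exponents_at_def by blast
          have eq: "(\<Prod>m\<in>- {k}. (u - (z(i := s)) m) powi b k m) = Q s u" for u
          proof -
            have "- {k} = insert i (- {i, k})" using k by auto
            then have "(\<Prod>m\<in>- {k}. (u - (z(i := s)) m) powi b k m) =
              (u - s) powi b k i * (\<Prod>m\<in>- {i, k}. (u - (z(i := s)) m) powi b k m)" by simp
            also have "(\<Prod>m\<in>- {i, k}. (u - (z(i := s)) m) powi b k m) = (\<Prod>m\<in>- {i, k}. (u - z m) powi b k m)"
              by (intro prod.cong) auto
            finally show ?thesis by (simp add: Q_def)
          qed
          have img: "(z(i := s)) ` (- {k}) = insert s (z ` (- {i, k}))"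
            using image_coordinate_update[of i k z s] k by (simp add: insert_commute)
          have "1 - f (z(k := u, i := s)) = c * Q s u" "1 - f (z(k := u0, i := s)) = c * Q s u0"
            using c[of u] c[of u0] u u0 s k unfolding img eq by (auto simp: fun_upd_twist)
          then show ?case by simp
        qed
      qed
      ultimately have "((\<lambda>s. 0) \<longlongrightarrow> 1 * (\<Prod>m\<in>- {i, k}. (u0 - z m) powi e m) -
          1 * (\<Prod>m\<in>- {i, k}. (u - z m) powi e m)) (at (z j))"
        by (rule Lim_transform_eventually)
      then show ?thesis by (simp add: tendsto_const_iff)
    qed
    have zik: "inj_on z (- {i, k})" by (rule inj_on_subset[OF z]) auto
    have "e l = 0"
      by (rule prod_powi_exponents_unique[of "- {i, k}" z 1 "\<Prod>m\<in>- {i, k}. (u0 - z m) powi e m" "{}" e "\<lambda>_. 0" l])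
        (use zik Qlim(2)[OF u0] const l in auto)
    then show ?thesis by (simp add: e_def)
  qed
  show "b k i + b k j = 0" if "k \<noteq> i" "k \<noteq> j" for k using main[of k j] that ij by simp
  show "b k l = 0" if "k \<noteq> i" "k \<noteq> j" "l \<noteq> i" "l \<noteq> j" "l \<noteq> k" for k l
    using main[of k l] that by simp
qed

section \<open>Functions of configurations omitting two values\<close>

definition cratio :: "complex \<Rightarrow> complex \<Rightarrow> complex \<Rightarrow> complex \<Rightarrow> complex" where
  "cratio a b c d = ((a - b) * (c - d)) / ((a - d) * (c - b))"

text \<open>This is \<open>zero_edge\<close> for \<open>1 / f\<close>, since \<open>1 - 1 / f = - (1 - f) / f\<close> has exponents \<open>b - a\<close>.\<close>

lemma pole_edge:
  fixes f :: "('n::finite \<Rightarrow> complex) \<Rightarrow> complex"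
  assumes om: "omits_01 f" and f: "has_exponents f a" and g: "has_exponents (\<lambda>z. 1 - f z) b"
    and ij: "i \<noteq> j" "a i j < 0"
  shows "b i j = a i j"
    and "\<And>k. k \<noteq> i \<Longrightarrow> k \<noteq> j \<Longrightarrow> b k i + b k j = a k i + a k j"
    and "\<And>k l. k \<noteq> i \<Longrightarrow> k \<noteq> j \<Longrightarrow> l \<noteq> i \<Longrightarrow> l \<noteq> j \<Longrightarrow> l \<noteq> k \<Longrightarrow> b k l = a k l"
proof -
  have inv: "has_exponents (\<lambda>z. inverse (f z)) (\<lambda>i j. - a i j)"
    by (rule has_exponents_inverse[OF f])
  have "has_exponents (\<lambda>z. - 1 * ((1 - f z) * inverse (f z))) (\<lambda>i j. 0 + (b i j + - a i j))"
    by (intro has_exponents_mult has_exponents_const g inv) auto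
  then have "has_exponents (\<lambda>z. 1 - inverse (f z)) (\<lambda>i j. b i j - a i j)"
    by (rule has_exponents_cong) (use omits_01_nonzero[OF om] in \<open>auto simp: field_simps\<close>)
  note Z = zero_edge[OF inv this ij(1)]
  show "b i j = a i j" using Z(1) ij by simp
  show "b k i + b k j = a k i + a k j" if "k \<noteq> i" "k \<noteq> j" for k using Z(2)[OF _ that] ij by simp
  show "b k l = a k l" if "k \<noteq> i" "k \<noteq> j" "l \<noteq> i" "l \<noteq> j" "l \<noteq> k" for k l
    using Z(3)[OF _ that] ij by simp
qed

lemma exponent_row_zero_imp_constant:
  assumes "has_exponents f a" "inj_on z (- {i})" "\<And>j. j \<noteq> i \<Longrightarrow> a i j = 0"
  shows "\<exists>c. c \<noteq> 0 \<and> (\<forall>t. t \<notin> z ` (- {i}) \<longrightarrow> f (z(i := t)) = c)"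
proof -
  have "(\<Prod>j\<in>- {i}. (t - z j) powi a i j) = 1" for t
    using assms(3) by (intro prod.neutral) auto
  then show ?thesis using has_exponents_atD[OF assms(1,2)] unfolding has_exponents_at_def by simp
qed

text \<open>View the indices as vertices of a graph. An edge with \<open>a > 0\<close> is a zero edge, one with \<open>b > 0\<close> a one edge,
  one with \<open>a < 0\<close> or \<open>b < 0\<close> a pole edge; then \<open>a = b\<close>. A nonconstant rational function attains each of
  \<open>0, 1, \<infinity>\<close>, so a vertex \<open>i\<close> on any edge has a zero edge to some \<open>j\<close>, a one edge to some \<open>k\<close> and a pole edge
  to some \<open>l\<close>. The rules for edges then force the remaining edges among \<open>i, j, k, l\<close>, with opposite edges of the
  same kind and all weights equal. An edge that leaves this complete graph would be disjoint from edges of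
  different kinds, which the rules forbid.\<close>

lemma exponents_row_pattern:
  fixes f :: "('n::finite \<Rightarrow> complex) \<Rightarrow> complex"
  assumes om: "omits_01 f" and f: "has_exponents f a" and g: "has_exponents (\<lambda>z. 1 - f z) b"
    and suma: "\<And>i. sum (a i) (- {i}) = 0" and sumb: "\<And>i. sum (b i) (- {i}) = 0"
    and nz: "i \<noteq> j'" "a i j' \<noteq> 0"
  shows "\<exists>j k l w. distinct [i, j, k, l] \<and> w > 0 \<and>
    (\<forall>p. p \<noteq> i \<longrightarrow> a i p = (if p = j then w else if p = l then - w else 0)) \<and>
    (\<forall>p. p \<noteq> i \<longrightarrow> b i p = (if p = k then w else if p = l then - w else 0))"
proof -
  \<comment> \<open>With this, every rule for f and 1 - f holds with the two exchanged.\<close>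
  have ff: "has_exponents (\<lambda>z. 1 - (1 - f z)) a" using f by simp
  note syma = exponents_symmetric[OF f] and symb = exponents_symmetric[OF g]
  note Z = zero_edge[OF f g] and O = zero_edge[OF g ff]
    and P = pole_edge[OF om f g] and P2 = pole_edge(1)[OF omits_01_one_minus[OF om] g ff]
  have pos: "\<exists>j. j \<noteq> i \<and> e j > 0" if "j \<noteq> i" "e j \<noteq> 0" "sum e (- {i}) = 0" for e :: "'n \<Rightarrow> int" and j
  proof (rule ccontr)
    assume "\<nexists>j. j \<noteq> i \<and> e j > 0"
    then have "\<forall>j\<in>- {i}. - e j \<ge> 0" by force
    moreover have "sum (\<lambda>j. - e j) (- {i}) = 0" using that(3) by (simp add: sum_negf)
    ultimately have "\<forall>j\<in>- {i}. - e j = 0" by (subst (asm) sum_nonneg_eq_0_iff) auto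
    then show False using that by auto
  qed
  obtain j where j: "j \<noteq> i" "a i j > 0" using pos[of j' "a i"] nz suma by auto
  have "\<exists>k. k \<noteq> i \<and> b i k \<noteq> 0"
  proof (rule ccontr)
    assume 0: "\<nexists>k. k \<noteq> i \<and> b i k \<noteq> 0"
    obtain z :: "'n \<Rightarrow> complex" where "inj z" using ex_inj_complex by blast
    then have z: "inj_on z (- {i})" by (rule inj_on_subset) auto
    obtain c where "\<forall>t. t \<notin> z ` (- {i}) \<longrightarrow> 1 - f (z(i := t)) = c"
      using exponent_row_zero_imp_constant[OF g z] 0 by blast
    then have c: "f (z(i := t)) = 1 - c" if "t \<notin> z ` (- {i})" for t
      using that by (metis add_diff_cancel_left' diff_add_cancel)
    have "infinite (UNIV - z ` (- {i}))" by (intro Diff_infinite_finite infinite_UNIV_char_0) auto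
    then have "UNIV - z ` (- {i}) \<noteq> {}" by (metis finite.emptyI)
    then obtain t0 where "t0 \<notin> z ` (- {i})" by blast
    then have "1 - c \<noteq> 0"
      using c om z unfolding omits_01_def by metis
    moreover obtain d where "d \<noteq> 0"
      "\<And>t. t \<notin> z ` (- {i}) \<Longrightarrow> f (z(i := t)) = d * (\<Prod>j\<in>- {i}. (t - z j) powi a i j)"
      using has_exponents_atD[OF f z] unfolding has_exponents_at_def by blast
    ultimately have "a i j = (\<lambda>_. 0) j"
      using prod_powi_exponents_unique[of "- {i}" z d "1 - c" "{}" "a i" "\<lambda>_. 0" j] z c j by auto
    then show False using j by simp
  qed
  then obtain k' where k': "k' \<noteq> i" "b i k' \<noteq> 0" by blast
  obtain k where k: "k \<noteq> i" "b i k > 0" using pos[of k' "b i"] k' sumb by auto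
  obtain l where l: "l \<noteq> i" "b i l < 0" using pos[of k' "\<lambda>l. - b i l"] k' sumb by (auto simp: sum_negf)
  have bij: "b i j = 0" using Z(1)[of i j] j by simp
  have aik: "a i k = 0" using O(1)[of i k] k by simp
  have ail: "a i l = b i l" using P2[of i l] l by simp
  have d: "j \<noteq> k" "l \<noteq> j" "l \<noteq> k" using j k l bij aik ail by auto
  have bkj: "b k j = - b i k" using Z(2)[of i j k] j k d symb[of k i] by simp
  have akj: "a k j = b k j" using P2[of k j] bkj k d by simp
  have w: "a i j = b i k" using O(2)[of i k j] j k d akj bkj syma[of j i] syma[of j k] by simp
  have akl: "a l k = - a i l" using O(2)[of i k l] k l d syma[of l i] by simp
  have bil: "b i l = - b i k" using Z(2)[of l k i] akl ail l k d by simp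
  have a0: "a i p = 0" and b0: "b i p = 0" if p: "p \<notin> {i, j, k, l}" for p
  proof -
    have "b p k = 0" "b p l = 0" "b p i + b p j = 0"
      using Z(2)[of i j p] Z(3)[of i j p] p j k l d by auto
    moreover have "a p j = 0" "a p l = 0" "a p i + a p k = 0"
      using O(2)[of i k p] O(3)[of i k p] p j k l d by auto
    moreover have "b p j = a p j" "b p k = a p k"
      using P(3)[of i l p] p j k l d ail by auto
    ultimately show "a i p = 0" "b i p = 0" using syma[of i p] symb[of i p] by auto
  qed
  show ?thesis
  proof (intro exI conjI)
    show "distinct [i, j, k, l]" using j k l d by auto
    show "a i j > 0" by fact
    show "\<forall>p. p \<noteq> i \<longrightarrow> a i p = (if p = j then a i j else if p = l then - a i j else 0)"
      using a0 aik ail bil w d by auto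
    show "\<forall>p. p \<noteq> i \<longrightarrow> b i p = (if p = k then a i j else if p = l then - a i j else 0)"
      using b0 bij bil w d by auto
  qed
qed

text \<open>If the exponent were at least two, both the identity and its derivative would have right-hand side \<open>0\<close> at
  \<open>v\<close>, and these two equations are independent unless \<open>x = y\<close>.\<close>

lemma three_powers_dependent_imp_linear:
  fixes C D :: complex
  assumes eq: "\<And>t. C * (t - x) ^ n + D * (t - y) ^ n = (t - v) ^ n"
    and "n > 0" "C \<noteq> 0" "x \<noteq> y" "v \<noteq> x" 
  shows "n = 1"
proof (rule ccontr)
  assume "n \<noteq> 1"
  then obtain m where m: "n = Suc (Suc m)" using \<open>n > 0\<close> by (metis One_nat_def gr0_implies_Suc neq0_conv)
  have "((\<lambda>t. C * (t - x) ^ n + D * (t - y) ^ n) has_field_derivative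
      C * (of_nat n * (v - x) ^ (n - 1)) + D * (of_nat n * (v - y) ^ (n - 1))) (at v)"
    by (auto intro!: derivative_eq_intros)
  then have "((\<lambda>t. C * (t - x) ^ n + D * (t - y) ^ n) has_field_derivative
      of_nat n * (C * (v - x) ^ Suc m + D * (v - y) ^ Suc m)) (at v)"
    unfolding m by (simp only: diff_Suc_1 distrib_left mult.left_commute)
  moreover have "((\<lambda>t. (t - v) ^ n) has_field_derivative 0) (at v)"
    unfolding m by (auto intro!: derivative_eq_intros)
  ultimately have "of_nat n * (C * (v - x) ^ Suc m + D * (v - y) ^ Suc m) = 0"
    unfolding eq by (rule DERIV_unique)
  then have 1: "C * (v - x) ^ Suc m + D * (v - y) ^ Suc m = 0"
    using \<open>n > 0\<close> by (simp only: mult_eq_0_iff of_nat_eq_0_iff) auto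
  have "C * (v - x) ^ n + D * (v - y) ^ n = 0" using eq[of v] \<open>n > 0\<close> by simp
  then have "C * (v - x) ^ Suc m * (v - x) + D * (v - y) ^ Suc m * (v - y) = 0"
    unfolding m by (simp add: mult.commute mult.left_commute)
  moreover have "p * (y - x) = (p * (v - x) + q * (v - y)) - (p + q) * (v - y)" for p q
    by (simp add: algebra_simps)
  ultimately have "C * (v - x) ^ Suc m * (y - x) = 0" using 1 by (metis diff_self mult_zero_left)
  then show False using assms by simp
qed

text \<open>By \<open>exponents_row_pattern\<close>, as functions of the point \<open>z\<^sub>i\<close> both \<open>f\<close> and \<open>1 - f\<close> are constants times the
  \<open>w\<close>-th power of a fractional linear function with the same pole. Clearing denominators in
  \<open>f + (1 - f) = 1\<close> gives a relation between three \<open>w\<close>-th powers, hence \<open>w = 1\<close>, and the constant is determined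
  by evaluating at \<open>z\<^sub>k\<close>.\<close>

theorem omits_01_classification:
  fixes f :: "('n::finite \<Rightarrow> complex) \<Rightarrow> complex"
  assumes om: "omits_01 f"
  shows "(\<exists>c. \<forall>z. inj z \<longrightarrow> f z = c) \<or>
    (\<exists>i j k l. distinct [i, j, k, l] \<and> (\<forall>z. inj z \<longrightarrow> f z = cratio (z i) (z j) (z k) (z l)))"
proof -
  obtain a where f: "has_exponents f a" and suma: "\<And>i. sum (a i) (- {i}) = 0"
    using omits_01_imp_has_exponents[OF om] by blast
  obtain b where g: "has_exponents (\<lambda>z. 1 - f z) b" and sumb: "\<And>i. sum (b i) (- {i}) = 0"
    using omits_01_imp_has_exponents[OF omits_01_one_minus[OF om]] by blast
  show ?thesis
  proof (cases "\<exists>i j. i \<noteq> j \<and> a i j \<noteq> 0")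
    case False
    obtain z0 :: "'n \<Rightarrow> complex" where z0: "inj z0" using ex_inj_complex by blast
    have "f z = f z0" if "inj z" for z
    proof (rule configurations_connected_by_single_moves[of UNIV z0 z "\<lambda>z. f z = f z0", OF _ z0 that refl])
      fix z k u assume z: "inj z" "inj (z(k := u))" "f z = f z0"
      have "f (z(k := u)) = f (z(k := z k))"
        using exponent_row_zero_imp_constant[OF f, of z k] False z
        by (metis fun_upd_triv inj_fun_upd_iff)
      then show "f (z(k := u)) = f z0" using z by simp
    next
      fix z z' assume "\<And>j. j \<in> UNIV \<Longrightarrow> z j = z' j" "f z = f z0"
      then show "f z' = f z0" by (metis UNIV_I ext)
    qed auto
    then show ?thesis by blast
  next
    case True
    then obtain i j' where "i \<noteq> j'" "a i j' \<noteq> 0" by blast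
    from exponents_row_pattern[OF om f g suma sumb this]
    obtain j k l w where d: "distinct [i, j, k, l]" and w: "w > 0"
      and ra: "\<And>p. p \<noteq> i \<Longrightarrow> a i p = (if p = j then w else if p = l then - w else 0)"
      and rb: "\<And>p. p \<noteq> i \<Longrightarrow> b i p = (if p = k then w else if p = l then - w else 0)"
      by blast
    define n where "n = nat w"
    have wn: "w = int n" "n > 0" using w by (auto simp: n_def)
    have "f z = cratio (z i) (z j) (z k) (z l)" if z: "inj z" for z
    proof -
      have zi: "inj_on z (- {i})" by (rule inj_on_subset[OF z]) auto
      have prod: "(\<Prod>p\<in>- {i}. (t - z p) powi e p) = (t - z m) ^ n / (t - z l) ^ n"
        if e: "\<And>p. p \<noteq> i \<Longrightarrow> e p = (if p = m then w else if p = l then - w else 0)"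
          and m: "m \<noteq> i" "m \<noteq> l" for e m t
      proof -
        have "(\<Prod>p\<in>- {i}. (t - z p) powi e p) = (\<Prod>p\<in>{m, l}. (t - z p) powi e p)"
          using e m d by (intro prod.mono_neutral_right) auto
        then show ?thesis using e[of m] e[of l] m d wn by (auto simp: power_int_minus divide_inverse)
      qed
      obtain C where C: "C \<noteq> 0" "\<And>t. t \<notin> z ` (- {i}) \<Longrightarrow> f (z(i := t)) = C * ((t - z j) ^ n / (t - z l) ^ n)"
        using has_exponents_atD[OF f zi] prod[of "a i" j, OF ra] d unfolding has_exponents_at_def by auto
      obtain D where D: "D \<noteq> 0" "\<And>t. t \<notin> z ` (- {i}) \<Longrightarrow> 1 - f (z(i := t)) = D * ((t - z k) ^ n / (t - z l) ^ n)"
        using has_exponents_atD[OF g zi] prod[of "b i" k, OF rb] d unfolding has_exponents_at_def by auto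
      have eq: "C * (t - z j) ^ n + D * (t - z k) ^ n = (t - z l) ^ n" for t
      proof -
        have off: "C * (t - z j) ^ n + D * (t - z k) ^ n - (t - z l) ^ n = 0" if t: "t \<notin> z ` (- {i})" for t
        proof -
          have "t \<noteq> z l" using t d by auto
          moreover have "C * ((t - z j) ^ n / (t - z l) ^ n) + D * ((t - z k) ^ n / (t - z l) ^ n) = 1"
            unfolding C(2)[OF t, symmetric] D(2)[OF t, symmetric] by simp
          ultimately show ?thesis by (simp add: field_simps)
        qed
        have "closure (- z ` (- {i})) = UNIV"
          by (simp add: closure_complement empty_interior_finite)
        then have "t \<in> closure (- z ` (- {i}))" by simp
        have "continuous_on (closure (- z ` (- {i}))) (\<lambda>t. C * (t - z j) ^ n + D * (t - z k) ^ n - (t - z l) ^ n)"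
          by (intro continuous_intros)
        then have "C * (t - z j) ^ n + D * (t - z k) ^ n - (t - z l) ^ n = 0"
          by (rule continuous_constant_on_closure) (use off \<open>t \<in> closure _\<close> in auto)
        then show ?thesis by simp
      qed
      have ne: "z j \<noteq> z k" "z l \<noteq> z j" "z i \<noteq> z l" using d z by (auto simp: inj_def)
      have n1: "n = 1"
        by (rule three_powers_dependent_imp_linear[OF eq wn(2) C(1)]) (use ne in auto)
      have "C * (z k - z j) = z k - z l" using eq[of "z k"] n1 by simp
      then have "C = (z k - z l) / (z k - z j)" using ne by (simp add: field_simps)
      moreover have "z i \<notin> z ` (- {i})" using z by (auto simp: inj_def)
      then have "f z = C * ((z i - z j) / (z i - z l))" using C(2)[of "z i"] n1 by simp
      ultimately show ?thesis by (simp add: cratio_def mult.commute)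
    qed
    then show ?thesis using d by blast
  qed
qed

section \<open>Families of cross-ratios\<close>

text \<open>The orbit of a quadruple under the Klein four-group, the group of those permutations of four points that
  leave the cross-ratio unchanged. Each of its elements is determined by the place to which it moves a
  chosen entry, so any entry can be brought into first or last position.\<close>

definition klein :: "'i \<Rightarrow> 'i \<Rightarrow> 'i \<Rightarrow> 'i \<Rightarrow> ('i \<times> 'i \<times> 'i \<times> 'i) set" where
  "klein a b c d = {(a, b, c, d), (b, a, d, c), (c, d, a, b), (d, c, b, a)}"

lemma klein_refl: "(a, b, c, d) \<in> klein a b c d" by (simp add: klein_def)

lemma klein_sym: "(p, q, r, s) \<in> klein a b c d \<Longrightarrow> (a, b, c, d) \<in> klein p q r s"
  by (auto simp: klein_def)

lemma klein_trans:
  "(p, q, r, s) \<in> klein a b c d \<Longrightarrow> (a, b, c, d) \<in> klein u v w x \<Longrightarrow> (p, q, r, s) \<in> klein u v w x"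
  by (auto simp: klein_def)

lemma klein_distinct: "(p, q, r, s) \<in> klein a b c d \<Longrightarrow> distinct [a, b, c, d] \<Longrightarrow> distinct [p, q, r, s]"
  by (auto simp: klein_def)

lemma klein_set: "(p, q, r, s) \<in> klein a b c d \<Longrightarrow> {p, q, r, s} = {a, b, c, d}"
  by (auto simp: klein_def)

lemma klein_first: "x \<in> {a, b, c, d} \<Longrightarrow> \<exists>q r s. (x, q, r, s) \<in> klein a b c d"
  by (auto simp: klein_def)

lemma klein_last: "x \<in> {a, b, c, d} \<Longrightarrow> \<exists>p q r. (p, q, r, x) \<in> klein a b c d"
  by (auto simp: klein_def)

lemma cratio_klein_invariant:
  assumes "(p, q, r, s) \<in> klein a b c d"
  shows "cratio (z p) (z q) (z r) (z s) = cratio (z a) (z b) (z c) (z d)"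
proof -
  have "cratio b a d c = cratio a b c d" "cratio c d a b = cratio a b c d"
    "cratio d c b a = cratio a b c d" for a b c d
  proof -
    have "(b - a) * (d - c) = (a - b) * (c - d)" "(b - c) * (d - a) = (a - d) * (c - b)"
      by (simp_all add: algebra_simps)
    then show "cratio b a d c = cratio a b c d" by (simp add: cratio_def)
    show "cratio c d a b = cratio a b c d" by (simp add: cratio_def mult.commute)
    have "(d - c) * (b - a) = (a - b) * (c - d)" "(d - a) * (b - c) = (a - d) * (c - b)"
      by (simp_all add: algebra_simps)
    then show "cratio d c b a = cratio a b c d" by (simp add: cratio_def)
  qed
  then show ?thesis using assms by (auto simp: klein_def)
qed

text \<open>The exponents of the cross-ratio: it vanishes where the points collide along the matching \<open>i j | k l\<close> and has
  poles along \<open>i l | j k\<close>; along the third matching \<open>i k | j l\<close> it takes the value \<open>1\<close>.\<close>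

definition cr_exponent :: "'i \<Rightarrow> 'i \<Rightarrow> 'i \<Rightarrow> 'i \<Rightarrow> 'i \<Rightarrow> 'i \<Rightarrow> int" where
  "cr_exponent i j k l u v =
    (if {u, v} = {i, j} \<or> {u, v} = {k, l} then 1
     else if {u, v} = {i, l} \<or> {u, v} = {j, k} then - 1 else 0)"

lemma cr_exponent_klein_invariant:
  assumes "(p, q, r, s) \<in> klein a b c d"
  shows "cr_exponent p q r s = cr_exponent a b c d"
proof -
  consider "(p, q, r, s) = (a, b, c, d)" | "(p, q, r, s) = (b, a, d, c)"
    | "(p, q, r, s) = (c, d, a, b)" | "(p, q, r, s) = (d, c, b, a)"
    using assms by (auto simp: klein_def)
  then show ?thesis
    by cases (simp_all add: cr_exponent_def fun_eq_iff insert_commute disj_commute)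
qed

lemma cr_exponent_rows:
  assumes "distinct [i, j, k, l]"
  shows "cr_exponent i j k l i v = (if v = j then 1 else if v = l then - 1 else 0)"
    and "cr_exponent i j k l j v = (if v = i then 1 else if v = k then - 1 else 0)"
    and "cr_exponent i j k l k v = (if v = l then 1 else if v = j then - 1 else 0)"
    and "cr_exponent i j k l l v = (if v = k then 1 else if v = i then - 1 else 0)"
    and "u \<notin> {i, j, k, l} \<Longrightarrow> cr_exponent i j k l u v = 0"
proof -
  have ne: "i \<noteq> j" "i \<noteq> k" "i \<noteq> l" "j \<noteq> k" "j \<noteq> l" "k \<noteq> l"
    "j \<noteq> i" "k \<noteq> i" "l \<noteq> i" "k \<noteq> j" "l \<noteq> j" "l \<noteq> k" using assms by auto
  show "cr_exponent i j k l i v = (if v = j then 1 else if v = l then - 1 else 0)"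
    "cr_exponent i j k l j v = (if v = i then 1 else if v = k then - 1 else 0)"
    "cr_exponent i j k l k v = (if v = l then 1 else if v = j then - 1 else 0)"
    "cr_exponent i j k l l v = (if v = k then 1 else if v = i then - 1 else 0)"
    by (simp_all add: cr_exponent_def doubleton_eq_iff ne)
  show "u \<notin> {i, j, k, l} \<Longrightarrow> cr_exponent i j k l u v = 0"
    by (simp add: cr_exponent_def doubleton_eq_iff)
qed

lemma has_exponents_difference:
  fixes i j :: "'n::finite"
  assumes "i \<noteq> j"
  shows "has_exponents (\<lambda>z. z i - z j) (\<lambda>u v. if {u, v} = {i, j} then 1 else 0)"
  unfolding has_exponents_def
proof (intro allI impI)
  fix u and z :: "'n \<Rightarrow> complex" assume z: "inj_on z (- {u})"
  let ?e = "\<lambda>v. if {u, v} = {i, j} then 1 else (0::int)"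
  have single: "(\<Prod>v\<in>- {u}. (t - z v) powi ?e v) = t - z w"
    if "w \<noteq> u" "{u, w} = {i, j}" for w t
  proof -
    have "(\<Prod>v\<in>- {u}. (t - z v) powi ?e v) = (\<Prod>v\<in>{w}. (t - z v) powi ?e v)"
      using that by (intro prod.mono_neutral_right) (auto simp: doubleton_eq_iff)
    then show ?thesis using that by simp
  qed
  consider "u = i" | "u = j" | "u \<noteq> i" "u \<noteq> j" by blast
  then show "has_exponents_at (\<lambda>z. z i - z j) u z ?e"
  proof cases
    case 1
    then show ?thesis using single[of j] assms unfolding has_exponents_at_def
      by (intro exI[of _ 1]) auto
  next
    case 2
    then show ?thesis using single[of i] assms unfolding has_exponents_at_def
      by (intro exI[of _ "- 1"]) (auto simp: insert_commute)
  next
    case 3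
    then have "(\<Prod>v\<in>- {u}. (t - z v) powi ?e v) = 1" for t
      by (intro prod.neutral) (auto simp: doubleton_eq_iff)
    moreover have "z i \<noteq> z j" using z 3 assms by (auto dest: inj_onD)
    ultimately show ?thesis using 3 unfolding has_exponents_at_def
      by (intro exI[of _ "z i - z j"]) auto
  qed
qed

lemma has_exponents_cratio:
  fixes i j k l :: "'n::finite"
  assumes "distinct [i, j, k, l]"
  shows "has_exponents (\<lambda>z. cratio (z i) (z j) (z k) (z l)) (cr_exponent i j k l)"
proof (rule has_exponents_cong)
  show "has_exponents (\<lambda>z. ((z i - z j) * (z k - z l)) * inverse ((z i - z l) * (z k - z j)))
    (\<lambda>u v. ((if {u, v} = {i, j} then 1 else 0) + (if {u, v} = {k, l} then 1 else 0)) +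
       - ((if {u, v} = {i, l} then 1 else 0) + (if {u, v} = {k, j} then 1 else 0)))"
    using assms by (intro has_exponents_mult has_exponents_inverse has_exponents_difference) auto
next
  fix u v
  have "{i, j} \<noteq> {k, l}" "{i, j} \<noteq> {i, l}" "{i, j} \<noteq> {k, j}" "{k, l} \<noteq> {i, l}"
    "{k, l} \<noteq> {k, j}" "{i, l} \<noteq> {k, j}"
    using assms by (auto simp: doubleton_eq_iff)
  then show "((if {u, v} = {i, j} then 1 else 0) + (if {u, v} = {k, l} then 1 else 0)) +
       - ((if {u, v} = {i, l} then 1 else 0) + (if {u, v} = {k, j} then 1 else 0)) =
       cr_exponent i j k l u v"
    by (simp add: cr_exponent_def insert_commute[of j k])
qed (simp add: cratio_def divide_inverse)

text \<open>The quotient is itself classified, and its exponents are the difference of those of numerator and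
  denominator. In the row of \<open>s\<close> only the numerator contributes, so \<open>s\<close> is one of the four points of the
  quotient and its edges to \<open>r\<close> and \<open>p\<close> are known: the quotient is the cross-ratio of \<open>p, x, r, s\<close> for some
  \<open>x\<close>. Subtracting these exponents from those of the numerator leaves exactly the exponents of the cross-ratio
  of \<open>p, q, r, x\<close>.\<close>

lemma omits_01_ratio_of_cratios:
  fixes p q r s a b c d :: "'n::finite"
  assumes d1: "distinct [p, q, r, s]" and d2: "distinct [a, b, c, d]"
    and s: "s \<notin> {a, b, c, d}"
    and om: "omits_01 (\<lambda>z. cratio (z p) (z q) (z r) (z s) / cratio (z a) (z b) (z c) (z d))"
      (is "omits_01 ?g")
  shows "\<exists>x. x \<notin> {p, q, r, s} \<and> (p, q, r, x) \<in> klein a b c d"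
proof -
  define E where "E = (\<lambda>u v. cr_exponent p q r s u v - cr_exponent a b c d u v)"
  have "has_exponents (\<lambda>z. cratio (z p) (z q) (z r) (z s) * inverse (cratio (z a) (z b) (z c) (z d)))
      (\<lambda>u v. cr_exponent p q r s u v + - cr_exponent a b c d u v)"
    by (rule has_exponents_mult[OF has_exponents_cratio[OF d1] has_exponents_inverse[OF has_exponents_cratio[OF d2]]])
  then have gE: "has_exponents ?g E" by (simp add: E_def divide_inverse)
  consider c where "\<And>z. inj z \<Longrightarrow> ?g z = c"
    | i j k l where "distinct [i, j, k, l]" "\<And>z. inj z \<Longrightarrow> ?g z = cratio (z i) (z j) (z k) (z l)"
    using omits_01_classification[OF om] by blast
  then show ?thesis
  proof cases
    case (1 c)
    obtain z :: "'n \<Rightarrow> complex" where "inj z" using ex_inj_complex by blast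
    then have "c \<noteq> 0" using 1 omits_01_nonzero(1)[OF om] by auto
    from has_exponents_const[OF this] have "has_exponents ?g (\<lambda>u v. 0)"
      by (rule has_exponents_cong) (use 1 in auto)
    then have "E s r = 0" using has_exponents_unique[OF gE] d1 by auto
    then show ?thesis using d1 cr_exponent_rows(4)[OF d1, of r] cr_exponent_rows(5)[OF d2 s] by (simp add: E_def)
  next
    case (2 i j k l)
    have "has_exponents ?g (cr_exponent i j k l)"
      by (rule has_exponents_cong[OF has_exponents_cratio[OF 2(1)]]) (use 2 in auto)
    then have eq: "cr_exponent i j k l u v = E u v" if "u \<noteq> v" for u v
      using has_exponents_unique gE that by blast
    have "E s r = 1" "E s p = - 1" 
      using d1 cr_exponent_rows(4)[OF d1] cr_exponent_rows(5)[OF d2 s] by (simp_all add: E_def)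
    then have sr: "cr_exponent i j k l s r = 1" "cr_exponent i j k l s p = - 1" using eq d1 by auto
    then have "s \<in> {i, j, k, l}" using cr_exponent_rows(5)[OF 2(1), of s r] by fastforce
    then obtain i' x k' where rot: "(i', x, k', s) \<in> klein i j k l" using klein_last by metis
    have dx: "distinct [i', x, k', s]" using klein_distinct[OF rot 2(1)] .
    have "cr_exponent i' x k' s s r = 1" "cr_exponent i' x k' s s p = - 1"
      using sr cr_exponent_klein_invariant[OF rot] by auto
    then have "k' = r" "i' = p" unfolding cr_exponent_rows(4)[OF dx] by (auto split: if_splits)
    then have eq': "cr_exponent a b c d u v = cr_exponent p q r s u v - cr_exponent p x r s u v"
      if "u \<noteq> v" for u v
      using eq[OF that] cr_exponent_klein_invariant[OF rot] by (simp add: E_def)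
    have dx: "distinct [p, x, r, s]" using dx \<open>k' = r\<close> \<open>i' = p\<close> by simp
    have "cr_exponent a b c d a b = 1" by (simp add: cr_exponent_def)
    then have "x \<noteq> q" using eq'[of a b] d2 by auto
    then have x: "x \<notin> {p, q, r, s}" using dx by auto
    have "cr_exponent a b c d p q = 1" "cr_exponent a b c d p x = - 1" "cr_exponent a b c d q r = - 1"
      using eq'[of p q] eq'[of p x] eq'[of q r] d1 x cr_exponent_rows(1,2)[OF d1]
        cr_exponent_rows(1)[OF dx] cr_exponent_rows(5)[OF dx, of q r] by auto
    note vals = this
    then have "p \<in> {a, b, c, d}" using cr_exponent_rows(5)[OF d2, of p q] by fastforce
    then obtain b' c' d' where rot': "(p, b', c', d') \<in> klein a b c d" using klein_first by metis
    note d3 = klein_distinct[OF rot' d2]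
    have bd: "b' = q" "d' = x"
      using vals(1,2) unfolding cr_exponent_klein_invariant[OF rot', symmetric] cr_exponent_rows(1)[OF d3]
      by (auto split: if_splits)
    then have "c' = r"
      using vals(3) unfolding cr_exponent_klein_invariant[OF rot', symmetric]
        cr_exponent_rows(2)[OF d3, unfolded bd] bd by (auto split: if_splits)
    then show ?thesis using rot' x bd by blast
  qed
qed

lemma ex_inj_extending:
  fixes w :: "'n::finite \<Rightarrow> complex"
  assumes "inj_on w S"
  shows "\<exists>z. inj z \<and> (\<forall>i\<in>S. z i = w i)"
proof -
  have "infinite (UNIV - w ` S)" by (intro Diff_infinite_finite infinite_UNIV_char_0) auto
  then obtain W where W: "W \<subseteq> UNIV - w ` S" "finite W" "card W = card (- S)"
    using infinite_arbitrarily_large by metis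
  then obtain v where v: "bij_betw v (- S) W" using finite_same_card_bij[of "- S" W] by auto
  define z where "z = (\<lambda>i. if i \<in> S then w i else v i)"
  have zS: "z ` S = w ` S" "z ` (- S) = v ` (- S)" by (auto simp: z_def intro!: image_cong)
  have "inj_on z S" using assms by (rule inj_on_cong[THEN iffD1, rotated]) (simp add: z_def)
  moreover have "inj_on z (- S)"
    using bij_betw_imp_inj_on[OF v] by (rule inj_on_cong[THEN iffD1, rotated]) (simp add: z_def)
  moreover have "z ` (S - - S) \<inter> z ` (- S - S) = {}"
    using W(1) bij_betw_imp_surj_on[OF v] zS by (simp add: Diff_Compl Compl_Diff_eq Diff_eq) blast
  ultimately have "inj_on z (S \<union> - S)" unfolding inj_on_Un by blast
  then show ?thesis by (intro exI[of _ z]) (auto simp: z_def)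
qed

lemma cratio_surjective:
  fixes p q r s :: "'n::finite"
  assumes d: "distinct [p, q, r, s]" and c: "c \<noteq> 0" "c \<noteq> 1"
  shows "\<exists>z. inj z \<and> cratio (z p) (z q) (z r) (z s) = c"
proof -
  have "infinite (UNIV - {0, 1, c})" by (intro Diff_infinite_finite infinite_UNIV_char_0) auto
  then have "UNIV - {0, 1, c} \<noteq> {}" by (metis finite.emptyI)
  then obtain x where x: "x \<noteq> 0" "x \<noteq> 1" "x \<noteq> c" by blast
  define y where "y = x * (c - 1) / (c - x)"
  have y: "y * (c - x) = x * (c - 1)" using x by (simp add: y_def)
  have "y \<noteq> 0" using x c by (simp add: y_def)
  moreover have "y \<noteq> 1"
  proof
    assume "y = 1"
    then have "(x - 1) * c = 0" using y by (simp add: algebra_simps)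
    then show False using x c by simp
  qed
  moreover have "y \<noteq> x"
  proof
    assume "y = x"
    then show False using y x by simp
  qed
  moreover define w where "w = (\<lambda>_. 0)(p := x, q := 0, r := 1, s := y)"
  ultimately have "inj_on w {p, q, r, s}" using d x by (auto simp: inj_on_def)
  from ex_inj_extending[OF this]
  obtain z where z: "inj z" "\<forall>i\<in>{p, q, r, s}. z i = w i" by blast
  have "cratio x 0 1 y = c" using y \<open>y \<noteq> x\<close> x by (simp add: cratio_def field_simps)
  then show ?thesis using z d by (intro exI[of _ z]) (auto simp: w_def)
qed

text \<open>A permutation of four points acts on the cross-ratio by one of the six maps \<open>c, 1 - c, 1 / c,
  1 - 1 / c, 1 / (1 - c), c / (c - 1)\<close>. Each has a fixed point different from \<open>0\<close> and \<open>1\<close>.\<close>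

lemma cratio_permuted_coincidence:
  fixes p q r s a b c d :: "'n::finite"
  assumes d1: "distinct [p, q, r, s]" and d2: "distinct [a, b, c, d]"
    and eq: "{p, q, r, s} = {a, b, c, d}"
  shows "\<exists>z. inj z \<and> cratio (z p) (z q) (z r) (z s) = cratio (z a) (z b) (z c) (z d)"
proof -
  have "s \<in> {a, b, c, d}" using eq by blast
  then obtain a' b' c' where rot: "(a', b', c', s) \<in> klein a b c d" using klein_last by metis
  have d3: "distinct [a', b', c', s]" "{p, q, r, s} = {a', b', c', s}"
    using klein_distinct[OF rot d2] klein_set[OF rot] eq by auto
  have "a' \<in> {p, q, r, s}" "b' \<in> {p, q, r, s}" "c' \<in> {p, q, r, s}" unfolding d3(2) by simp_all
  then have "a' \<in> {p, q, r}" "b' \<in> {p, q, r}" "c' \<in> {p, q, r}" using d3(1) by auto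
  then have cases: "(a', b', c') \<in> {(p, q, r), (r, q, p), (q, p, r), (p, r, q), (q, r, p), (r, p, q)}"
    using d3(1) by auto
  \<comment> \<open>A primitive sixth root of unity is the fixed point for the two permutations of order three.\<close>
  obtain \<omega> :: complex where "\<omega> * (1 - \<omega>) = 1"
  proof
    show "(1 / 2 + \<i> * of_real (sqrt 3) / 2) * (1 - (1 / 2 + \<i> * of_real (sqrt 3) / 2)) = (1 :: complex)"
      by (simp add: complex_eq_iff algebra_simps)
  qed
  moreover from this have "\<omega> \<noteq> 0" "\<omega> \<noteq> 1" by auto
  ultimately have \<omega>: "\<omega> \<noteq> 0" "\<omega> \<noteq> 1" "\<omega> * (1 - \<omega>) = 1" by blast+
  \<comment> \<open>The five non-trivial maps, for permutations that fix the last point.\<close>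
  have perm: "cratio y w x v = 1 / (1 - cratio x y w v)" "cratio w x y v = 1 - 1 / cratio x y w v"
    "cratio w y x v = 1 / cratio x y w v" "cratio x w y v = 1 - cratio x y w v"
    "cratio y x w v = 1 - 1 / (1 - cratio x y w v)"
    if "distinct [x, y, w, v]" for x y w v
  proof -
    have ne: "x - y \<noteq> 0" "y - x \<noteq> 0" "x - w \<noteq> 0" "w - x \<noteq> 0" "x - v \<noteq> 0" "y - w \<noteq> 0" "w - y \<noteq> 0"
      "y - v \<noteq> 0" "w - v \<noteq> 0" using that by auto
    have om: "1 - cratio x y w v = cratio x w y v"
      unfolding cratio_def using ne by (simp add: divide_simps) (simp add: algebra_simps)
    show "cratio x w y v = 1 - cratio x y w v" using om by simp
    show inv: "cratio w y x v = 1 / cratio x y w v"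
      unfolding cratio_def using ne by (simp add: divide_simps)
    show "cratio y w x v = 1 / (1 - cratio x y w v)"
      unfolding om unfolding cratio_def using ne by (simp add: divide_simps)
    show "cratio w x y v = 1 - 1 / cratio x y w v"
      unfolding inv[symmetric] unfolding cratio_def using ne
      by (simp add: divide_simps) (simp add: algebra_simps)
    show "cratio y x w v = 1 - 1 / (1 - cratio x y w v)"
      unfolding om unfolding cratio_def using ne
      by (simp add: divide_simps) (simp add: algebra_simps)
  qed
  have \<omega>': "1 / (1 - \<omega>) = \<omega>" "1 - 1 / \<omega> = \<omega>"
  proof -
    show "1 / (1 - \<omega>) = \<omega>" using \<omega> by (simp add: divide_eq_eq)
    have "1 / \<omega> = 1 - \<omega>" using \<omega> by (simp add: divide_eq_eq mult.commute)
    then show "1 - 1 / \<omega> = \<omega>" by simp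
  qed
  have fixed: ?thesis if v: "v \<noteq> 0" "v \<noteq> 1"
    and eq: "\<And>z. inj z \<Longrightarrow> cratio (z p) (z q) (z r) (z s) = v \<Longrightarrow>
      cratio (z a') (z b') (z c') (z s) = v" for v
  proof -
    obtain z where z: "inj z" "cratio (z p) (z q) (z r) (z s) = v"
      using cratio_surjective[OF d1 v] by blast
    then show ?thesis using eq[OF z] cratio_klein_invariant[OF rot, of z] by auto
  qed
  have dz: "distinct [z p, z q, z r, z s]" if "inj z" for z :: "'n \<Rightarrow> complex"
    using d1 by (simp add: inj_eq[OF that])
  consider "(a', b', c') = (p, q, r)" | "(a', b', c') = (r, q, p)" | "(a', b', c') = (q, p, r)"
    | "(a', b', c') = (p, r, q)" | "(a', b', c') = (q, r, p)" | "(a', b', c') = (r, p, q)"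
    using cases by blast
  then show ?thesis
  proof cases
    case 1 then show ?thesis by (intro fixed[of 2]) simp_all
  next
    case 2 then show ?thesis by (intro fixed[of "- 1"]) (simp_all add: perm[OF dz])
  next
    case 3 then show ?thesis by (intro fixed[of 2]) (simp_all add: perm[OF dz])
  next
    case 4 then show ?thesis by (intro fixed[of "1 / 2"]) (simp_all add: perm[OF dz])
  next
    case 5 then show ?thesis by (intro fixed[OF \<omega>(1,2)]) (simp add: perm[OF dz] \<omega>')
  next
    case 6 then show ?thesis by (intro fixed[OF \<omega>(1,2)]) (simp add: perm[OF dz] \<omega>')
  qed
qed

text \<open>Any two quadruples of the family agree in three positions, up to the Klein four-group. If two of them
  agree precisely in \<open>p, q, r\<close>, a third one that agreed with each of these in three positions, but not in
  \<open>p, q, r\<close>, would contain both of the differing entries, which would have to occupy one and the same position.\<close>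

lemma cratio_family_common_triple:
  fixes a b c d :: "'m \<Rightarrow> 'n::finite"
  assumes J: "J \<noteq> {}" and dj: "\<And>j. j \<in> J \<Longrightarrow> distinct [a j, b j, c j, d j]"
    and om: "\<And>j k. j \<in> J \<Longrightarrow> k \<in> J \<Longrightarrow> j \<noteq> k \<Longrightarrow>
      omits_01 (\<lambda>z. cratio (z (a j)) (z (b j)) (z (c j)) (z (d j)) /
                    cratio (z (a k)) (z (b k)) (z (c k)) (z (d k)))"
  shows "\<exists>p q r e. \<forall>j\<in>J. distinct [p, q, r, e j] \<and> (p, q, r, e j) \<in> klein (a j) (b j) (c j) (d j)"
proof -
  have adj: "\<exists>p q r s x. distinct [p, q, r, s, x] \<and> (p, q, r, s) \<in> klein (a j) (b j) (c j) (d j) \<and>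
      (p, q, r, x) \<in> klein (a k) (b k) (c k) (d k)" if jk: "j \<in> J" "k \<in> J" "j \<noteq> k" for j k
  proof -
    \<comment> \<open>With equal sets of points the two cross-ratios would coincide somewhere.\<close>
    have "\<not> {a j, b j, c j, d j} \<subseteq> {a k, b k, c k, d k}"
    proof
      assume "{a j, b j, c j, d j} \<subseteq> {a k, b k, c k, d k}"
      moreover have "card {a j, b j, c j, d j} = 4" "card {a k, b k, c k, d k} = 4"
        using dj[OF jk(1)] dj[OF jk(2)] by auto
      ultimately have "{a j, b j, c j, d j} = {a k, b k, c k, d k}"
        by (intro card_subset_eq) auto
      from cratio_permuted_coincidence[OF dj[OF jk(1)] dj[OF jk(2)] this]
      show False using omits_01_nonzero[OF om[OF jk]] by force
    qed
    then obtain s where s: "s \<in> {a j, b j, c j, d j}" "s \<notin> {a k, b k, c k, d k}" by blast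
    obtain p q r where rot: "(p, q, r, s) \<in> klein (a j) (b j) (c j) (d j)" using klein_last[OF s(1)] by blast
    have "omits_01 (\<lambda>z. cratio (z p) (z q) (z r) (z s) / cratio (z (a k)) (z (b k)) (z (c k)) (z (d k)))"
      using om[OF jk] unfolding cratio_klein_invariant[OF rot] .
    from omits_01_ratio_of_cratios[OF klein_distinct[OF rot dj[OF jk(1)]] dj[OF jk(2)] s(2) this]
    show ?thesis using rot klein_distinct[OF rot dj[OF jk(1)]] by fastforce
  qed
  obtain j0 where j0: "j0 \<in> J" using J by blast
  show ?thesis
  proof (cases "J = {j0}")
    case True
    then show ?thesis using dj[OF j0] klein_refl by (intro exI[of _ "a j0"] exI[of _ "b j0"] exI[of _ "c j0"] exI[of _ "d"]) auto
  next
    case False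
    then obtain j1 where j1: "j1 \<in> J" "j1 \<noteq> j0" using j0 by blast
    obtain p q r s x where base: "distinct [p, q, r, s, x]"
      "(p, q, r, s) \<in> klein (a j0) (b j0) (c j0) (d j0)" "(p, q, r, x) \<in> klein (a j1) (b j1) (c j1) (d j1)"
      using adj[OF j0 j1(1)] j1(2) by metis
    have "\<exists>e. (p, q, r, e) \<in> klein (a k) (b k) (c k) (d k)" if k: "k \<in> J" for k
    proof (cases "k = j0 \<or> k = j1")
      case True
      then show ?thesis using base by blast
    next
      case False
      then obtain p' q' r' s' x' where 1: "distinct [p', q', r', s', x']"
        "(p', q', r', s') \<in> klein (a k) (b k) (c k) (d k)" "(p', q', r', x') \<in> klein (a j0) (b j0) (c j0) (d j0)"
        using adj[OF k j0] by metis
      obtain p'' q'' r'' s'' x'' where 2: "distinct [p'', q'', r'', s'', x'']"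
        "(p'', q'', r'', s'') \<in> klein (a k) (b k) (c k) (d k)" "(p'', q'', r'', x'') \<in> klein (a j1) (b j1) (c j1) (d j1)"
        using adj[OF k j1(1)] False by metis
      have a1: "(p', q', r', x') \<in> klein p q r s" using klein_trans[OF 1(3) klein_sym[OF base(2)]] .
      have a2: "(p'', q'', r'', x'') \<in> klein p q r x" using klein_trans[OF 2(3) klein_sym[OF base(3)]] .
      have a3: "(p'', q'', r'', s'') \<in> klein p' q' r' s'" using klein_trans[OF 2(2) klein_sym[OF 1(2)]] .
      \<comment> \<open>All 64 ways in which the Klein four-group can align the quadruples.\<close>
      have "\<exists>e. (p, q, r, e) \<in> klein p' q' r' s'"
        using a1 a2 a3 base(1) 1(1) 2(1) unfolding klein_def by auto
      then show ?thesis using klein_trans[OF _ 1(2)] by blast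
    qed
    then obtain e where "\<And>k. k \<in> J \<Longrightarrow> (p, q, r, e k) \<in> klein (a k) (b k) (c k) (d k)" by metis
    note pe = this
    have "distinct [p, q, r, e k]" if "k \<in> J" for k
      using klein_distinct[OF pe[OF that] dj[OF that]] .
    then show ?thesis using pe by blast
  qed
qed

section \<open>Brackets, cross-ratios and Moebius transformations\<close>

definition bracket :: "complex^2 \<Rightarrow> complex^2 \<Rightarrow> complex" where
  "bracket v w = v $ 1 * w $ 2 - v $ 2 * w $ 1"

lemma two_add_one [simp]: "(2::2) + 1 = 1" "(1::2) + 1 = 2" "(3::2) = 1"
  by simp_all

lemma vec2_eq_0_iff: "v = 0 \<longleftrightarrow> v $ 1 = 0 \<and> v $ 2 = 0" for v :: "complex^2"
  by (simp add: vec_eq_iff forall_2)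

lemma bracket_scale: "bracket (c *s v) (d *s w) = c * d * bracket v w"
  by (simp add: bracket_def algebra_simps)

lemma proportional_iff_bracket:
  "proportional v w \<longleftrightarrow> v \<noteq> 0 \<and> w \<noteq> 0 \<and> bracket v w = 0"
proof
  assume "proportional v w"
  then show "v \<noteq> 0 \<and> w \<noteq> 0 \<and> bracket v w = 0"
    by (auto simp: proportional_def bracket_def)
next
  assume vw: "v \<noteq> 0 \<and> w \<noteq> 0 \<and> bracket v w = 0"
  then have b: "v $ 1 * w $ 2 = v $ 2 * w $ 1" by (simp add: bracket_def)
  have "\<exists>c. w = c *s v"
  proof (cases "v $ 1 = 0")
    case True
    then have "v $ 2 \<noteq> 0" "w $ 1 = 0" using vw b by (auto simp: vec2_eq_0_iff)
    then show ?thesis using True by (intro exI[of _ "w $ 2 / v $ 2"]) (simp add: vec_eq_iff forall_2)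
  next
    case False
    then show ?thesis using b
      by (intro exI[of _ "w $ 1 / v $ 1"]) (simp add: vec_eq_iff forall_2 field_simps)
  qed
  then obtain c where "w = c *s v" by blast
  moreover from this vw have "c \<noteq> 0" by auto
  ultimately show "proportional v w" using vw by (auto simp: proportional_def)
qed

lemma proportional_refl_iff: "proportional v v \<longleftrightarrow> v \<noteq> 0"
  by (auto simp: proportional_iff_bracket bracket_def)

lemma rep_cp1_nonzero: "rep_cp1 u \<noteq> 0"
  using Quotient3_rep_reflp[OF Quotient3_cp1] proportional_refl_iff by blast

lemma abs_rep_cp1: "abs_cp1 (rep_cp1 u) = u"
  using Quotient3_abs_rep[OF Quotient3_cp1] .

lemma abs_cp1_eq_iff:
  assumes "v \<noteq> 0" "w \<noteq> 0"
  shows "abs_cp1 v = abs_cp1 w \<longleftrightarrow> bracket v w = 0"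
  using Quotient3_rel[OF Quotient3_cp1, of v w] assms
  by (auto simp: proportional_iff_bracket proportional_refl_iff bracket_def)

lemma bracket_rep_nonzero: "u \<noteq> w \<Longrightarrow> bracket (rep_cp1 u) (rep_cp1 w) \<noteq> 0"
  using abs_cp1_eq_iff[OF rep_cp1_nonzero rep_cp1_nonzero] abs_rep_cp1 by metis

lemma rep_abs_cp1: "v \<noteq> 0 \<Longrightarrow> \<exists>c. c \<noteq> 0 \<and> rep_cp1 (abs_cp1 v) = c *s v"
  using abs_cp1_eq_iff[of "v" "rep_cp1 (abs_cp1 v)"] abs_rep_cp1[of "abs_cp1 v"] rep_cp1_nonzero[of "abs_cp1 v"]
    proportional_iff_bracket[of v "rep_cp1 (abs_cp1 v)"] by (auto simp: proportional_def)

lift_definition cross_ratio :: "cp1 \<Rightarrow> cp1 \<Rightarrow> cp1 \<Rightarrow> cp1 \<Rightarrow> complex" is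
  "\<lambda>a b c d. (bracket a b * bracket c d) / (bracket a d * bracket c b)"
proof -
  fix a a' b b' c c' d d'
  assume "proportional a a'" "proportional b b'" "proportional c c'" "proportional d d'"
  then obtain \<alpha> \<beta> \<gamma> \<delta> where "\<alpha> \<noteq> 0" "a' = \<alpha> *s a" "\<beta> \<noteq> 0" "b' = \<beta> *s b" "\<gamma> \<noteq> 0" "c' = \<gamma> *s c"
    "\<delta> \<noteq> 0" "d' = \<delta> *s d" unfolding proportional_def by blast
  then show "(bracket a b * bracket c d) / (bracket a d * bracket c b) =
      (bracket a' b' * bracket c' d') / (bracket a' d' * bracket c' b')"
    by (simp add: bracket_scale)
qed

lemma cross_ratio_abs:
  assumes "a \<noteq> 0" "b \<noteq> 0" "c \<noteq> 0" "d \<noteq> 0"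
  shows "cross_ratio (abs_cp1 a) (abs_cp1 b) (abs_cp1 c) (abs_cp1 d) =
    (bracket a b * bracket c d) / (bracket a d * bracket c b)"
  using assms by (intro cross_ratio.abs_eq) (simp_all add: proportional_refl_iff)

lemma bracket_commute: "bracket w v = - bracket v w"
  by (simp add: bracket_def)

text \<open>The Pluecker relation.\<close>

lemma bracket_plucker: "bracket a b * bracket c d - bracket a c * bracket b d + bracket a d * bracket b c = 0"
  by (simp add: bracket_def algebra_simps)

text \<open>The difference between \<open>1\<close> and the cross-ratio is again a quotient of brackets, by the Pluecker relation.\<close>

lemma cross_ratio_omits_01:
  assumes "distinct [a, b, c, d]"
  shows "cross_ratio a b c d \<noteq> 0" "cross_ratio a b c d \<noteq> 1"
proof -
  define A B C D where "A = rep_cp1 a" and "B = rep_cp1 b" and "C = rep_cp1 c" and "D = rep_cp1 d"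
  have nz: "A \<noteq> 0" "B \<noteq> 0" "C \<noteq> 0" "D \<noteq> 0" by (simp_all add: A_def B_def C_def D_def rep_cp1_nonzero)
  have ab: "a = abs_cp1 A" "b = abs_cp1 B" "c = abs_cp1 C" "d = abs_cp1 D"
    by (simp_all add: A_def B_def C_def D_def abs_rep_cp1)
  have br: "bracket A B \<noteq> 0" "bracket A C \<noteq> 0" "bracket A D \<noteq> 0" "bracket C B \<noteq> 0" "bracket B D \<noteq> 0"
    "bracket C D \<noteq> 0"
    unfolding A_def B_def C_def D_def by (rule bracket_rep_nonzero; use assms in auto)+
  have cr: "cross_ratio a b c d = (bracket A B * bracket C D) / (bracket A D * bracket C B)"
    unfolding ab using nz by (rule cross_ratio_abs)
  show "cross_ratio a b c d \<noteq> 0" using br by (simp add: cr)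
  have "bracket A B * bracket C D - bracket A D * bracket C B = bracket A C * bracket B D"
    using bracket_plucker[of A B C D] by (simp add: bracket_commute[of C B] algebra_simps)
  then show "cross_ratio a b c d \<noteq> 1" using br by (auto simp: cr field_simps)
qed

lemma cross_ratio_inject:
  assumes "distinct [a, b, c, d]" "distinct [a, b, c, e]" "cross_ratio a b c d = cross_ratio a b c e"
  shows "d = e"
proof -
  define A B C D E where "A = rep_cp1 a" and "B = rep_cp1 b" and "C = rep_cp1 c" and "D = rep_cp1 d"
    and "E = rep_cp1 e"
  have nz: "A \<noteq> 0" "B \<noteq> 0" "C \<noteq> 0" "D \<noteq> 0" "E \<noteq> 0"
    by (simp_all add: A_def B_def C_def D_def E_def rep_cp1_nonzero)
  have ab: "a = abs_cp1 A" "b = abs_cp1 B" "c = abs_cp1 C" "d = abs_cp1 D" "e = abs_cp1 E"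
    by (simp_all add: A_def B_def C_def D_def E_def abs_rep_cp1)
  have br: "bracket A B \<noteq> 0" "bracket A D \<noteq> 0" "bracket C B \<noteq> 0" "bracket A E \<noteq> 0" "bracket A C \<noteq> 0"
    unfolding A_def B_def C_def D_def E_def by (rule bracket_rep_nonzero; use assms(1,2) in auto)+
  have "(bracket A B * bracket C D) / (bracket A D * bracket C B) =
      (bracket A B * bracket C E) / (bracket A E * bracket C B)"
    using assms(3) unfolding ab using nz by (simp add: cross_ratio_abs)
  then have "bracket C D * bracket A E = bracket C E * bracket A D"
    using br by (simp add: field_simps)
  then have "bracket A C * bracket D E = 0"
    using bracket_plucker[of A C D E] by (simp add: mult.commute)
  then have "bracket D E = 0" using br by simp
  then show ?thesis unfolding ab using abs_cp1_eq_iff[OF nz(4,5)] by simp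
qed

definition sl2_scale :: "complex \<Rightarrow> complex^2^2 \<Rightarrow> complex^2^2" where
  "sl2_scale k B = (\<chi> i j. k * B $ i $ j)"

text \<open>The Moebius transformation of an invertible matrix. The choice of the square root affects only the sign of
  the normalised matrix.\<close>

definition psl2_of :: "complex^2^2 \<Rightarrow> psl2" where
  "psl2_of B = abs_psl2 (sl2_scale (1 / csqrt (det B)) B)"

lemma det_sl2_scale: "det (sl2_scale k B) = k\<^sup>2 * det B"
  by (simp add: sl2_scale_def det_2 power2_eq_square algebra_simps)

lemma sl2_equiv_normalised:
  assumes "det B \<noteq> 0"
  shows "sl2_equiv (sl2_scale (1 / csqrt (det B)) B) (sl2_scale (1 / csqrt (det B)) B)"
  using assms by (simp add: sl2_equiv_def det_sl2_scale power_divide)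

lemma
  assumes "det B \<noteq> 0"
  shows psl2_nonzero_of: "psl2_nonzero i j (psl2_of B) \<longleftrightarrow> B $ i $ j \<noteq> 0"
    and psl2_affine_of: "psl2_affine i j (psl2_of B) =
      vector [B $ i $ (j + 1) / B $ i $ j, B $ (i + 1) $ j / B $ i $ j, B $ (i + 1) $ (j + 1) / B $ i $ j]"
    and moebius_of: "v \<noteq> 0 \<Longrightarrow> moebius (psl2_of B) (abs_cp1 v) = abs_cp1 (B *v v)"
proof -
  let ?k = "1 / csqrt (det B)"
  have k: "?k \<noteq> 0" using assms by simp
  note n = sl2_equiv_normalised[OF assms]
  show "psl2_nonzero i j (psl2_of B) \<longleftrightarrow> B $ i $ j \<noteq> 0"
    unfolding psl2_of_def psl2_nonzero.abs_eq[OF n] using k by (simp add: sl2_scale_def)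
  show "psl2_affine i j (psl2_of B) =
      vector [B $ i $ (j + 1) / B $ i $ j, B $ (i + 1) $ j / B $ i $ j, B $ (i + 1) $ (j + 1) / B $ i $ j]"
    unfolding psl2_of_def psl2_affine.abs_eq[OF n] using k by (simp add: sl2_scale_def)
  assume v: "v \<noteq> 0"
  then have pv: "proportional v v" by (simp add: proportional_refl_iff)
  have sc: "sl2_scale ?k B *v v = ?k *s (B *v v)"
    by (simp add: sl2_scale_def vec_eq_iff matrix_vector_mult_def sum_distrib_left mult.assoc)
  have ne: "sl2_scale ?k B *v v \<noteq> 0"
    using n v by (subst sl2_mult_eq_0_iff) (auto simp: sl2_equiv_def)
  then have "B *v v \<noteq> 0" unfolding sc by auto
  moreover have "bracket (?k *s (B *v v)) (B *v v) = 0" by (simp add: bracket_def)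
  ultimately have "abs_cp1 (sl2_scale ?k B *v v) = abs_cp1 (B *v v)"
    using ne abs_cp1_eq_iff unfolding sc by blast
  then show "moebius (psl2_of B) (abs_cp1 v) = abs_cp1 (B *v v)"
    unfolding psl2_of_def moebius.abs_eq[OF n pv] .
qed

lemma psl2_has_nonzero_entry: "\<exists>i j. psl2_nonzero i j g"
proof -
  obtain M where M: "sl2_equiv M M" "g = abs_psl2 M"
    using Quotient3_rep_reflp[OF Quotient3_psl2] Quotient3_abs_rep[OF Quotient3_psl2] by metis
  have "\<exists>i j. M $ i $ j \<noteq> 0"
  proof (rule ccontr)
    assume "\<nexists>i j. M $ i $ j \<noteq> 0"
    then have "det M = 0" by (simp add: det_2)
    then show False using M(1) by (simp add: sl2_equiv_def)
  qed
  then show ?thesis unfolding M(2) psl2_nonzero.abs_eq[OF M(1)] .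
qed

lemma bracket_mult_vec: "bracket (B *v v) (B *v w) = det B * bracket v w" for B :: "complex^2^2"
  by (simp add: bracket_def matrix_vector_mult_def sum_2 det_2 algebra_simps)

lemma moebius_cross_ratio:
  "cross_ratio (moebius g a) (moebius g b) (moebius g c) (moebius g d) = cross_ratio a b c d"
proof -
  obtain M where M: "sl2_equiv M M" "g = abs_psl2 M"
    using Quotient3_rep_reflp[OF Quotient3_psl2] Quotient3_abs_rep[OF Quotient3_psl2] by metis
  have det: "det M = 1" using M by (simp add: sl2_equiv_def)
  have "moebius g u = abs_cp1 (M *v rep_cp1 u)" "M *v rep_cp1 u \<noteq> 0" for u
    using moebius.abs_eq[OF M(1), of "rep_cp1 u"] rep_cp1_nonzero[of u] M(2) sl2_mult_eq_0_iff[OF det]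
    by (simp_all add: proportional_refl_iff abs_rep_cp1)
  then have "cross_ratio (moebius g a) (moebius g b) (moebius g c) (moebius g d) =
    (bracket (rep_cp1 a) (rep_cp1 b) * bracket (rep_cp1 c) (rep_cp1 d)) /
    (bracket (rep_cp1 a) (rep_cp1 d) * bracket (rep_cp1 c) (rep_cp1 b))"
    by (simp add: cross_ratio_abs bracket_mult_vec det)
  also have "\<dots> = cross_ratio a b c d"
    using cross_ratio_abs[OF rep_cp1_nonzero rep_cp1_nonzero rep_cp1_nonzero rep_cp1_nonzero, of a b c d]
    by (simp add: abs_rep_cp1)
  finally show ?thesis .
qed

lemma moebius_inject:
  assumes "moebius g a = moebius g b"
  shows "a = b"
proof -
  obtain M where M: "sl2_equiv M M" "g = abs_psl2 M"
    using Quotient3_rep_reflp[OF Quotient3_psl2] Quotient3_abs_rep[OF Quotient3_psl2] by metis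
  have det: "det M = 1" using M by (simp add: sl2_equiv_def)
  have m: "moebius g u = abs_cp1 (M *v rep_cp1 u)" "M *v rep_cp1 u \<noteq> 0" for u
    using moebius.abs_eq[OF M(1), of "rep_cp1 u"] rep_cp1_nonzero[of u] M(2) sl2_mult_eq_0_iff[OF det]
    by (simp_all add: proportional_refl_iff abs_rep_cp1)
  have "bracket (rep_cp1 a) (rep_cp1 b) = 0"
    using assms m abs_cp1_eq_iff[OF m(2) m(2)] by (simp add: bracket_mult_vec det)
  then show ?thesis using abs_cp1_eq_iff[OF rep_cp1_nonzero rep_cp1_nonzero] abs_rep_cp1 by metis
qed

text \<open>The linear map that takes the points \<open>p1, p2, p3\<close> of the projective line to \<open>q1, q2, q3\<close>. Up to a factor it
  is the composition of the map taking \<open>p1, p2, p3\<close> to \<open>0, 1, \<infinity>\<close> with the inverse of the one for \<open>q1, q2, q3\<close>.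
  It is polynomial, and homogeneous of degree one in each of the six vectors.\<close>

definition transport_matrix ::
  "complex^2 \<Rightarrow> complex^2 \<Rightarrow> complex^2 \<Rightarrow> complex^2 \<Rightarrow> complex^2 \<Rightarrow> complex^2 \<Rightarrow> complex^2^2" where
  "transport_matrix p1 p2 p3 q1 q2 q3 = (\<chi> i j.
     bracket (axis j 1) p3 * bracket p2 p1 * bracket q2 q3 * q1 $ i -
     bracket (axis j 1) p1 * bracket p2 p3 * bracket q2 q1 * q3 $ i)"

lemma transport_matrix_mult:
  "transport_matrix p1 p2 p3 q1 q2 q3 *v v =
     (bracket v p3 * bracket p2 p1 * bracket q2 q3) *s q1 -
     (bracket v p1 * bracket p2 p3 * bracket q2 q1) *s q3"
  by (simp add: transport_matrix_def vec_eq_iff forall_2 matrix_vector_mult_def sum_2 bracket_def axis_def algebra_simps)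

lemma det_transport_matrix:
  "det (transport_matrix p1 p2 p3 q1 q2 q3) =
     (bracket p2 p1 * bracket q2 q3) * (bracket p2 p3 * bracket q2 q1) * bracket q1 q3 * bracket p1 p3"
  by (simp add: transport_matrix_def det_2 bracket_def axis_def algebra_simps)

lemma transport_matrix_scale:
  "transport_matrix (a *s p1) (b *s p2) (c *s p3) (d *s q1) (e *s q2) (f *s q3) $ i $ j =
    (a * b * c * d * e * f) * transport_matrix p1 p2 p3 q1 q2 q3 $ i $ j"
proof -
  have "bracket x (c *s p) = c * bracket x p" "bracket (c *s p) x = c * bracket p x" for x p c
    by (simp_all add: bracket_def algebra_simps)
  then show ?thesis by (simp add: transport_matrix_def) (simp add: algebra_simps)
qed

lemma transport_matrix_maps:
  fixes p1 p2 p3 q1 q2 q3 :: "complex^2"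
  assumes p: "p1 \<noteq> 0" "p2 \<noteq> 0" "p3 \<noteq> 0" and q: "q1 \<noteq> 0" "q2 \<noteq> 0" "q3 \<noteq> 0"
    and dp: "distinct [abs_cp1 p1, abs_cp1 p2, abs_cp1 p3]"
    and dq: "distinct [abs_cp1 q1, abs_cp1 q2, abs_cp1 q3]"
  defines "B \<equiv> transport_matrix p1 p2 p3 q1 q2 q3"
  shows "det B \<noteq> 0" "moebius (psl2_of B) (abs_cp1 p1) = abs_cp1 q1"
    "moebius (psl2_of B) (abs_cp1 p2) = abs_cp1 q2" "moebius (psl2_of B) (abs_cp1 p3) = abs_cp1 q3"
proof -
  have bp: "bracket p1 p2 \<noteq> 0" "bracket p1 p3 \<noteq> 0" "bracket p2 p3 \<noteq> 0" "bracket p2 p1 \<noteq> 0"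
    using dp by (simp_all add: abs_cp1_eq_iff p bracket_commute[of p2 p1])
  have bq: "bracket q1 q2 \<noteq> 0" "bracket q1 q3 \<noteq> 0" "bracket q2 q3 \<noteq> 0" "bracket q2 q1 \<noteq> 0"
    using dq by (simp_all add: abs_cp1_eq_iff q bracket_commute[of q2 q1])
  show det: "det B \<noteq> 0" using bp bq by (simp add: B_def det_transport_matrix)
  have scaled: "moebius (psl2_of B) (abs_cp1 v) = abs_cp1 w"
    if "v \<noteq> 0" "w \<noteq> 0" "B *v v = c *s w" "c \<noteq> 0" for v w c
  proof -
    have "bracket (c *s w) w = 0" by (simp add: bracket_def)
    then show ?thesis unfolding moebius_of[OF det that(1)] that(3)
      using abs_cp1_eq_iff[of "c *s w" w] that by auto
  qed
  have self: "bracket v v = 0" for v by (simp add: bracket_def)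
  show "moebius (psl2_of B) (abs_cp1 p1) = abs_cp1 q1"
    by (rule scaled[of _ _ "bracket p1 p3 * bracket p2 p1 * bracket q2 q3"])
      (use p q bp bq in \<open>simp_all add: B_def transport_matrix_mult self\<close>)
  show "moebius (psl2_of B) (abs_cp1 p3) = abs_cp1 q3"
    by (rule scaled[of _ _ "- (bracket p3 p1 * bracket p2 p3 * bracket q2 q1)"])
      (use p q bp bq in \<open>simp_all add: B_def transport_matrix_mult self bracket_commute[of p3 p1]\<close>)
  show "moebius (psl2_of B) (abs_cp1 p2) = abs_cp1 q2"
    by (rule scaled[of _ _ "bracket p2 p1 * bracket p2 p3 * bracket q1 q3"])
      (use p q bp bq in \<open>simp_all add: B_def transport_matrix_mult\<close>,
        simp add: bracket_def vec_eq_iff forall_2 algebra_simps)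
qed

section \<open>Holomorphy in the charts\<close>

text \<open>Complex differentiability of a function of several complex variables at a point.\<close>

definition cdiff :: "(complex^'n::finite \<Rightarrow> complex) \<Rightarrow> complex^'n \<Rightarrow> bool" where
  "cdiff F z \<longleftrightarrow> (\<exists>F'. (F has_derivative F') (at z) \<and> (\<forall>c v. F' (c *s v) = c * F' v))"

lemma cdiff_const: "cdiff (\<lambda>z. c) z"
  unfolding cdiff_def by (intro exI[of _ "\<lambda>h. 0"]) auto

lemma cdiff_nth: "cdiff (\<lambda>z. z $ i) z"
  unfolding cdiff_def
  by (intro exI[of _ "\<lambda>h. h $ i"] conjI
      bounded_linear.has_derivative[OF bounded_linear_vec_nth has_derivative_ident]) simp

lemma cdiff_diff: "cdiff F z \<Longrightarrow> cdiff G z \<Longrightarrow> cdiff (\<lambda>z. F z - G z) z"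
  unfolding cdiff_def
proof (elim exE conjE)
  fix F' G' assume "(F has_derivative F') (at z)" "(G has_derivative G') (at z)"
    "\<forall>c v. F' (c *s v) = c * F' v" "\<forall>c v. G' (c *s v) = c * G' v"
  then show "\<exists>H'. ((\<lambda>z. F z - G z) has_derivative H') (at z) \<and> (\<forall>c v. H' (c *s v) = c * H' v)"
    by (intro exI[of _ "\<lambda>h. F' h - G' h"]) (auto intro: has_derivative_diff simp: algebra_simps)
qed

lemma cdiff_mult: "cdiff F z \<Longrightarrow> cdiff G z \<Longrightarrow> cdiff (\<lambda>z. F z * G z) z"
  unfolding cdiff_def
proof (elim exE conjE)
  fix F' G' assume "(F has_derivative F') (at z)" "(G has_derivative G') (at z)"
    "\<forall>c v. F' (c *s v) = c * F' v" "\<forall>c v. G' (c *s v) = c * G' v"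
  then show "\<exists>H'. ((\<lambda>z. F z * G z) has_derivative H') (at z) \<and> (\<forall>c v. H' (c *s v) = c * H' v)"
    by (intro exI[of _ "\<lambda>h. F z * G' h + F' h * G z"]) (auto intro: has_derivative_mult simp: algebra_simps)
qed

lemma cdiff_divide: "cdiff F z \<Longrightarrow> cdiff G z \<Longrightarrow> G z \<noteq> 0 \<Longrightarrow> cdiff (\<lambda>z. F z / G z) z"
  unfolding cdiff_def
proof (elim exE conjE)
  fix F' G' assume "G z \<noteq> 0" "(F has_derivative F') (at z)" "(G has_derivative G') (at z)"
    "\<forall>c v. F' (c *s v) = c * F' v" "\<forall>c v. G' (c *s v) = c * G' v"
  then show "\<exists>H'. ((\<lambda>z. F z / G z) has_derivative H') (at z) \<and> (\<forall>c v. H' (c *s v) = c * H' v)"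
    by (intro exI[of _ "\<lambda>h. - F z * (inverse (G z) * G' h * inverse (G z)) + F' h / G z"] conjI has_derivative_divide)
      (auto simp: field_simps)
qed

lemma cdiff_cong:
  assumes "cdiff F z" "\<forall>\<^sub>F w in nhds z. F w = G w"
  shows "cdiff G z"
proof -
  have "\<forall>\<^sub>F w in at z. F w = G w" "F z = G z"
    using assms(2) by (auto simp: eventually_nhds_conv_at)
  then show ?thesis using assms(1) unfolding cdiff_def
    by (metis UNIV_I has_derivative_transform_eventually)
qed

lemma cdiff_isCont: "cdiff F z \<Longrightarrow> isCont F z"
  unfolding cdiff_def by (auto intro: has_derivative_continuous)

lemma cdiff_eventually_nonzero:
  assumes "cdiff F z" "F z \<noteq> 0"
  shows "\<forall>\<^sub>F w in nhds z. F w \<noteq> 0"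
proof -
  have "\<forall>\<^sub>F w in at z. F w \<noteq> 0"
    using cdiff_isCont[OF assms(1)] assms(2) tendsto_imp_eventually_ne unfolding isCont_def by blast
  then show ?thesis using assms(2) by (simp add: eventually_nhds_conv_at)
qed

lemma cdiff_compose_permutation:
  fixes F :: "complex^'n::finite \<Rightarrow> complex" and z :: "complex^'n"
  assumes "cdiff F (\<chi> i. z $ \<sigma> i)"
  shows "cdiff (\<lambda>z. F (\<chi> i. z $ \<sigma> i)) z"
proof -
  obtain F' where F': "(F has_derivative F') (at (\<chi> i. z $ \<sigma> i))" "\<forall>c v. F' (c *s v) = c * F' v"
    using assms unfolding cdiff_def by blast
  have "linear (\<lambda>z::complex^'n. (\<chi> i. z $ \<sigma> i) :: complex^'n)"
    by (intro linearI) (simp_all add: vec_eq_iff)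
  then have "((\<lambda>z::complex^'n. (\<chi> i. z $ \<sigma> i)) has_derivative (\<lambda>z. \<chi> i. z $ \<sigma> i)) (at z)"
    by (intro bounded_linear_imp_has_derivative) (simp add: linear_conv_bounded_linear)
  from has_derivative_compose[OF this F'(1)]
  have "((\<lambda>z. F (\<chi> i. z $ \<sigma> i)) has_derivative (\<lambda>h. F' (\<chi> i. h $ \<sigma> i))) (at z)" .
  moreover have "(\<chi> i. (c *s v) $ \<sigma> i) = c *s (\<chi> i. v $ \<sigma> i)" for c and v :: "complex^'n"
    by (simp add: vec_eq_iff)
  ultimately show ?thesis using F'(2) unfolding cdiff_def by metis
qed

lemma holomorphic_vec_on_iff_cdiff:
  fixes f :: "complex^'a::finite \<Rightarrow> complex^'b::finite"
  assumes "open S"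
  shows "holomorphic_vec_on f S \<longleftrightarrow> (\<forall>z\<in>S. \<forall>k. cdiff (\<lambda>z. f z $ k) z)"
proof
  assume f: "holomorphic_vec_on f S"
  show "\<forall>z\<in>S. \<forall>k. cdiff (\<lambda>z. f z $ k) z"
  proof (intro ballI allI)
    fix z k assume z: "z \<in> S"
    then obtain f' where f': "(f has_derivative f') (at z)" "\<forall>c v. f' (c *s v) = c *s f' v"
      using f at_within_open[OF z assms] unfolding holomorphic_vec_on_def by metis
    have "((\<lambda>z. f z $ k) has_derivative (\<lambda>h. f' h $ k)) (at z)"
      by (rule bounded_linear.has_derivative[OF bounded_linear_vec_nth f'(1)])
    then show "cdiff (\<lambda>z. f z $ k) z"
      unfolding cdiff_def using f'(2) by (intro exI[of _ "\<lambda>h. f' h $ k"]) simp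
  qed
next
  assume c: "\<forall>z\<in>S. \<forall>k. cdiff (\<lambda>z. f z $ k) z"
  show "holomorphic_vec_on f S" unfolding holomorphic_vec_on_def
  proof
    fix z assume z: "z \<in> S"
    then obtain g where g: "\<And>k. ((\<lambda>z. f z $ k) has_derivative g k) (at z)" "\<And>k c v. g k (c *s v) = c * g k v"
      using c unfolding cdiff_def by metis
    have lin: "bounded_linear (\<lambda>c::complex. (axis k c :: complex^'b))" for k
      unfolding linear_conv_bounded_linear[symmetric]
      by (intro linearI) (simp_all add: vec_eq_iff axis_def)
    have sum: "(\<Sum>k\<in>UNIV. axis k (v k)) = ((\<chi> k. v k) :: complex^'b)" for v :: "'b \<Rightarrow> complex"
      by (simp add: vec_eq_iff axis_def if_distrib[of "\<lambda>x. x = _"] cong: if_cong)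
    have "((\<lambda>z. \<Sum>k\<in>UNIV. axis k (f z $ k)) has_derivative (\<lambda>h. \<Sum>k\<in>UNIV. axis k (g k h))) (at z)"
      by (intro has_derivative_sum bounded_linear.has_derivative[OF lin] g)
    then have "(f has_derivative (\<lambda>h. \<chi> k. g k h)) (at z)" unfolding sum by simp
    then have "(f has_derivative (\<lambda>h. \<chi> k. g k h)) (at z within S)"
      by (rule has_derivative_at_withinI)
    moreover have "(\<chi> k. g k (c *s v)) = c *s (\<chi> k. g k v)" for c v
      by (simp add: vec_eq_iff g(2))
    ultimately show "\<exists>f'. (f has_derivative f') (at z within S) \<and> (\<forall>c v. f' (c *s v) = c *s f' v)"
      by blast
  qed
qed

lemma open_if_eventually_mem:
  assumes "\<And>x. x \<in> S \<Longrightarrow> \<forall>\<^sub>F y in nhds x. y \<in> S"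
  shows "open S"
  unfolding open_subopen[of S]
proof
  fix x assume "x \<in> S"
  then obtain T where "open T" "x \<in> T" "\<forall>y\<in>T. y \<in> S"
    using assms unfolding eventually_nhds by meson
  then show "\<exists>T. open T \<and> x \<in> T \<and> T \<subseteq> S" by blast
qed

text \<open>The vector with coordinate \<open>c\<close> in the affine chart \<open>j\<close>.\<close>

definition affine_vec :: "2 \<Rightarrow> complex \<Rightarrow> complex^2" where
  "affine_vec j c = (\<chi> k. if k = j then 1 else c)"

text \<open>The inverse of the chart of the configuration space selected by \<open>s\<close>.\<close>

definition chart_point :: "('n \<Rightarrow> 2) \<Rightarrow> complex^'n \<Rightarrow> cp1^'n::finite" where
  "chart_point s z = (\<chi> i. abs_cp1 (affine_vec (s i) (z $ i)))"

lemma add_one_neq: "(j::2) + 1 \<noteq> j"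
  using exhaust_2[of j] by auto

lemma affine_vec_nonzero: "affine_vec j c \<noteq> 0"
  by (auto simp: affine_vec_def vec_eq_iff)

lemma cp1_nonzero_abs: "v \<noteq> 0 \<Longrightarrow> cp1_nonzero j (abs_cp1 v) \<longleftrightarrow> v $ j \<noteq> 0"
  by (intro cp1_nonzero.abs_eq) (simp add: proportional_refl_iff)

lemma cp1_affine_abs: "v \<noteq> 0 \<Longrightarrow> cp1_affine j (abs_cp1 v) = v $ (j + 1) / v $ j"
  by (intro cp1_affine.abs_eq) (simp add: proportional_refl_iff)

lemma cp1_nonzero_affine_vec: "cp1_nonzero j (abs_cp1 (affine_vec j c))"
  by (simp add: cp1_nonzero_abs affine_vec_nonzero) (simp add: affine_vec_def)

lemma cp1_affine_affine_vec: "cp1_affine j (abs_cp1 (affine_vec j c)) = c"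
  by (simp add: cp1_affine_abs affine_vec_nonzero) (simp add: affine_vec_def add_one_neq)

lemma abs_affine_vec_cp1_affine:
  assumes "cp1_nonzero j u"
  shows "abs_cp1 (affine_vec j (cp1_affine j u)) = u"
proof -
  define v where "v = rep_cp1 u"
  have v: "v \<noteq> 0" "u = abs_cp1 v" by (simp_all add: v_def rep_cp1_nonzero abs_rep_cp1)
  then have vj: "v $ j \<noteq> 0" using assms by (simp add: cp1_nonzero_abs)
  have "bracket (affine_vec j (v $ (j + 1) / v $ j)) v = 0"
    using exhaust_2[of j] vj by (auto simp: bracket_def affine_vec_def)
  then show ?thesis unfolding v(2) cp1_affine_abs[OF v(1)]
    using abs_cp1_eq_iff[OF affine_vec_nonzero v(1)] by blast
qed

lemma ex_cp1_nonzero: "\<exists>j. cp1_nonzero j u"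
proof -
  have "rep_cp1 u $ 1 \<noteq> 0 \<or> rep_cp1 u $ 2 \<noteq> 0" using rep_cp1_nonzero[of u] by (simp add: vec2_eq_0_iff)
  then show ?thesis using cp1_nonzero_abs[OF rep_cp1_nonzero] unfolding abs_rep_cp1 by blast
qed

lemma atlas_carrier_PConf: "atlas_carrier PConf_atlas = (PConf :: (cp1^'n::finite) set)"
proof -
  have "\<exists>s. \<forall>i. cp1_nonzero (s i) (x $ i)" for x :: "cp1^'n"
    by (intro choice allI ex_cp1_nonzero)
  then show ?thesis by (auto simp: atlas_carrier_def PConf_atlas_def)
qed

text \<open>Using \<open>chart_point\<close> in place of the abstract inverse of a chart.\<close>

lemma holomorphic_map_from_PConf_iff:
  fixes f :: "cp1^'n::finite \<Rightarrow> 'q"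
  shows "holomorphic_map PConf_atlas \<B> f \<longleftrightarrow> f ` PConf \<subseteq> atlas_carrier \<B> \<and>
    (\<forall>s. \<forall>(V, \<psi>)\<in>\<B>. open {z. chart_point s z \<in> PConf \<and> f (chart_point s z) \<in> V} \<and>
      holomorphic_vec_on (\<lambda>z. \<psi> (f (chart_point s z))) {z. chart_point s z \<in> PConf \<and> f (chart_point s z) \<in> V})"
proof -
  define U where "U = (\<lambda>s. {x :: cp1^'n. x \<in> PConf \<and> (\<forall>i. cp1_nonzero (s i) (x $ i))})"
  define \<phi> where "\<phi> = (\<lambda>s (x :: cp1^'n). \<chi> i. cp1_affine (s i) (x $ i))"
  have left: "chart_point s (\<phi> s x) = x" if "x \<in> U s" for s x
    using that by (simp add: U_def \<phi>_def chart_point_def vec_eq_iff abs_affine_vec_cp1_affine)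
  have right: "\<phi> s (chart_point s z) = z" for s z
    by (simp add: \<phi>_def chart_point_def vec_eq_iff cp1_affine_affine_vec)
  have mem: "chart_point s z \<in> U s \<longleftrightarrow> chart_point s z \<in> PConf" for s z
    by (simp add: U_def chart_point_def cp1_nonzero_affine_vec)
  have inj: "inj_on (\<phi> s) (U s)" for s using left by (metis inj_onI)
  have inv: "inv_into (U s) (\<phi> s) z = chart_point s z" if "chart_point s z \<in> PConf" for s z
    using inj that by (intro inv_into_f_eq) (simp_all add: mem right)
  have img: "\<phi> s ` (U s \<inter> f -` V) = {z. chart_point s z \<in> PConf \<and> f (chart_point s z) \<in> V}" for s V
  proof (intro equalityI subsetI)
    fix z assume "z \<in> \<phi> s ` (U s \<inter> f -` V)"
    then show "z \<in> {z. chart_point s z \<in> PConf \<and> f (chart_point s z) \<in> V}"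
      using left by (auto simp: U_def)
  next
    fix z assume "z \<in> {z. chart_point s z \<in> PConf \<and> f (chart_point s z) \<in> V}"
    then show "z \<in> \<phi> s ` (U s \<inter> f -` V)"
      using mem right by (intro image_eqI[of _ _ "chart_point s z"]) auto
  qed
  have hol: "holomorphic_vec_on (\<psi> \<circ> f \<circ> inv_into (U s) (\<phi> s)) S \<longleftrightarrow>
    holomorphic_vec_on (\<lambda>z. \<psi> (f (chart_point s z))) S"
    if S: "S = {z. chart_point s z \<in> PConf \<and> f (chart_point s z) \<in> V}"
    for s S V and \<psi> :: "'q \<Rightarrow> complex^'b::finite"
  proof -
    have "(\<psi> \<circ> f \<circ> inv_into (U s) (\<phi> s) has_derivative f') (at z within S) \<longleftrightarrow>
      ((\<lambda>z. \<psi> (f (chart_point s z))) has_derivative f') (at z within S)" if z: "z \<in> S" for z f'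
      by (intro iffI; erule has_derivative_transform[OF z, rotated]) (use inv S in auto)
    then show ?thesis unfolding holomorphic_vec_on_def by (intro ball_cong refl) simp
  qed
  have atl: "PConf_atlas = range (\<lambda>s. (U s, \<phi> s))"
    unfolding PConf_atlas_def U_def \<phi>_def by blast
  have carrier: "atlas_carrier (range (\<lambda>s. (U s, \<phi> s))) = PConf"
    unfolding atl[symmetric] by (rule atlas_carrier_PConf)
  have "holomorphic_map PConf_atlas \<B> f \<longleftrightarrow> f ` PConf \<subseteq> atlas_carrier \<B> \<and>
    (\<forall>s. \<forall>(V, \<psi>)\<in>\<B>. open (\<phi> s ` (U s \<inter> f -` V)) \<and>
      holomorphic_vec_on (\<psi> \<circ> f \<circ> inv_into (U s) (\<phi> s)) (\<phi> s ` (U s \<inter> f -` V)))"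
    unfolding holomorphic_map_def atl ball_simps by (simp only: case_prod_conv carrier)
  then show ?thesis unfolding img hol[OF refl] .
qed

lemma chart_point_in_PConf_iff:
  "chart_point s z \<in> PConf \<longleftrightarrow>
    (\<forall>i j. i \<noteq> j \<longrightarrow> bracket (affine_vec (s i) (z $ i)) (affine_vec (s j) (z $ j)) \<noteq> 0)"
proof -
  have "chart_point s z \<in> PConf \<longleftrightarrow> (\<forall>i j. chart_point s z $ i = chart_point s z $ j \<longrightarrow> i = j)"
    by (simp add: PConf_def inj_def)
  also have "\<dots> \<longleftrightarrow>
      (\<forall>i j. bracket (affine_vec (s i) (z $ i)) (affine_vec (s j) (z $ j)) = 0 \<longrightarrow> i = j)"
    by (simp add: chart_point_def abs_cp1_eq_iff affine_vec_nonzero)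
  finally show ?thesis by metis
qed

lemma cdiff_affine_vec_nth: "cdiff (\<lambda>z. affine_vec j (z $ i) $ k) z"
  by (cases "k = j") (auto simp: affine_vec_def cdiff_const cdiff_nth)

lemma cdiff_bracket:
  assumes "\<And>k. cdiff (\<lambda>z. V z $ k) z" "\<And>k. cdiff (\<lambda>z. W z $ k) z"
  shows "cdiff (\<lambda>z. bracket (V z) (W z)) z"
  unfolding bracket_def by (intro cdiff_diff cdiff_mult assms)

lemma eventually_chart_point_in_PConf:
  assumes "chart_point s z \<in> PConf"
  shows "\<forall>\<^sub>F w in nhds z. chart_point s w \<in> PConf"
  unfolding chart_point_in_PConf_iff
proof (intro eventually_all_finite)
  fix i j
  show "\<forall>\<^sub>F w in nhds z. i \<noteq> j \<longrightarrow> bracket (affine_vec (s i) (w $ i)) (affine_vec (s j) (w $ j)) \<noteq> 0"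
  proof (cases "i = j")
    case False
    then have "\<forall>\<^sub>F w in nhds z. bracket (affine_vec (s i) (w $ i)) (affine_vec (s j) (w $ j)) \<noteq> 0"
      using assms unfolding chart_point_in_PConf_iff
      by (intro cdiff_eventually_nonzero cdiff_bracket cdiff_affine_vec_nth) auto
    then show ?thesis by eventually_elim simp
  qed simp
qed

text \<open>A map to the projective line is holomorphic if it has local lifts to homogeneous coordinates that are
  differentiable. In contrast to charts of the target, lifts can be inserted into polynomials such as
  \<open>bracket\<close> and \<open>transport_matrix\<close>. Differentiability at the centre of each neighbourhood is enough, as every
  point is the centre of one.\<close>

definition holomorphic_cp1 :: "(cp1^'n::finite \<Rightarrow> cp1) \<Rightarrow> bool" where
  "holomorphic_cp1 u \<longleftrightarrow> (\<forall>s z0. chart_point s z0 \<in> PConf \<longrightarrow>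
    (\<exists>V. (\<forall>\<^sub>F z in nhds z0. V z \<noteq> 0 \<and> u (chart_point s z) = abs_cp1 (V z)) \<and>
         (\<forall>k. cdiff (\<lambda>z. V z $ k) z0)))"

lemma holomorphic_cp1_const: "holomorphic_cp1 (\<lambda>x. c)"
  unfolding holomorphic_cp1_def
  by (intro allI impI exI[of _ "\<lambda>z. rep_cp1 c"]) (simp add: rep_cp1_nonzero abs_rep_cp1 cdiff_const)

lemma holomorphic_cp1_nth: "holomorphic_cp1 (\<lambda>x. x $ i)"
  unfolding holomorphic_cp1_def
proof (intro allI impI)
  fix s and z0 :: "complex^'a"
  show "\<exists>V. (\<forall>\<^sub>F z in nhds z0. V z \<noteq> 0 \<and> chart_point s z $ i = abs_cp1 (V z)) \<and> (\<forall>k. cdiff (\<lambda>z. V z $ k) z0)"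
    by (intro exI[of _ "\<lambda>z. affine_vec (s i) (z $ i)"])
      (simp add: affine_vec_nonzero chart_point_def cdiff_affine_vec_nth)
qed

lemma holomorphic_cp1_component:
  fixes h :: "cp1^'n::finite \<Rightarrow> cp1^'m::finite"
  assumes "holomorphic_map PConf_atlas PConf_atlas h"
  shows "holomorphic_cp1 (\<lambda>x. h x $ p)"
  unfolding holomorphic_cp1_def
proof (intro allI impI)
  fix s and z0 :: "complex^'n" assume z0: "chart_point s z0 \<in> PConf"
  note hol = assms[unfolded holomorphic_map_from_PConf_iff atlas_carrier_PConf]
  have "\<exists>t. \<forall>i. cp1_nonzero (t i) (h (chart_point s z0) $ i)"
    by (intro choice allI ex_cp1_nonzero)
  then obtain t where t: "\<And>i. cp1_nonzero (t i) (h (chart_point s z0) $ i)" by blast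
  define V where "V = {x :: cp1^'m. x \<in> PConf \<and> (\<forall>i. cp1_nonzero (t i) (x $ i))}"
  define \<psi> where "\<psi> = (\<lambda>x :: cp1^'m. \<chi> i. cp1_affine (t i) (x $ i))"
  define S where "S = {z. chart_point s z \<in> PConf \<and> h (chart_point s z) \<in> V}"
  have "(V, \<psi>) \<in> PConf_atlas" by (auto simp: PConf_atlas_def V_def \<psi>_def)
  then have S: "open S" "holomorphic_vec_on (\<lambda>z. \<psi> (h (chart_point s z))) S"
    using hol unfolding S_def by blast+
  have z0S: "z0 \<in> S" using z0 t hol by (auto simp: S_def V_def)
  have "cdiff (\<lambda>z. \<psi> (h (chart_point s z)) $ p) z0"
    using S z0S by (simp add: holomorphic_vec_on_iff_cdiff)
  then have 1: "cdiff (\<lambda>z. cp1_affine (t p) (h (chart_point s z) $ p)) z0" by (simp add: \<psi>_def)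
  show "\<exists>V. (\<forall>\<^sub>F z in nhds z0. V z \<noteq> 0 \<and> h (chart_point s z) $ p = abs_cp1 (V z)) \<and> (\<forall>k. cdiff (\<lambda>z. V z $ k) z0)"
  proof (intro exI[of _ "\<lambda>z. affine_vec (t p) (cp1_affine (t p) (h (chart_point s z) $ p))"] conjI allI)
    have "\<forall>\<^sub>F z in nhds z0. z \<in> S" using S(1) z0S by (rule eventually_nhds_in_open)
    then show "\<forall>\<^sub>F z in nhds z0. affine_vec (t p) (cp1_affine (t p) (h (chart_point s z) $ p)) \<noteq> 0 \<and>
        h (chart_point s z) $ p = abs_cp1 (affine_vec (t p) (cp1_affine (t p) (h (chart_point s z) $ p)))"
      by eventually_elim (simp add: affine_vec_nonzero S_def V_def abs_affine_vec_cp1_affine)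
    show "cdiff (\<lambda>z. affine_vec (t p) (cp1_affine (t p) (h (chart_point s z) $ p)) $ k) z0" for k
      using 1 by (cases "k = t p") (auto simp: affine_vec_def cdiff_const)
  qed
qed

lemma permute_coords_in_PConf:
  assumes "bij \<sigma>" "x \<in> PConf"
  shows "permute_coords \<sigma> x \<in> PConf"
proof -
  have "($) (permute_coords \<sigma> x) = ($) x \<circ> \<sigma>"
    by (simp add: permute_coords_def fun_eq_iff)
  then show ?thesis using assms by (simp add: PConf_def inj_compose bij_is_inj)
qed

lemma holomorphic_cp1_permute:
  fixes u :: "cp1^'n::finite \<Rightarrow> cp1"
  assumes u: "holomorphic_cp1 u" and \<sigma>: "bij \<sigma>"
  shows "holomorphic_cp1 (\<lambda>x. u (permute_coords \<sigma> x))"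
  unfolding holomorphic_cp1_def
proof (intro allI impI)
  fix s and z0 :: "complex^'n" assume z0: "chart_point s z0 \<in> PConf"
  define L where "L = (\<lambda>z :: complex^'n. (\<chi> i. z $ \<sigma> i) :: complex^'n)"
  have eq: "permute_coords \<sigma> (chart_point s z) = chart_point (s \<circ> \<sigma>) (L z)" for z
    by (simp add: permute_coords_def chart_point_def L_def vec_eq_iff)
  have "chart_point (s \<circ> \<sigma>) (L z0) \<in> PConf"
    unfolding eq[symmetric] by (rule permute_coords_in_PConf[OF \<sigma> z0])
  then obtain V where V: "\<forall>\<^sub>F z in nhds (L z0). V z \<noteq> 0 \<and> u (chart_point (s \<circ> \<sigma>) z) = abs_cp1 (V z)"
    "\<And>k. cdiff (\<lambda>z. V z $ k) (L z0)" using u unfolding holomorphic_cp1_def by blast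
  have "linear L" unfolding L_def by (intro linearI) (simp_all add: vec_eq_iff)
  then have "isCont L z0" by (intro linear_continuous_at) (simp add: linear_conv_bounded_linear)
  then have "filterlim L (nhds (L z0)) (nhds z0)" by (simp add: isCont_def tendsto_at_iff_tendsto_nhds)
  then have ev: "\<forall>\<^sub>F z in nhds z0. V (L z) \<noteq> 0 \<and> u (chart_point (s \<circ> \<sigma>) (L z)) = abs_cp1 (V (L z))"
    using V(1) by (rule eventually_compose_filterlim[rotated])
  have "cdiff (\<lambda>z. V (L z) $ k) z0" for k
    using cdiff_compose_permutation[of "\<lambda>z. V z $ k" z0 \<sigma>] V(2) by (simp add: L_def)
  then show "\<exists>V. (\<forall>\<^sub>F z in nhds z0. V z \<noteq> 0 \<and> u (permute_coords \<sigma> (chart_point s z)) = abs_cp1 (V z)) \<and>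
      (\<forall>k. cdiff (\<lambda>z. V z $ k) z0)"
    unfolding eq using ev by (intro exI[of _ "\<lambda>z. V (L z)"]) simp
qed

definition holomorphic_fun :: "(cp1^'n::finite \<Rightarrow> complex) \<Rightarrow> bool" where
  "holomorphic_fun F \<longleftrightarrow> (\<forall>s z. chart_point s z \<in> PConf \<longrightarrow> cdiff (\<lambda>z. F (chart_point s z)) z)"

lemma holomorphic_fun_const: "holomorphic_fun (\<lambda>x. c)"
  by (simp add: holomorphic_fun_def cdiff_const)

lemma holomorphic_fun_divide:
  fixes F G :: "cp1^'n::finite \<Rightarrow> complex"
  assumes "holomorphic_fun F" "holomorphic_fun G" "\<And>x. x \<in> PConf \<Longrightarrow> G x \<noteq> 0"
  shows "holomorphic_fun (\<lambda>x. F x / G x)"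
  unfolding holomorphic_fun_def
proof (intro allI impI)
  fix s and z :: "complex^'n" assume z: "chart_point s z \<in> PConf"
  show "cdiff (\<lambda>z. F (chart_point s z) / G (chart_point s z)) z"
    using assms(1,2) z unfolding holomorphic_fun_def by (intro cdiff_divide assms(3)[OF z]) blast+
qed

lemma holomorphic_fun_cross_ratio:
  fixes a b c d :: "cp1^'n::finite \<Rightarrow> cp1"
  assumes hol: "holomorphic_cp1 a" "holomorphic_cp1 b" "holomorphic_cp1 c" "holomorphic_cp1 d"
    and ne: "\<And>x. x \<in> PConf \<Longrightarrow> a x \<noteq> d x" "\<And>x. x \<in> PConf \<Longrightarrow> c x \<noteq> b x"
  shows "holomorphic_fun (\<lambda>x. cross_ratio (a x) (b x) (c x) (d x))"
  unfolding holomorphic_fun_def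
proof (intro allI impI)
  fix s and z0 :: "complex^'n" assume z0: "chart_point s z0 \<in> PConf"
  obtain A where A: "\<forall>\<^sub>F z in nhds z0. A z \<noteq> 0 \<and> a (chart_point s z) = abs_cp1 (A z)" "\<And>k. cdiff (\<lambda>z. A z $ k) z0"
    using hol(1) z0 unfolding holomorphic_cp1_def by blast
  obtain B where B: "\<forall>\<^sub>F z in nhds z0. B z \<noteq> 0 \<and> b (chart_point s z) = abs_cp1 (B z)" "\<And>k. cdiff (\<lambda>z. B z $ k) z0"
    using hol(2) z0 unfolding holomorphic_cp1_def by blast
  obtain C where C: "\<forall>\<^sub>F z in nhds z0. C z \<noteq> 0 \<and> c (chart_point s z) = abs_cp1 (C z)" "\<And>k. cdiff (\<lambda>z. C z $ k) z0"
    using hol(3) z0 unfolding holomorphic_cp1_def by blast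
  obtain D where D: "\<forall>\<^sub>F z in nhds z0. D z \<noteq> 0 \<and> d (chart_point s z) = abs_cp1 (D z)" "\<And>k. cdiff (\<lambda>z. D z $ k) z0"
    using hol(4) z0 unfolding holomorphic_cp1_def by blast
  have at: "A z0 \<noteq> 0" "B z0 \<noteq> 0" "C z0 \<noteq> 0" "D z0 \<noteq> 0"
    "a (chart_point s z0) = abs_cp1 (A z0)" "b (chart_point s z0) = abs_cp1 (B z0)"
    "c (chart_point s z0) = abs_cp1 (C z0)" "d (chart_point s z0) = abs_cp1 (D z0)"
    using A(1) B(1) C(1) D(1) by (auto dest: eventually_nhds_x_imp_x)
  have br: "bracket (A z0) (D z0) \<noteq> 0" "bracket (C z0) (B z0) \<noteq> 0"
    using ne[OF z0] at abs_cp1_eq_iff by auto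
  show "cdiff (\<lambda>z. cross_ratio (a (chart_point s z)) (b (chart_point s z)) (c (chart_point s z)) (d (chart_point s z))) z0"
  proof (rule cdiff_cong)
    show "cdiff (\<lambda>z. (bracket (A z) (B z) * bracket (C z) (D z)) / (bracket (A z) (D z) * bracket (C z) (B z))) z0"
      using br by (intro cdiff_divide cdiff_mult cdiff_bracket A(2) B(2) C(2) D(2)) simp
    show "\<forall>\<^sub>F z in nhds z0. (bracket (A z) (B z) * bracket (C z) (D z)) / (bracket (A z) (D z) * bracket (C z) (B z)) =
        cross_ratio (a (chart_point s z)) (b (chart_point s z)) (c (chart_point s z)) (d (chart_point s z))"
      using A(1) B(1) C(1) D(1) by eventually_elim (simp add: cross_ratio_abs)
  qed
qed

section \<open>Finite configurations and limits at infinity\<close>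

text \<open>The chart index \<open>1\<close> is the one in which the affine coordinate \<open>c\<close> stands for the point with homogeneous
  coordinates \<open>1\<close> and \<open>c\<close>, so that all points are finite.\<close>

definition finite_config :: "('n::finite \<Rightarrow> complex) \<Rightarrow> cp1^'n" where
  "finite_config z = chart_point (\<lambda>_. 1) (\<chi> i. z i)"

text \<open>In the chart with index \<open>2\<close> the coordinate \<open>0\<close> is the point \<open>\<infinity>\<close> of the chart with index \<open>1\<close>; here the \<open>i\<close>-th
  point is placed there.\<close>

definition config_at_infinity :: "'n::finite \<Rightarrow> ('n \<Rightarrow> complex) \<Rightarrow> cp1^'n" where
  "config_at_infinity i z = chart_point ((\<lambda>_. 1)(i := 2)) (\<chi> j. (z(i := 0)) j)"

lemma bracket_affine_vec_1: "bracket (affine_vec 1 c) (affine_vec 1 d) = d - c"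
  by (simp add: bracket_def affine_vec_def)

lemma finite_config_in_PConf_iff: "finite_config z \<in> PConf \<longleftrightarrow> inj z"
proof -
  have "finite_config z \<in> PConf \<longleftrightarrow> (\<forall>i j. i \<noteq> j \<longrightarrow> z j - z i \<noteq> 0)"
    unfolding finite_config_def chart_point_in_PConf_iff by (simp add: bracket_affine_vec_1)
  also have "\<dots> \<longleftrightarrow> inj z" unfolding inj_def by (metis eq_iff_diff_eq_0)
  finally show ?thesis .
qed

lemma config_at_infinity_in_PConf:
  fixes z :: "'n::finite \<Rightarrow> complex"
  assumes "inj_on z (- {i})"
  shows "config_at_infinity i z \<in> PConf"
  unfolding config_at_infinity_def chart_point_in_PConf_iff
proof (intro allI impI)
  fix j k :: 'n assume "j \<noteq> k"
  have "z k \<noteq> z j" if "j \<noteq> i" "k \<noteq> i" using assms that \<open>j \<noteq> k\<close> by (auto dest: inj_onD)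
  then show "bracket (affine_vec (((\<lambda>_. 1)(i := 2)) j) ((\<chi> j. (z(i := 0)) j) $ j))
          (affine_vec (((\<lambda>_. 1)(i := 2)) k) ((\<chi> j. (z(i := 0)) j) $ k)) \<noteq> 0"
    using \<open>j \<noteq> k\<close> by (cases "j = i"; cases "k = i") (simp_all add: bracket_def affine_vec_def)
qed

lemma cross_ratio_finite_config:
  "cross_ratio (finite_config z $ i) (finite_config z $ j) (finite_config z $ k) (finite_config z $ l) =
    cratio (z i) (z j) (z k) (z l)"
proof -
  have "(z j - z i) * (z l - z k) = (z i - z j) * (z k - z l)"
    "(z l - z i) * (z j - z k) = (z i - z l) * (z k - z j)"
    by (simp_all add: algebra_simps)
  then show ?thesis
    by (simp add: finite_config_def chart_point_def cross_ratio_abs affine_vec_nonzero bracket_affine_vec_1 cratio_def)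
qed

lemma coordinate_line_eq: "(\<chi> j. (z(i := t)) j) = (\<chi> j. (z(i := 0)) j) + axis i t"
  for z :: "'n::finite \<Rightarrow> complex"
  by (simp add: vec_eq_iff axis_def)

lemma bounded_linear_axis: "bounded_linear (\<lambda>c::complex. (axis k c :: complex^'n::finite))"
  unfolding linear_conv_bounded_linear[symmetric]
  by (intro linearI) (simp_all add: vec_eq_iff axis_def)

lemma cdiff_imp_field_differentiable:
  fixes F :: "complex^'n::finite \<Rightarrow> complex"
  assumes "cdiff F (\<chi> j. (z(i := t)) j)"
  shows "(\<lambda>t. F (\<chi> j. (z(i := t)) j)) field_differentiable (at t)"
proof -
  obtain F' where F': "(F has_derivative F') (at (\<chi> j. (z(i := t)) j))" "\<And>c v. F' (c *s v) = c * F' v"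
    using assms unfolding cdiff_def by blast
  have "((\<lambda>t. (\<chi> j. (z(i := 0)) j) + axis i t) has_derivative (\<lambda>h. 0 + axis i h)) (at t)"
    by (intro has_derivative_add has_derivative_const
        bounded_linear.has_derivative[OF bounded_linear_axis has_derivative_ident])
  then have "((\<lambda>t. (\<chi> j. (z(i := t)) j)) has_derivative (\<lambda>h. axis i h)) (at t)"
    by (simp only: coordinate_line_eq[symmetric] add_0_left)
  from has_derivative_compose[OF this F'(1)]
  have "((\<lambda>t. F (\<chi> j. (z(i := t)) j)) has_derivative (\<lambda>h. F' (axis i h))) (at t)" .
  moreover have "F' (axis i h) = F' (axis i 1) * h" for h
  proof -
    have "axis i h = h *s axis i 1" by (simp add: vec_eq_iff axis_def)
    then show ?thesis using F'(2)[of h "axis i 1"] by simp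
  qed
  ultimately show ?thesis
    unfolding field_differentiable_def has_field_derivative_def by (metis (no_types, lifting) ext)
qed

text \<open>Replace the chart of the \<open>i\<close>-th point by the one around \<open>\<infinity>\<close>, in which its coordinate is \<open>1 / t\<close>.\<close>

lemma holomorphic_fun_tendsto_at_infinity:
  fixes F :: "cp1^'n::finite \<Rightarrow> complex"
  assumes F: "holomorphic_fun F" and z: "inj_on z (- {i})"
  shows "((\<lambda>t. F (finite_config (z(i := t)))) \<longlongrightarrow> F (config_at_infinity i z)) at_infinity"
proof -
  define s where "s = (\<lambda>_::'n. 1::2)(i := 2)"
  have "cdiff (\<lambda>w. F (chart_point s w)) (\<chi> j. (z(i := 0)) j)"
    using F config_at_infinity_in_PConf[OF z] unfolding holomorphic_fun_def config_at_infinity_def s_def by blast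
  from field_differentiable_imp_continuous_at[OF cdiff_imp_field_differentiable[OF this]]
  have "((\<lambda>t. F (chart_point s (\<chi> j. (z(i := t)) j))) \<longlongrightarrow> F (config_at_infinity i z)) (at 0)"
    unfolding isCont_def config_at_infinity_def s_def .
  moreover have "filterlim (\<lambda>t::complex. inverse t) (at 0) at_infinity"
    by (simp add: filterlim_at tendsto_inverse_0 eventually_not_equal_at_infinity)
  ultimately have "((\<lambda>t. F (chart_point s (\<chi> j. (z(i := inverse t)) j))) \<longlongrightarrow> F (config_at_infinity i z)) at_infinity"
    by (rule filterlim_compose)
  moreover have "\<forall>\<^sub>F t in at_infinity. F (chart_point s (\<chi> j. (z(i := inverse t)) j)) = F (finite_config (z(i := t)))"
    using eventually_not_equal_at_infinity[of 0]
  proof eventually_elim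
    case (elim t)
    have "abs_cp1 (affine_vec 2 (inverse t)) = abs_cp1 (affine_vec 1 t)"
      unfolding abs_cp1_eq_iff[OF affine_vec_nonzero affine_vec_nonzero]
      using elim by (simp add: bracket_def affine_vec_def)
    then have "chart_point s (\<chi> j. (z(i := inverse t)) j) = finite_config (z(i := t))"
      by (simp add: vec_eq_iff chart_point_def finite_config_def s_def)
    then show ?case by simp
  qed
  ultimately show ?thesis by (rule Lim_transform_eventually)
qed

lemma holomorphic_fun_omits_01:
  fixes F :: "cp1^'n::finite \<Rightarrow> complex"
  assumes F: "holomorphic_fun F" and om: "\<And>x. x \<in> PConf \<Longrightarrow> F x \<noteq> 0 \<and> F x \<noteq> 1"
  shows "omits_01 (\<lambda>z. F (finite_config z))"
  unfolding omits_01_def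
proof (intro allI impI conjI)
  fix i and z :: "'n \<Rightarrow> complex" assume z: "inj_on z (- {i})"
  have P: "finite_config (z(i := t)) \<in> PConf" if "t \<notin> z ` (- {i})" for t
    using z that unfolding finite_config_in_PConf_iff inj_fun_upd_iff by blast
  show "F (finite_config (z(i := t))) \<noteq> 0" "F (finite_config (z(i := t))) \<noteq> 1" if "t \<notin> z ` (- {i})" for t
    using om[OF P[OF that]] by auto
  show "\<exists>l. l \<noteq> 0 \<and> l \<noteq> 1 \<and> ((\<lambda>t. F (finite_config (z(i := t)))) \<longlongrightarrow> l) at_infinity"
    using holomorphic_fun_tendsto_at_infinity[OF F z] om[OF config_at_infinity_in_PConf[OF z]] by blast
  have "(\<lambda>t. F (finite_config (z(i := t)))) field_differentiable (at t)" if "t \<notin> z ` (- {i})" for t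
    unfolding finite_config_def
    by (rule cdiff_imp_field_differentiable)
      (use F P[OF that] in \<open>unfold holomorphic_fun_def finite_config_def, blast\<close>)
  then show "(\<lambda>t. F (finite_config (z(i := t)))) holomorphic_on - z ` (- {i})"
    unfolding holomorphic_on_def by (auto intro: field_differentiable_at_within)
qed

text \<open>At most one point of a configuration lies at \<open>\<infinity>\<close>, so every configuration is a limit of finite ones in which
  only one point moves.\<close>

lemma holomorphic_fun_determined_by_finite_configs:
  fixes F G :: "cp1^'n::finite \<Rightarrow> complex"
  assumes F: "holomorphic_fun F" and G: "holomorphic_fun G"
    and eq: "\<And>z. inj z \<Longrightarrow> F (finite_config z) = G (finite_config z)" and x: "x \<in> PConf"
  shows "F x = G x"
proof -
  define z where "z = (\<lambda>i. cp1_affine 1 (x $ i))"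
  have fin: "abs_cp1 (affine_vec 1 (z i)) = x $ i" if "cp1_nonzero 1 (x $ i)" for i
    unfolding z_def by (rule abs_affine_vec_cp1_affine[OF that])
  show ?thesis
  proof (cases "\<forall>i. cp1_nonzero 1 (x $ i)")
    case True
    then have "x = finite_config z" using fin by (simp add: vec_eq_iff finite_config_def chart_point_def)
    then show ?thesis using eq[of z] x finite_config_in_PConf_iff by metis
  next
    case False
    then obtain i where i: "\<not> cp1_nonzero 1 (x $ i)" by blast
    have inf: "u = abs_cp1 (affine_vec 2 0)" if "\<not> cp1_nonzero 1 u" for u
    proof -
      define v where "v = rep_cp1 u"
      have v: "v \<noteq> 0" "abs_cp1 v = u" by (simp_all add: v_def rep_cp1_nonzero abs_rep_cp1)
      then have "v $ 1 = 0" using that cp1_nonzero_abs[OF v(1)] by auto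
      then have "bracket v (affine_vec 2 0) = 0" by (simp add: bracket_def affine_vec_def)
      then show ?thesis using abs_cp1_eq_iff[OF v(1) affine_vec_nonzero] v(2) by blast
    qed
    have fin_j: "cp1_nonzero 1 (x $ j)" if "j \<noteq> i" for j
    proof (rule ccontr)
      assume "\<not> cp1_nonzero 1 (x $ j)"
      then have "x $ j = x $ i" using inf i by metis
      then show False using x that by (simp add: PConf_def inj_eq)
    qed
    have zi: "inj_on z (- {i})"
    proof (rule inj_onI)
      fix j k assume "j \<in> - {i}" "k \<in> - {i}" "z j = z k"
      then have "x $ j = x $ k" using fin fin_j by (metis ComplD singletonI)
      then show "j = k" using x by (simp add: PConf_def inj_eq)
    qed
    have xi: "x = config_at_infinity i z"
      unfolding vec_eq_iff config_at_infinity_def chart_point_def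
      using fin fin_j inf[OF i] by simp
    have "\<forall>\<^sub>F t in at_infinity. t \<notin> z ` (- {i})"
      using eventually_ball_finite[of "z ` (- {i})" "\<lambda>t y. t \<noteq> y" at_infinity]
      by (force elim: eventually_mono intro: eventually_not_equal_at_infinity)
    then have "\<forall>\<^sub>F t in at_infinity. F (finite_config (z(i := t))) = G (finite_config (z(i := t)))"
      by eventually_elim (use zi in \<open>auto intro!: eq simp: inj_fun_upd_iff\<close>)
    from Lim_transform_eventually[OF holomorphic_fun_tendsto_at_infinity[OF F zi] this]
    show ?thesis unfolding xi
      using holomorphic_fun_tendsto_at_infinity[OF G zi] tendsto_unique trivial_limit_at_infinity by blast
  qed
qed

section \<open>Holomorphic families of Moebius transformations\<close>

lemma cdiff_transport_matrix:
  assumes "\<And>k. cdiff (\<lambda>z. V1 z $ k) z0" "\<And>k. cdiff (\<lambda>z. V2 z $ k) z0" "\<And>k. cdiff (\<lambda>z. V3 z $ k) z0"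
    "\<And>k. cdiff (\<lambda>z. W1 z $ k) z0" "\<And>k. cdiff (\<lambda>z. W2 z $ k) z0" "\<And>k. cdiff (\<lambda>z. W3 z $ k) z0"
  shows "cdiff (\<lambda>z. transport_matrix (V1 z) (V2 z) (V3 z) (W1 z) (W2 z) (W3 z) $ i $ j) z0"
  unfolding transport_matrix_def vec_lambda_beta
  by (intro cdiff_diff cdiff_mult cdiff_bracket assms cdiff_const)

text \<open>In local lifts the transport matrix is differentiable. Lifts and chosen representatives differ by scalars,
  and by homogeneity this only multiplies the matrix by a scalar, which does not affect the charts of
  the projective linear group.\<close>

theorem ex_holomorphic_moebius_transport:
  fixes u1 u2 u3 q1 q2 q3 :: "cp1^'n::finite \<Rightarrow> cp1"
  assumes hol: "holomorphic_cp1 u1" "holomorphic_cp1 u2" "holomorphic_cp1 u3"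
      "holomorphic_cp1 q1" "holomorphic_cp1 q2" "holomorphic_cp1 q3"
    and du: "\<And>x. x \<in> PConf \<Longrightarrow> distinct [u1 x, u2 x, u3 x]"
    and dq: "\<And>x. x \<in> PConf \<Longrightarrow> distinct [q1 x, q2 x, q3 x]"
  shows "\<exists>A. holomorphic_map PConf_atlas psl2_atlas A \<and>
    (\<forall>x\<in>PConf. moebius (A x) (u1 x) = q1 x \<and> moebius (A x) (u2 x) = q2 x \<and> moebius (A x) (u3 x) = q3 x)"
proof -
  define B where "B = (\<lambda>x. transport_matrix (rep_cp1 (u1 x)) (rep_cp1 (u2 x)) (rep_cp1 (u3 x))
    (rep_cp1 (q1 x)) (rep_cp1 (q2 x)) (rep_cp1 (q3 x)))"
  define A where "A = (\<lambda>x. psl2_of (B x))"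
  have maps: "det (B x) \<noteq> 0" "moebius (A x) (u1 x) = q1 x" "moebius (A x) (u2 x) = q2 x" "moebius (A x) (u3 x) = q3 x"
    if "x \<in> PConf" for x
    using transport_matrix_maps[of "rep_cp1 (u1 x)" "rep_cp1 (u2 x)" "rep_cp1 (u3 x)"
      "rep_cp1 (q1 x)" "rep_cp1 (q2 x)" "rep_cp1 (q3 x)"] du[OF that] dq[OF that]
    unfolding A_def B_def abs_rep_cp1 by (simp_all add: rep_cp1_nonzero)
  have loc: "\<exists>M :: complex^'n \<Rightarrow> complex^2^2. (\<forall>a b. cdiff (\<lambda>z. M z $ a $ b) z0) \<and>
      (\<forall>\<^sub>F z in nhds z0. chart_point s z \<in> PConf \<and> (\<exists>k. k \<noteq> 0 \<and> (\<forall>a b. B (chart_point s z) $ a $ b = k * M z $ a $ b)))"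
    if z0: "chart_point s z0 \<in> PConf" for s and z0 :: "complex^'n"
  proof -
    have lift: "\<exists>V. (\<forall>\<^sub>F z in nhds z0. \<exists>c. c \<noteq> 0 \<and> rep_cp1 (u (chart_point s z)) = c *s V z) \<and>
        (\<forall>k. cdiff (\<lambda>z. V z $ k) z0)" if u: "holomorphic_cp1 u" for u
    proof -
      obtain V where V: "\<forall>\<^sub>F z in nhds z0. V z \<noteq> 0 \<and> u (chart_point s z) = abs_cp1 (V z)"
        "\<forall>k. cdiff (\<lambda>z. V z $ k) z0" using u z0 unfolding holomorphic_cp1_def by blast
      from V(1) have "\<forall>\<^sub>F z in nhds z0. \<exists>c. c \<noteq> 0 \<and> rep_cp1 (u (chart_point s z)) = c *s V z"
        by eventually_elim (simp add: rep_abs_cp1)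
      then show ?thesis using V(2) by blast
    qed
    obtain V1 where V1: "\<forall>\<^sub>F z in nhds z0. \<exists>c. c \<noteq> 0 \<and> rep_cp1 (u1 (chart_point s z)) = c *s V1 z"
      "\<And>k. cdiff (\<lambda>z. V1 z $ k) z0" using lift[OF hol(1)] by blast
    obtain V2 where V2: "\<forall>\<^sub>F z in nhds z0. \<exists>c. c \<noteq> 0 \<and> rep_cp1 (u2 (chart_point s z)) = c *s V2 z"
      "\<And>k. cdiff (\<lambda>z. V2 z $ k) z0" using lift[OF hol(2)] by blast
    obtain V3 where V3: "\<forall>\<^sub>F z in nhds z0. \<exists>c. c \<noteq> 0 \<and> rep_cp1 (u3 (chart_point s z)) = c *s V3 z"
      "\<And>k. cdiff (\<lambda>z. V3 z $ k) z0" using lift[OF hol(3)] by blast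
    obtain W1 where W1: "\<forall>\<^sub>F z in nhds z0. \<exists>c. c \<noteq> 0 \<and> rep_cp1 (q1 (chart_point s z)) = c *s W1 z"
      "\<And>k. cdiff (\<lambda>z. W1 z $ k) z0" using lift[OF hol(4)] by blast
    obtain W2 where W2: "\<forall>\<^sub>F z in nhds z0. \<exists>c. c \<noteq> 0 \<and> rep_cp1 (q2 (chart_point s z)) = c *s W2 z"
      "\<And>k. cdiff (\<lambda>z. W2 z $ k) z0" using lift[OF hol(5)] by blast
    obtain W3 where W3: "\<forall>\<^sub>F z in nhds z0. \<exists>c. c \<noteq> 0 \<and> rep_cp1 (q3 (chart_point s z)) = c *s W3 z"
      "\<And>k. cdiff (\<lambda>z. W3 z $ k) z0" using lift[OF hol(6)] by blast
    define M where "M = (\<lambda>z. transport_matrix (V1 z) (V2 z) (V3 z) (W1 z) (W2 z) (W3 z))"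
    have "\<forall>a b. cdiff (\<lambda>z. M z $ a $ b) z0"
      unfolding M_def by (intro allI cdiff_transport_matrix V1(2) V2(2) V3(2) W1(2) W2(2) W3(2))
    moreover have "\<forall>\<^sub>F z in nhds z0. chart_point s z \<in> PConf \<and>
        (\<exists>k. k \<noteq> 0 \<and> (\<forall>a b. B (chart_point s z) $ a $ b = k * M z $ a $ b))"
      using eventually_chart_point_in_PConf[OF z0] V1(1) V2(1) V3(1) W1(1) W2(1) W3(1)
    proof eventually_elim
      case (elim z)
      then obtain a b c d e f where "a \<noteq> 0" "b \<noteq> 0" "c \<noteq> 0" "d \<noteq> 0" "e \<noteq> 0" "f \<noteq> 0"
        "rep_cp1 (u1 (chart_point s z)) = a *s V1 z" "rep_cp1 (u2 (chart_point s z)) = b *s V2 z"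
        "rep_cp1 (u3 (chart_point s z)) = c *s V3 z" "rep_cp1 (q1 (chart_point s z)) = d *s W1 z"
        "rep_cp1 (q2 (chart_point s z)) = e *s W2 z" "rep_cp1 (q3 (chart_point s z)) = f *s W3 z" by blast
      then have "a * b * c * d * e * f \<noteq> 0"
        "\<forall>i j. B (chart_point s z) $ i $ j = (a * b * c * d * e * f) * M z $ i $ j"
        unfolding B_def M_def by (simp_all only: transport_matrix_scale) simp_all
      then show ?case using elim(1) by blast
    qed
    ultimately show ?thesis by blast
  qed
  have "holomorphic_map PConf_atlas psl2_atlas A"
    unfolding holomorphic_map_from_PConf_iff
  proof (intro conjI allI ballI)
    show "A ` PConf \<subseteq> atlas_carrier psl2_atlas"
      using psl2_has_nonzero_entry by (auto simp: atlas_carrier_def psl2_atlas_def)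
  next
    fix s :: "'n \<Rightarrow> 2" and C :: "(psl2, 3) chart" assume "C \<in> psl2_atlas"
    then obtain i j where C: "C = ({g. psl2_nonzero i j g}, psl2_affine i j)" by (auto simp: psl2_atlas_def)
    define S where "S = {z. chart_point s z \<in> PConf \<and> psl2_nonzero i j (A (chart_point s z))}"
    have key: "(\<forall>\<^sub>F z in nhds z0. z \<in> S) \<and> (\<forall>k. cdiff (\<lambda>z. psl2_affine i j (A (chart_point s z)) $ k) z0)"
      if z0: "z0 \<in> S" for z0
    proof -
      have P: "chart_point s z0 \<in> PConf" using z0 by (simp add: S_def)
      obtain M where M: "\<And>a b. cdiff (\<lambda>z. M z $ a $ b) z0"
        "\<forall>\<^sub>F z in nhds z0. chart_point s z \<in> PConf \<and> (\<exists>k. k \<noteq> 0 \<and> (\<forall>a b. B (chart_point s z) $ a $ b = k * M z $ a $ b))"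
        using loc[OF P] by blast
      have ev: "\<forall>\<^sub>F z in nhds z0. chart_point s z \<in> PConf \<and> (psl2_nonzero i j (A (chart_point s z)) \<longleftrightarrow> M z $ i $ j \<noteq> 0) \<and>
          psl2_affine i j (A (chart_point s z)) = vector [M z $ i $ (j + 1) / M z $ i $ j,
            M z $ (i + 1) $ j / M z $ i $ j, M z $ (i + 1) $ (j + 1) / M z $ i $ j]"
        using M(2)
      proof eventually_elim
        case (elim z)
        then obtain k where k: "k \<noteq> 0" "\<And>a b. B (chart_point s z) $ a $ b = k * M z $ a $ b" by blast
        show ?case using elim k maps(1) by (simp add: A_def psl2_nonzero_of psl2_affine_of)
      qed
      have M0: "M z0 $ i $ j \<noteq> 0" using eventually_nhds_x_imp_x[OF ev] z0 by (simp add: S_def)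
      have "\<forall>\<^sub>F z in nhds z0. M z $ i $ j \<noteq> 0" by (rule cdiff_eventually_nonzero[OF M(1) M0])
      with ev have 1: "\<forall>\<^sub>F z in nhds z0. z \<in> S" by eventually_elim (simp add: S_def)
      have "cdiff (\<lambda>z. (vector [M z $ i $ (j + 1) / M z $ i $ j,
            M z $ (i + 1) $ j / M z $ i $ j, M z $ (i + 1) $ (j + 1) / M z $ i $ j] :: complex^3) $ k) z0" for k
        using exhaust_3[of k] M0 by (auto intro!: cdiff_divide M(1))
      then have "cdiff (\<lambda>z. psl2_affine i j (A (chart_point s z)) $ k) z0" for k
        by (rule cdiff_cong) (use ev in \<open>eventually_elim, simp\<close>)
      then show ?thesis using 1 by blast
    qed
    have "open S" using key by (intro open_if_eventually_mem) blast
    moreover from this have "holomorphic_vec_on (\<lambda>z. psl2_affine i j (A (chart_point s z))) S"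
      using key by (simp add: holomorphic_vec_on_iff_cdiff)
    ultimately show "case C of (V, \<psi>) \<Rightarrow> open {z. chart_point s z \<in> PConf \<and> A (chart_point s z) \<in> V} \<and>
        holomorphic_vec_on (\<lambda>z. \<psi> (A (chart_point s z))) {z. chart_point s z \<in> PConf \<and> A (chart_point s z) \<in> V}"
      unfolding C S_def by simp
  qed
  then show ?thesis using maps by blast
qed

section \<open>Holomorphic maps between configuration spaces\<close>

text \<open>Send each element to the element of the same rank.\<close>

lemma ex_initial_embedding:
  assumes "CARD('m::{finite,linorder}) \<le> CARD('n::{finite,linorder})"
  shows "\<exists>\<iota>::'m \<Rightarrow> 'n. initial_embedding \<iota>"
proof -
  define xs where "xs = sorted_list_of_set (UNIV :: 'n set)"
  have xs: "sorted_wrt (<) xs" "set xs = UNIV" "length xs = CARD('n)"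
    by (simp_all add: xs_def)
  define rank where "rank = (\<lambda>k::'m. card {..<k})"
  have rank_mono: "rank k < rank l" if "k < l" for k l
    unfolding rank_def using that by (intro psubset_card_mono) auto
  have rank_less: "rank k < CARD('m)" for k
    unfolding rank_def by (intro psubset_card_mono) auto
  have "inj rank" using rank_mono by (metis injI linorder_neqE nat_neq_iff)
  then have "card (range rank) = CARD('m)" by (rule card_image)
  then have rank_onto: "range rank = {..<CARD('m)}"
    using rank_less by (intro card_subset_eq) auto
  define \<iota> where "\<iota> = (\<lambda>k. xs ! rank k)"
  have "strict_mono \<iota>"
  proof (rule strict_monoI)
    fix k l :: 'm assume "k < l"
    then show "\<iota> k < \<iota> l"
      unfolding \<iota>_def using rank_mono rank_less[of l] assms xs
      by (intro sorted_wrt_nth_less[OF xs(1)]) auto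
  qed
  moreover have "k \<in> range \<iota>" if "k \<le> \<iota> i" for i k
  proof -
    obtain d where d: "d < length xs" "k = xs ! d" using xs(2) by (metis UNIV_I in_set_conv_nth)
    have "d \<le> rank i"
    proof (rule ccontr)
      assume "\<not> d \<le> rank i"
      then have "\<iota> i < k" unfolding \<iota>_def d(2) using d by (intro sorted_wrt_nth_less[OF xs(1)]) auto
      then show False using that by simp
    qed
    then have "d \<in> range rank" using rank_less[of i] by (simp add: rank_onto)
    then show ?thesis using d by (auto simp: \<iota>_def)
  qed
  ultimately show ?thesis unfolding initial_embedding_def by blast
qed

lemma ex_bij_between_embeddings:
  fixes \<iota> \<kappa> :: "'m \<Rightarrow> 'n::finite"
  assumes "inj \<iota>" "inj \<kappa>"
  shows "\<exists>\<sigma>. bij \<sigma> \<and> (\<forall>k. \<sigma> (\<iota> k) = \<kappa> k)"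
proof -
  have "card (range \<iota>) = card (range \<kappa>)"
    using card_image[OF assms(1)] card_image[OF assms(2)] by simp
  then have "card (- range \<iota>) = card (- range \<kappa>)" by (simp add: Compl_eq_Diff_UNIV card_Diff_subset)
  then obtain \<tau> where \<tau>: "bij_betw \<tau> (- range \<iota>) (- range \<kappa>)"
    using finite_same_card_bij[of "- range \<iota>" "- range \<kappa>"] by auto
  define \<sigma> where "\<sigma> = (\<lambda>x. if x \<in> range \<iota> then \<kappa> (inv \<iota> x) else \<tau> x)"
  have on: "\<sigma> (\<iota> k) = \<kappa> k" for k using assms(1) by (simp add: \<sigma>_def)
  have "bij_betw \<sigma> (range \<iota>) (range \<kappa>)"
    unfolding bij_betw_def
  proof
    show "inj_on \<sigma> (range \<iota>)"
    proof (rule inj_onI)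
      fix x y assume "x \<in> range \<iota>" "y \<in> range \<iota>" "\<sigma> x = \<sigma> y"
      then show "x = y" using on injD[OF assms(2)] by (metis imageE)
    qed
    show "\<sigma> ` range \<iota> = range \<kappa>" unfolding image_image on ..
  qed
  moreover have "bij_betw \<sigma> (- range \<iota>) (- range \<kappa>)"
    using \<tau> by (rule bij_betw_cong[THEN iffD1, rotated]) (simp add: \<sigma>_def)
  ultimately have "bij_betw \<sigma> (range \<iota> \<union> - range \<iota>) (range \<kappa> \<union> - range \<kappa>)"
    by (rule bij_betw_combine) simp
  then show ?thesis using on by auto
qed

text \<open>The twist takes \<open>h\<^sub>p, h\<^sub>q, h\<^sub>r\<close> to prescribed points: three constants if all cross-ratios are constant,
  three points of the configuration otherwise. The other coordinates follow, because three points and the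
  cross-ratio determine the fourth. In the second case this exhibits \<open>h\<close> as the selection of coordinates along
  an injection \<open>\<iota>\<close> of index types, and the permutation \<open>\<sigma>\<close> turns \<open>\<iota>\<close> into an initial segment.\<close>

theorem theorem4p4:
  fixes h :: "cp1^'n::{finite,linorder} \<Rightarrow> cp1^'m::{finite,linorder}"
  assumes "CARD('m) \<ge> 3"
    and "holomorphic_map PConf_atlas PConf_atlas h"
  shows "\<exists>(\<sigma>::'n \<Rightarrow> 'n) A.
           bij \<sigma> \<and> holomorphic_map PConf_atlas psl2_atlas A \<and>
           (twist A (h \<circ> permute_coords \<sigma>) constant_on PConf \<or>
            forgetful_on_PConf (twist A (h \<circ> permute_coords \<sigma>)))"
proof -
  define u where "u = (\<lambda>k x. h x $ k)"
  have u: "holomorphic_cp1 (u k)" for k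
    unfolding u_def by (rule holomorphic_cp1_component[OF assms(2)])
  have hP: "h x \<in> PConf" if "x \<in> PConf" for x
    using assms(2) that unfolding holomorphic_map_from_PConf_iff atlas_carrier_PConf by blast
  have u_eq: "u k x = u l x \<longleftrightarrow> k = l" if "x \<in> PConf" for k l x
    using hP[OF that] by (auto simp: PConf_def u_def inj_eq)
  obtain S :: "'m set" where "card S = 3" using obtain_subset_with_card_n[OF assms(1)] by metis
  then obtain p q r :: 'm where pqr: "p \<noteq> q" "p \<noteq> r" "q \<noteq> r" by (auto simp: card_3_iff)
  define J where "J = - {p, q, r}"
  define F where "F = (\<lambda>j x. cross_ratio (u p x) (u q x) (u r x) (u j x))"
  have dist: "distinct [u p x, u q x, u r x, u j x]" if "x \<in> PConf" "j \<in> J" for x j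
    using pqr that by (auto simp: u_eq J_def)
  have F: "holomorphic_fun (F j)" if "j \<in> J" for j
    unfolding F_def by (intro holomorphic_fun_cross_ratio u) (use pqr that in \<open>auto simp: u_eq J_def\<close>)
  have F01: "F j x \<noteq> 0 \<and> F j x \<noteq> 1" if "x \<in> PConf" "j \<in> J" for j x
    using cross_ratio_omits_01[OF dist[OF that]] by (simp add: F_def)
  \<comment> \<open>Equality would mean that two points of the image configuration coincide.\<close>
  have F_ne: "F j x \<noteq> F k x" if "x \<in> PConf" "j \<in> J" "k \<in> J" "j \<noteq> k" for j k x
    using cross_ratio_inject[OF dist[OF that(1,2)] dist[OF that(1,3)]] that by (auto simp: F_def u_eq)
  have om: "omits_01 (\<lambda>z. F j (finite_config z))" if "j \<in> J" for j
    using F[OF that] F01 that by (intro holomorphic_fun_omits_01) auto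
  have om2: "omits_01 (\<lambda>z. F j (finite_config z) / F k (finite_config z))"
    if "j \<in> J" "k \<in> J" "j \<noteq> k" for j k
    using F F01 F_ne that by (intro holomorphic_fun_omits_01[of "\<lambda>x. F j x / F k x"] holomorphic_fun_divide) auto
  show ?thesis
  proof (cases "\<forall>j\<in>J. \<exists>c. \<forall>z. inj z \<longrightarrow> F j (finite_config z) = c")
    case True
    then obtain c where c: "\<And>j z. j \<in> J \<Longrightarrow> inj z \<Longrightarrow> F j (finite_config z) = c j" by metis
    have Fc: "F j x = c j" if "x \<in> PConf" "j \<in> J" for x j
      by (rule holomorphic_fun_determined_by_finite_configs[OF F[OF that(2)] holomorphic_fun_const _ that(1)])
        (rule c[OF that(2)])
    define o0 o1 o2 where "o0 = abs_cp1 (affine_vec 1 0)" and "o1 = abs_cp1 (affine_vec 1 1)"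
      and "o2 = abs_cp1 (affine_vec 2 0)"
    have o: "distinct [o0, o1, o2]"
      by (simp add: o0_def o1_def o2_def abs_cp1_eq_iff affine_vec_nonzero bracket_def) (simp add: affine_vec_def)
    obtain A where A: "holomorphic_map PConf_atlas psl2_atlas A"
      "\<And>x. x \<in> PConf \<Longrightarrow> moebius (A x) (u p x) = o0 \<and> moebius (A x) (u q x) = o1 \<and> moebius (A x) (u r x) = o2"
      using ex_holomorphic_moebius_transport[OF u u u holomorphic_cp1_const holomorphic_cp1_const holomorphic_cp1_const,
          of p q r o0 o1 o2] o dist pqr u_eq by auto
    have same: "moebius (A x) (u k x) = moebius (A y) (u k y)" if xy: "x \<in> PConf" "y \<in> PConf" for x y k
    proof (cases "k \<in> J")
      case False
      then show ?thesis using A(2)[OF xy(1)] A(2)[OF xy(2)] by (auto simp: J_def)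
    next
      case True
      have "distinct [o0, o1, o2, moebius (A x) (u k x)]" if "x \<in> PConf" for x
        using dist[OF that True] A(2)[OF that] o moebius_inject[of "A x"] by auto
      moreover have "cross_ratio o0 o1 o2 (moebius (A x) (u k x)) = c k" if "x \<in> PConf" for x
        using moebius_cross_ratio[of "A x" "u p x" "u q x" "u r x" "u k x"] A(2)[OF that] Fc[OF that True]
        by (simp add: F_def)
      ultimately show ?thesis using cross_ratio_inject xy by metis
    qed
    have "twist A (h \<circ> permute_coords id) x = twist A (h \<circ> permute_coords id) y"
      if "x \<in> PConf" "y \<in> PConf" for x y
    proof -
      have "twist A (h \<circ> permute_coords id) x = (\<chi> k. moebius (A x) (u k x))" for x
        by (simp add: twist_def moebius_diag_def permute_coords_def u_def)
      then show ?thesis using same[OF that] by simp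
    qed
    then have "twist A (h \<circ> permute_coords id) constant_on PConf"
      unfolding constant_on_def by metis
    then show ?thesis using A(1) bij_id by blast
  next
    case False
    then obtain j0 where j0: "j0 \<in> J" "\<And>c. \<exists>z. inj z \<and> F j0 (finite_config z) \<noteq> c" by blast
    have "\<exists>a b c d. distinct [a, b, c, d] \<and>
        (\<forall>z. inj z \<longrightarrow> F j (finite_config z) = cratio (z a) (z b) (z c) (z d))" if j: "j \<in> J" for j
    proof -
      obtain a b c d where abcd: "distinct [a, b, c, d]"
        "\<And>z. inj z \<Longrightarrow> F j0 (finite_config z) = cratio (z a) (z b) (z c) (z d)"
        using omits_01_classification[OF om[OF j0(1)]] j0(2) by metis
      \<comment> \<open>A constant value would be attained by the nonconstant function F j0, against the injectivity of the image configurations.\<close>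
      have "\<nexists>e. \<forall>z. inj z \<longrightarrow> F j (finite_config z) = e"
      proof
        assume "\<exists>e. \<forall>z. inj z \<longrightarrow> F j (finite_config z) = e"
        then obtain e where e: "\<And>z. inj z \<Longrightarrow> F j (finite_config z) = e" by blast
        have ne: "j \<noteq> j0" using e j0(2)[of e] by auto
        obtain z0 :: "'n \<Rightarrow> complex" where "inj z0" using ex_inj_complex by blast
        then have "e \<noteq> 0" "e \<noteq> 1" using omits_01_nonzero[OF om[OF j]] e by metis+
        from cratio_surjective[OF abcd(1) this]
        obtain z where z: "inj z" "cratio (z a) (z b) (z c) (z d) = e" by blast
        then have "F j (finite_config z) = F j0 (finite_config z)" using e abcd(2) by simp
        then show False using F_ne[of "finite_config z" j j0] z(1) j j0(1) ne
          by (simp add: finite_config_in_PConf_iff)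
      qed
      then show ?thesis using omits_01_classification[OF om[OF j]] by blast
    qed
    then obtain a b c d where abcd: "\<And>j. j \<in> J \<Longrightarrow> distinct [a j, b j, c j, d j]"
      "\<And>j z. j \<in> J \<Longrightarrow> inj z \<Longrightarrow> F j (finite_config z) = cratio (z (a j)) (z (b j)) (z (c j)) (z (d j))"
      by metis
    have "omits_01 (\<lambda>z. cratio (z (a j)) (z (b j)) (z (c j)) (z (d j)) /
        cratio (z (a k)) (z (b k)) (z (c k)) (z (d k)))" if jk: "j \<in> J" "k \<in> J" "j \<noteq> k" for j k
      by (rule omits_01_cong[OF om2[OF jk]]) (simp add: abcd(2) jk)
    from cratio_family_common_triple[of J a b c d, OF _ abcd(1) this] j0(1)
    obtain p' q' r' e where e: "\<And>j. j \<in> J \<Longrightarrow> distinct [p', q', r', e j]"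
      "\<And>j. j \<in> J \<Longrightarrow> (p', q', r', e j) \<in> klein (a j) (b j) (c j) (d j)" by blast
    have Fe: "F j x = cross_ratio (x $ p') (x $ q') (x $ r') (x $ e j)" if j: "j \<in> J" and x: "x \<in> PConf" for j x
    proof (rule holomorphic_fun_determined_by_finite_configs[OF F[OF j] _ _ x])
      show "holomorphic_fun (\<lambda>x. cross_ratio (x $ p') (x $ q') (x $ r') (x $ e j))"
        using e(1)[OF j]
        by (intro holomorphic_fun_cross_ratio holomorphic_cp1_nth) (auto simp: PConf_def inj_eq)
      show "F j (finite_config z) = cross_ratio (finite_config z $ p') (finite_config z $ q')
          (finite_config z $ r') (finite_config z $ e j)" if "inj z" for z
        unfolding cross_ratio_finite_config abcd(2)[OF j that]
        by (rule cratio_klein_invariant[OF e(2)[OF j], symmetric])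
    qed
    obtain z0 :: "'n \<Rightarrow> complex" where "inj z0" using ex_inj_complex by blast
    then have x0: "finite_config z0 \<in> PConf" by (simp add: finite_config_in_PConf_iff)
    define \<iota> where "\<iota> = (\<lambda>k. if k = p then p' else if k = q then q' else if k = r then r' else e k)"
    have \<iota>: "\<iota> p = p'" "\<iota> q = q'" "\<iota> r = r'" "\<And>j. j \<in> J \<Longrightarrow> \<iota> j = e j"
      using pqr by (auto simp: \<iota>_def J_def)
    have e_inj: "j = k" if "j \<in> J" "k \<in> J" "e j = e k" for j k
      using F_ne[OF x0 that(1,2)] Fe[OF that(1) x0] Fe[OF that(2) x0] that(3) by auto
    have "inj \<iota>"
    proof (rule injI)
      fix j k assume eq: "\<iota> j = \<iota> k"
      have d: "p' \<noteq> q'" "p' \<noteq> r'" "q' \<noteq> r'" using e(1)[OF j0(1)] by auto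
      have d2: "e j \<noteq> p'" "e j \<noteq> q'" "e j \<noteq> r'" if "j \<in> J" for j using e(1)[OF that] by auto
      have "j \<in> J \<or> j = p \<or> j = q \<or> j = r" "k \<in> J \<or> k = p \<or> k = q \<or> k = r" by (auto simp: J_def)
      then show "j = k" using eq d d2 \<iota> e_inj by metis
    qed
    have "CARD('m) \<le> CARD('n)" using card_inj_on_le[OF \<open>inj \<iota>\<close>, of UNIV] by simp
    then obtain \<kappa> :: "'m \<Rightarrow> 'n" where \<kappa>: "initial_embedding \<kappa>" using ex_initial_embedding by blast
    then have "inj \<kappa>" unfolding initial_embedding_def by (simp add: strict_mono_imp_inj_on)
    from ex_bij_between_embeddings[OF \<open>inj \<iota>\<close> this]
    obtain \<sigma> where \<sigma>: "bij \<sigma>" "\<And>k. \<sigma> (\<iota> k) = \<kappa> k" by blast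
    define v where "v = (\<lambda>k x. u k (permute_coords \<sigma> x))"
    have v: "holomorphic_cp1 (v k)" for k unfolding v_def by (rule holomorphic_cp1_permute[OF u \<sigma>(1)])
    have perm: "permute_coords \<sigma> x \<in> PConf" if "x \<in> PConf" for x
      by (rule permute_coords_in_PConf[OF \<sigma>(1) that])
    have nth: "permute_coords \<sigma> x $ \<iota> k = x $ \<kappa> k" for x k by (simp add: permute_coords_def \<sigma>(2))
    have \<kappa>_ne: "x $ \<kappa> k = x $ \<kappa> l \<longleftrightarrow> k = l" if "x \<in> PConf" for x k l
      using that \<open>inj \<kappa>\<close> by (simp add: PConf_def inj_eq)
    have dv: "distinct [v p x, v q x, v r x]" if "x \<in> PConf" for x
      using u_eq[OF perm[OF that]] pqr by (simp add: v_def)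
    have dk: "distinct [x $ \<kappa> p, x $ \<kappa> q, x $ \<kappa> r]" if "x \<in> PConf" for x
      using \<kappa>_ne[OF that] pqr by simp
    obtain A where A: "holomorphic_map PConf_atlas psl2_atlas A"
      "\<And>x. x \<in> PConf \<Longrightarrow> moebius (A x) (v p x) = x $ \<kappa> p \<and> moebius (A x) (v q x) = x $ \<kappa> q \<and> moebius (A x) (v r x) = x $ \<kappa> r"
      using ex_holomorphic_moebius_transport[OF v v v holomorphic_cp1_nth holomorphic_cp1_nth holomorphic_cp1_nth dv dk]
      by blast
    have main: "moebius (A x) (v k x) = x $ \<kappa> k" if x: "x \<in> PConf" for x k
    proof (cases "k \<in> J")
      case False
      then show ?thesis using A(2)[OF x] by (auto simp: J_def)
    next
      case True
      have "distinct [x $ \<kappa> p, x $ \<kappa> q, x $ \<kappa> r, moebius (A x) (v k x)]"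
        using dist[OF perm[OF x] True] A(2)[OF x] dk[OF x] moebius_inject[of "A x" "v _ x" "v k x"]
        by (auto simp: v_def)
      moreover have "distinct [x $ \<kappa> p, x $ \<kappa> q, x $ \<kappa> r, x $ \<kappa> k]"
        using \<kappa>_ne[OF x] pqr True by (auto simp: J_def)
      moreover have "cross_ratio (x $ \<kappa> p) (x $ \<kappa> q) (x $ \<kappa> r) (moebius (A x) (v k x)) =
          cross_ratio (x $ \<kappa> p) (x $ \<kappa> q) (x $ \<kappa> r) (x $ \<kappa> k)"
        using moebius_cross_ratio[of "A x" "v p x" "v q x" "v r x" "v k x"] A(2)[OF x]
          Fe[OF True perm[OF x], unfolded \<iota>[symmetric] \<iota>(4)[OF True, symmetric] nth]
        by (simp add: F_def v_def)
      ultimately show ?thesis by (rule cross_ratio_inject)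
    qed
    have "forgetful_on_PConf (twist A (h \<circ> permute_coords \<sigma>))"
      unfolding forgetful_on_PConf_def
    proof (intro exI[of _ \<kappa>] conjI ballI \<kappa>)
      fix x :: "(cp1, 'n) vec" assume "x \<in> PConf"
      from main[OF this] show "twist A (h \<circ> permute_coords \<sigma>) x = (\<chi> i. x $ \<kappa> i)"
        by (simp add: twist_def moebius_diag_def v_def u_def)
    qed
    then show ?thesis using \<sigma>(1) A(1) by blast
  qed
qed

end
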